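(* Let $\mathcal{B}$ be a $C^*$-algebra, let $E$ be a Hilbert $\mathcal{B}$-module, and let $s=\{s_t\}_{t\ge 0}$ be a pure strongly continuous semigroup of adjointable isometries on $E$. Then there is a Hilbert $\mathcal{B}$-module $F$ such that $s$ is unitarily equivalent to the standard right shift $v=\{v_t\}_{t\ge0}$ on $L^2(\mathbb{R}_+,F)$; that is, there is a unitary $V\colon L^2(\mathbb{R}_+,F)\to E$ such that $s_t=Vv_tV^*$ for all $t\ge 0$.
   Context: A family $s=\{s_t\}_{t\ge 0}$ of linear maps on $E$ is a semigroup if $s_rs_t=s_{r+t}$ for all $r,t\ge0$ and $s_0=\mathrm{id}$; it is strongly continuous if $t\mapsto s_tx$ is norm continuous for every $x\in E$. A linear map $s$ between Hilbert $\mathcal{B}$-modules is an isometry if $\langle sx,sy\rangle=\langle x,y\rangle$ for all $x,y$; a unitary is a surjective isometry. A semigroup of adjointable isometries on $E$ is pure if $s_t^*x\to 0$ in norm as $t\to\infty$ for every $x\in E$. For a Hilbert $\mathcal{B}$-module $F$, $L^2(\mathbb{R}_+,F):=L^2(\mathbb{R}_+)\otimes F$ is the external tensor product of the Hilbert $\mathbb{C}$-module $L^2(\mathbb{R}_+)$ and $F$ (equivalently, the completion of the linear span of the functions $x\mapsto h(x)y$, $h\in C_c(\mathbb{R}_+)$, $y\in F$, with respect to the inner product $\langle f,g\rangle=\int\langle f(x),g(x)\rangle\,dx$). The standard right shift over $F$ is the semigroup of isometries $v_t$ on $L^2(\mathbb{R}_+,F)$ given by $[v_tf](x)=f(x-t)$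 for $x\ge t$ and $[v_tf](x)=0$ otherwise. *)

theory Defs
  imports "HOL-Analysis.Analysis" "HOL-Algebra.Module"
begin

section \<open>C*-algebras\<close>

text \<open>Complex Banach algebras with involution satisfying the C*-identity; a unit is not assumed.\<close>

class cstar_algebra = real_normed_algebra + banach +
  fixes scaleC :: "complex \<Rightarrow> 'a \<Rightarrow> 'a"
    and star :: "'a \<Rightarrow> 'a"
  assumes scaleC_add_right: "scaleC c (a + b) = scaleC c a + scaleC c b"
    and scaleC_add_left: "scaleC (c + d) a = scaleC c a + scaleC d a"
    and scaleC_scaleC: "scaleC c (scaleC d a) = scaleC (c * d) a"
    and scaleC_of_real: "scaleC (complex_of_real r) a = r *\<^sub>R a"
    and scaleC_mult_left: "scaleC c a * b = scaleC c (a * b)"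
    and scaleC_mult_right: "a * scaleC c b = scaleC c (a * b)"
    and norm_scaleC: "norm (scaleC c a) = cmod c * norm a"
    and star_star: "star (star a) = a"
    and star_add: "star (a + b) = star a + star b"
    and star_scaleC: "star (scaleC c a) = scaleC (cnj c) (star a)"
    and star_mult: "star (a * b) = star b * star a"
    and cstar_identity: "norm (star a * a) = (norm a)\<^sup>2"

definition cstar_positive :: "'b::cstar_algebra \<Rightarrow> bool" where
  "cstar_positive a \<longleftrightarrow> (\<exists>b. a = star b * b)"


section \<open>Hilbert modules\<close>

text \<open>
  A (right) Hilbert module is a complex vector space, i.e. an HOL-Algebra module over the field
  of complex numbers, with a right action of the C*-algebra and an algebra-valued inner
  product, linear in the second argument. The fields \<open>mult\<close> and \<open>one\<close> that
  the HOL-Algebra record \<open>module\<close> inherits from \<open>ring\<close> are unused.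
\<close>

definition complex_ring :: "complex ring" where
  "complex_ring = \<lparr> carrier = UNIV, monoid.mult = (*), one = 1, zero = 0, add = (+) \<rparr>"

record ('b, 'e) hmodule = "(complex, 'e) module" +
  ract :: "'e \<Rightarrow> 'b \<Rightarrow> 'e"
  ip :: "'e \<Rightarrow> 'e \<Rightarrow> 'b"

definition hnorm :: "('b::cstar_algebra, 'e) hmodule \<Rightarrow> 'e \<Rightarrow> real" where
  "hnorm E x = sqrt (norm (ip E x x))"

definition hcauchy :: "('b::cstar_algebra, 'e) hmodule \<Rightarrow> (nat \<Rightarrow> 'e) \<Rightarrow> bool" where
  "hcauchy E X \<longleftrightarrow> range X \<subseteq> carrier E \<and>
     (\<forall>\<epsilon>>0. \<exists>N. \<forall>m\<ge>N. \<forall>n\<ge>N. hnorm E (X m \<ominus>\<^bsub>E\<^esub> X n) < \<epsilon>)"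

locale hilbert_module =
  Module.module complex_ring E
  for E :: "('b::cstar_algebra, 'e) hmodule" (structure) +
  assumes ract_closed: "x \<in> carrier E \<Longrightarrow> ract E x b \<in> carrier E"
    and ract_add_left: "\<lbrakk>x \<in> carrier E; y \<in> carrier E\<rbrakk> \<Longrightarrow>
          ract E (x \<oplus> y) b = ract E x b \<oplus> ract E y b"
    and ract_add_right: "x \<in> carrier E \<Longrightarrow> ract E x (b + c) = ract E x b \<oplus> ract E x c"
    and ract_mult: "x \<in> carrier E \<Longrightarrow> ract E x (b * c) = ract E (ract E x b) c"
    and ract_smult: "x \<in> carrier E \<Longrightarrow> ract E (k \<odot> x) b = k \<odot> ract E x b"
    and ract_scaleC: "x \<in> carrier E \<Longrightarrow> ract E x (scaleC k b) = k \<odot> ract E x b"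
    and ip_add_right: "\<lbrakk>x \<in> carrier E; y \<in> carrier E; z \<in> carrier E\<rbrakk> \<Longrightarrow>
          ip E x (y \<oplus> z) = ip E x y + ip E x z"
    and ip_smult_right: "\<lbrakk>x \<in> carrier E; y \<in> carrier E\<rbrakk> \<Longrightarrow>
          ip E x (k \<odot> y) = scaleC k (ip E x y)"
    and ip_ract_right: "\<lbrakk>x \<in> carrier E; y \<in> carrier E\<rbrakk> \<Longrightarrow>
          ip E x (ract E y b) = ip E x y * b"
    and ip_star: "\<lbrakk>x \<in> carrier E; y \<in> carrier E\<rbrakk> \<Longrightarrow> star (ip E x y) = ip E y x"
    and ip_positive: "x \<in> carrier E \<Longrightarrow> cstar_positive (ip E x x)"
    and ip_definite: "\<lbrakk>x \<in> carrier E; ip E x x = 0\<rbrakk> \<Longrightarrow> x = \<zero>"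
    and complete: "hcauchy E X \<Longrightarrow>
          \<exists>x \<in> carrier E. (\<lambda>n. hnorm E (X n \<ominus> x)) \<longlonglongrightarrow> 0"


section \<open>Maps between Hilbert modules\<close>

definition hlinear :: "('b::cstar_algebra, 'e) hmodule \<Rightarrow> ('b, 'f) hmodule \<Rightarrow> ('e \<Rightarrow> 'f) \<Rightarrow> bool" where
  "hlinear E F T \<longleftrightarrow> T \<in> carrier E \<rightarrow> carrier F \<and>
     (\<forall>x \<in> carrier E. \<forall>y \<in> carrier E. T (x \<oplus>\<^bsub>E\<^esub> y) = T x \<oplus>\<^bsub>F\<^esub> T y) \<and>
     (\<forall>c. \<forall>x \<in> carrier E. T (c \<odot>\<^bsub>E\<^esub> x) = c \<odot>\<^bsub>F\<^esub> T x)"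

definition hisometry :: "('b::cstar_algebra, 'e) hmodule \<Rightarrow> ('b, 'f) hmodule \<Rightarrow> ('e \<Rightarrow> 'f) \<Rightarrow> bool" where
  "hisometry E F T \<longleftrightarrow> hlinear E F T \<and>
     (\<forall>x \<in> carrier E. \<forall>y \<in> carrier E. ip F (T x) (T y) = ip E x y)"

definition hunitary :: "('b::cstar_algebra, 'e) hmodule \<Rightarrow> ('b, 'f) hmodule \<Rightarrow> ('e \<Rightarrow> 'f) \<Rightarrow> bool" where
  "hunitary E F T \<longleftrightarrow> hisometry E F T \<and> T ` carrier E = carrier F"

definition hadjointable :: "('b::cstar_algebra, 'e) hmodule \<Rightarrow> ('b, 'f) hmodule \<Rightarrow> ('e \<Rightarrow> 'f) \<Rightarrow> bool" where
  "hadjointable E F T \<longleftrightarrow> T \<in> carrier E \<rightarrow> carrier F \<and>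
     (\<exists>S \<in> carrier F \<rightarrow> carrier E.
        \<forall>x \<in> carrier E. \<forall>y \<in> carrier F. ip F (T x) y = ip E x (S y))"

text \<open>The adjoint, meaningful for adjointable \<open>T\<close> and arguments in \<open>carrier F\<close>.\<close>

definition hadjoint :: "('b::cstar_algebra, 'e) hmodule \<Rightarrow> ('b, 'f) hmodule \<Rightarrow> ('e \<Rightarrow> 'f) \<Rightarrow> 'f \<Rightarrow> 'e" where
  "hadjoint E F T y =
     (THE x. x \<in> carrier E \<and> (\<forall>z \<in> carrier E. ip F (T z) y = ip E z x))"


section \<open>Semigroups\<close>

text \<open>Families indexed by the nonnegative reals; values at negative times are irrelevant.\<close>

definition hsemigroup :: "('b::cstar_algebra, 'e) hmodule \<Rightarrow> (real \<Rightarrow> 'e \<Rightarrow> 'e) \<Rightarrow> bool" where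
  "hsemigroup E s \<longleftrightarrow>
     (\<forall>t\<ge>0. hlinear E E (s t)) \<and>
     (\<forall>r\<ge>0. \<forall>t\<ge>0. \<forall>x \<in> carrier E. s r (s t x) = s (r + t) x) \<and>
     (\<forall>x \<in> carrier E. s 0 x = x)"

definition strongly_continuous :: "('b::cstar_algebra, 'e) hmodule \<Rightarrow> (real \<Rightarrow> 'e \<Rightarrow> 'e) \<Rightarrow> bool" where
  "strongly_continuous E s \<longleftrightarrow> (\<forall>x \<in> carrier E. \<forall>t\<ge>0.
     ((\<lambda>r. hnorm E (s r x \<ominus>\<^bsub>E\<^esub> s t x)) \<longlongrightarrow> 0) (at t within {0..}))"

definition adjointable_isometries :: "('b::cstar_algebra, 'e) hmodule \<Rightarrow> (real \<Rightarrow> 'e \<Rightarrow> 'e) \<Rightarrow> bool" where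
  "adjointable_isometries E s \<longleftrightarrow> (\<forall>t\<ge>0. hisometry E E (s t) \<and> hadjointable E E (s t))"

definition pure_semigroup :: "('b::cstar_algebra, 'e) hmodule \<Rightarrow> (real \<Rightarrow> 'e \<Rightarrow> 'e) \<Rightarrow> bool" where
  "pure_semigroup E s \<longleftrightarrow> (\<forall>x \<in> carrier E. ((\<lambda>t. hnorm E (hadjoint E E (s t) x)) \<longlongrightarrow> 0) at_top)"


section \<open>Completion\<close>

text \<open>
  Cauchy sequences of a (semi-)inner product module modulo null sequences.
  This also divides out the vectors of length zero.
\<close>

definition completion_rel :: "('b::cstar_algebra, 'e) hmodule \<Rightarrow> (nat \<Rightarrow> 'e) rel" where
  "completion_rel H = {(X, Y). hcauchy H X \<and> hcauchy H Y \<and>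
     (\<lambda>n. hnorm H (X n \<ominus>\<^bsub>H\<^esub> Y n)) \<longlonglongrightarrow> 0}"

definition completion_class :: "('b::cstar_algebra, 'e) hmodule \<Rightarrow> (nat \<Rightarrow> 'e) \<Rightarrow> (nat \<Rightarrow> 'e) set" where
  "completion_class H X = completion_rel H `` {X}"

definition completion_rep :: "(nat \<Rightarrow> 'e) set \<Rightarrow> nat \<Rightarrow> 'e" where
  "completion_rep A = (SOME X. X \<in> A)"

definition completion :: "('b::cstar_algebra, 'e) hmodule \<Rightarrow> ('b, (nat \<Rightarrow> 'e) set) hmodule" where
  "completion H =
     \<lparr> carrier = {X. hcauchy H X} // completion_rel H,
       monoid.mult = undefined,
       one = undefined,
       zero = completion_class H (\<lambda>n. \<zero>\<^bsub>H\<^esub>),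
       add = (\<lambda>A B. completion_class H (\<lambda>n. completion_rep A n \<oplus>\<^bsub>H\<^esub> completion_rep B n)),
       smult = (\<lambda>c A. completion_class H (\<lambda>n. c \<odot>\<^bsub>H\<^esub> completion_rep A n)),
       ract = (\<lambda>A b. completion_class H (\<lambda>n. ract H (completion_rep A n) b)),
       ip = (\<lambda>A B. lim (\<lambda>n. ip H (completion_rep A n) (completion_rep B n))) \<rparr>"


section \<open>The module of square integrable functions and the right shift\<close>

text \<open>Functions on the half line are functions on the real line that vanish on the negative axis.\<close>

definition L2_halfline :: "(real \<Rightarrow> complex) set" where
  "L2_halfline = {h. h \<in> borel_measurable lborel \<and>
     integrable lborel (\<lambda>x. (cmod (h x))\<^sup>2) \<and> (\<forall>x<0. h x = 0)}"

text \<open>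
  The algebraic tensor product of the square integrable functions with \<open>F\<close>, realised as the
  linear span of the functions \<open>x \<mapsto> h x \<odot> y\<close>. The integrands of the inner product below take
  values in a finite-dimensional subspace of the C*-algebra, so the Henstock-Kurzweil integral
  exists and agrees with the Bochner integral; the latter is not used since the library develops
  it for separable spaces only. The resulting inner product is
  \<open>\<langle>h \<otimes> y, k \<otimes> z\<rangle> = \<langle>h, k\<rangle>\<langle>y, z\<rangle>\<close>.
\<close>

definition L2_span :: "('b::cstar_algebra, 'e) hmodule \<Rightarrow> (real \<Rightarrow> 'e) set" where
  "L2_span F = {f. \<exists>(n::nat) h y.
     (\<forall>i<n. h i \<in> L2_halfline \<and> y i \<in> carrier F) \<and>
     f = (\<lambda>x. \<Oplus>\<^bsub>F\<^esub>i\<in>{..<n}. h i x \<odot>\<^bsub>F\<^esub> y i)}"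

definition L2_alg :: "('b::cstar_algebra, 'e) hmodule \<Rightarrow> ('b, real \<Rightarrow> 'e) hmodule" where
  "L2_alg F =
     \<lparr> carrier = L2_span F,
       monoid.mult = undefined,
       one = undefined,
       zero = (\<lambda>x. \<zero>\<^bsub>F\<^esub>),
       add = (\<lambda>f g x. f x \<oplus>\<^bsub>F\<^esub> g x),
       smult = (\<lambda>c f x. c \<odot>\<^bsub>F\<^esub> f x),
       ract = (\<lambda>f b x. ract F (f x) b),
       ip = (\<lambda>f g. integral {0..} (\<lambda>x. ip F (f x) (g x))) \<rparr>"

definition L2 :: "('b::cstar_algebra, 'e) hmodule \<Rightarrow> ('b, (nat \<Rightarrow> real \<Rightarrow> 'e) set) hmodule" where
  "L2 F = completion (L2_alg F)"

definition shift_fun :: "('b::cstar_algebra, 'e) hmodule \<Rightarrow> real \<Rightarrow> (real \<Rightarrow> 'e) \<Rightarrow> real \<Rightarrow> 'e" where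
  "shift_fun F t f = (\<lambda>x. if x \<ge> t then f (x - t) else \<zero>\<^bsub>F\<^esub>)"

text \<open>The extension of the shift of functions to the completion.\<close>

definition right_shift ::
  "('b::cstar_algebra, 'e) hmodule \<Rightarrow> real \<Rightarrow> (nat \<Rightarrow> real \<Rightarrow> 'e) set \<Rightarrow> (nat \<Rightarrow> real \<Rightarrow> 'e) set" where
  "right_shift F t A = completion_class (L2_alg F) (\<lambda>n. shift_fun F t (completion_rep A n))"

end

theory Submission
  imports Defs "HOL-Probability.Discrete_Topology"
begin

text \<open>
  Under an equivalence with the right shift over \<open>F\<close>, the elementary tensors \<open>exp (- x) \<otimes> y\<close> are the
  vectors \<open>y'\<close> with \<open>s\<^sub>t\<^sup>* y' = exp (- t) y'\<close> for all \<open>t\<close>. So \<open>F\<close> is taken to be this joint eigenspace,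
  a closed submodule of \<open>E\<close>, and \<open>V\<close> is determined by sending the right shift by \<open>r\<close> of
  \<open>sqrt 2 exp (- x) \<otimes> y\<close> to \<open>s\<^sub>r y\<close>. It preserves inner products by a computation with exponentials,
  and shifted exponentials are total in the square integrable functions.

  Surjectivity is the point: closed submodules need not be complemented, so a vanishing orthogonal
  complement would not suffice. Let \<open>R\<close> be the resolvent at \<open>1\<close> of the generator of \<open>s\<close>. As the \<open>s\<^sub>t\<close>
  are isometries, \<open>2 R\<^sup>* R = R + R\<^sup>*\<close>, hence \<open>p = R + R\<^sup>* - 2 R R\<^sup>*\<close> maps into \<open>F\<close> and
  \<open>R\<^sup>* - p = R (2 R\<^sup>* - 1)\<close>. For \<open>x = R\<^sup>* z\<close> and \<open>h = T / n\<close>, split \<open>x - s\<^sub>T s\<^sub>T\<^sup>* x\<close> into the orthogonal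
  pieces \<open>s\<^sub>k\<^sub>h (1 - s\<^sub>h s\<^sub>h\<^sup>*) s\<^sub>k\<^sub>h\<^sup>* x\<close>. Since \<open>(1 - s\<^sub>h s\<^sub>h\<^sup>*) R\<close> has norm \<open>O(h)\<close>, each piece is, up to
  an error of norm \<open>O(h)\<close>, the image of a vector of \<open>F\<close> under \<open>1 - exp (- h) s\<^sub>h\<close> followed by \<open>s\<^sub>k\<^sub>h\<close>. By
  orthogonality the total error has norm \<open>O(sqrt n h)\<close>, which tends to \<open>0\<close>; purity removes \<open>s\<^sub>T s\<^sub>T\<^sup>* x\<close>,
  and the range of \<open>R\<^sup>*\<close> is dense.
\<close>


section \<open>Elementary facts on C*-algebras\<close>

text \<open>The formula for \<open>p\<close> comes from the cogenerator \<open>W = 2 R - 1\<close>.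
  With \<open>R'\<close> the adjoint of \<open>R\<close>, the relation between \<open>R\<close> and
  \<open>R'\<close> says that \<open>W\<close> is an isometry, and \<open>2 p = 1 - W W'\<close> is
  the projection onto the kernel of its adjoint \<open>W' = 2 R' - 1\<close>. That kernel is
  \<open>F\<close>: the eigenvector equation, differentiated at time zero, reads
  \<open>2 R' y = y\<close>. So this particular closed submodule is complemented, by an explicit
  formula.

  Two obstacles come before. The length in a Hilbert module satisfies the triangle inequality only
  through Cauchy-Schwarz, which rests on the norm being monotone on sums of elements
  \<open>star b * b\<close>. The algebra may have no unit, so it is made to act on itself by left
  multiplication, and positivity is studied for bounded operators, among which there is an identity.
  Moreover the vectors form the carrier of a record and not a normed type. The carrier is therefore
  embedded isometrically into the bounded functions on its unit ball, each vector acting there by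
  the inner product, and the analysis takes place in the image. Resolvents are limits of fixed
  points in discrete time, without vector-valued integrals.\<close>

lemma star_zero: "star (0::'b::cstar_algebra) = 0"
  using star_add[of "0::'b" 0] by simp

lemma star_minus: "star (- a) = - star (a::'b::cstar_algebra)"
  using star_add[of a "- a"] by (simp add: star_zero eq_neg_iff_add_eq_0 add.commute)

lemma star_diff: "star (a - b) = star a - star (b::'b::cstar_algebra)"
  using star_add[of a "- b"] by (simp add: star_minus)

lemma star_scaleR: "star (r *\<^sub>R a) = r *\<^sub>R star (a::'b::cstar_algebra)"
  using star_scaleC[of "complex_of_real r" a] by (simp add: scaleC_of_real)

lemma norm_star: "norm (star a) = norm (a::'b::cstar_algebra)"
proof -
  have le: "norm a \<le> norm (star a)" for a :: 'b
  proof (cases "a = 0")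
    case False
    have "norm a * norm a \<le> norm (star a) * norm a"
      using norm_mult_ineq[of "star a" a] by (simp add: cstar_identity power2_eq_square)
    then show ?thesis using False by simp
  qed simp
  show ?thesis using le[of a] le[of "star a"] by (simp add: star_star)
qed

lemma bounded_linear_star: "bounded_linear (star :: 'b::cstar_algebra \<Rightarrow> 'b)"
  by (rule bounded_linear_intro[where K = 1]) (simp_all add: star_add star_scaleR norm_star)



lemma scaleC_zero_left: "scaleC 0 (a::'b::cstar_algebra) = 0"
  using scaleC_of_real[of 0 a] by simp

lemma scaleC_one: "scaleC 1 (a::'b::cstar_algebra) = a"
  using scaleC_of_real[of 1 a] by simp

lemma scaleC_zero_right: "scaleC c (0::'b::cstar_algebra) = 0"
  using scaleC_add_right[of c "0::'b" 0] by simp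

lemma scaleC_minus_right: "scaleC c (- a) = - scaleC c (a::'b::cstar_algebra)"
  using scaleC_add_right[of c a "- a"] by (simp add: scaleC_zero_right eq_neg_iff_add_eq_0 add.commute)

lemma scaleC_minus_left: "scaleC (- c) a = - scaleC c (a::'b::cstar_algebra)"
  using scaleC_add_left[of c "- c" a] by (simp add: scaleC_zero_left eq_neg_iff_add_eq_0 add.commute)

lemma scaleC_diff_right: "scaleC c (a - b) = scaleC c a - scaleC c (b::'b::cstar_algebra)"
  using scaleC_add_right[of c a "- b"] by (simp add: scaleC_minus_right)

lemma scaleC_diff_left: "scaleC (c - d) a = scaleC c a - scaleC d (a::'b::cstar_algebra)"
  using scaleC_add_left[of c "- d" a] by (simp add: scaleC_minus_left)

lemma scaleC_scaleR: "scaleC c (r *\<^sub>R a) = r *\<^sub>R scaleC c (a::'b::cstar_algebra)"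
  by (simp flip: scaleC_of_real add: scaleC_scaleC mult.commute)

lemma scaleR_scaleC_left: "scaleC (r *\<^sub>R c) (a::'b::cstar_algebra) = r *\<^sub>R scaleC c a"
  by (simp flip: scaleC_of_real add: scaleC_scaleC scaleR_conv_of_real)

lemma bounded_bilinear_scaleC: "bounded_bilinear (scaleC :: complex \<Rightarrow> 'b::cstar_algebra \<Rightarrow> 'b)"
  by (unfold_locales)
    (auto simp: scaleC_add_left scaleC_add_right scaleC_scaleR scaleR_scaleC_left norm_scaleC
      intro!: exI[where x = 1])

lemma star_mult_self_eq_0: "star a * a = 0 \<Longrightarrow> a = (0::'b::cstar_algebra)"
  using cstar_identity[of a] by simp


section \<open>Positive operators on a C*-algebra\<close>

notation blinfun_compose (infixl \<open>\<diamondop>\<close> 72)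

text \<open>The algebra is regarded as a Hilbert module over itself with inner product
  \<open>star d * e\<close>. Adjointness is a relation because a bounded operator need not have an
  adjoint.\<close>

definition op_adjoint ::
  "('b::cstar_algebra \<Rightarrow>\<^sub>L 'b) \<Rightarrow> ('b \<Rightarrow>\<^sub>L 'b) \<Rightarrow> bool" where
  "op_adjoint T T' \<longleftrightarrow> (\<forall>d e. star (T d) * e = star d * T' e)"

abbreviation selfadjoint :: "('b::cstar_algebra \<Rightarrow>\<^sub>L 'b) \<Rightarrow> bool" where
  "selfadjoint T \<equiv> op_adjoint T T"

text \<open>Positivity is encoded by a norm condition, so that sums of positive operators are
  positive for trivial reasons.\<close>

definition op_positive :: "('b::cstar_algebra \<Rightarrow>\<^sub>L 'b) \<Rightarrow> bool" where
  "op_positive T \<longleftrightarrow> selfadjoint T \<and> (\<exists>t>0. norm (t *\<^sub>R id_blinfun - T) \<le> t)"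

text \<open>\<open>Y\<close> is \<open>1 - sqrt (1 - X)\<close>, obtained as the limit of the
  iteration \<open>Z \<mapsto> (X + Z Z) / 2\<close> started at \<open>0\<close>. The iterates and
  their differences are dominated by those of the scalar sequence \<open>c\<close>, where
  \<open>X\<close> is replaced by \<open>1\<close>; it increases and stays below \<open>1\<close>.
  The second conclusion passes any closed property preserved by the iteration on to
  \<open>Y\<close>.\<close>

lemma blinfun_power_half_sqrt:
  fixes X :: "'a::banach \<Rightarrow>\<^sub>L 'a"
  assumes X: "norm X \<le> 1"
  obtains Y where "2 *\<^sub>R Y - Y \<diamondop> Y = X"
    and "\<And>Q. closed Q \<Longrightarrow> 0 \<in> Q \<Longrightarrow> (\<And>Z. Z \<in> Q \<Longrightarrow> (1/2) *\<^sub>R (X + Z \<diamondop> Z) \<in> Q) \<Longrightarrow> Y \<in> Q"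
proof -
  define y where "y = rec_nat 0 (\<lambda>_ Z. (1/2) *\<^sub>R (X + Z \<diamondop> Z))"
  define c where "c = rec_nat (0::real) (\<lambda>_ z. (1 + z\<^sup>2) / 2)"
  have y: "y 0 = 0" "y (Suc n) = (1/2) *\<^sub>R (X + y n \<diamondop> y n)"
    and c: "c 0 = 0" "c (Suc n) = (1 + (c n)\<^sup>2) / 2" for n
    by (simp_all add: y_def c_def)
  have c01: "0 \<le> c n \<and> c n \<le> 1" for n
    by (induction n) (auto simp: c power_le_one)
  have c_mono: "c n \<le> c (Suc n)" for n
    using c(2)[of n] sum_squares_ge_zero[of "c n - 1" 0] by (simp add: power2_eq_square algebra_simps)
  have y_le: "norm (y n) \<le> c n" for n
  proof (induction n)
    case (Suc n)
    have "norm (y n \<diamondop> y n) \<le> (c n)\<^sup>2"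
      using norm_blinfun_compose[of "y n" "y n"] mult_mono[OF Suc Suc] c01[of n]
      by (simp add: power2_eq_square)
    then have "norm (X + y n \<diamondop> y n) \<le> 1 + (c n)\<^sup>2"
      using norm_triangle_ineq[of X "y n \<diamondop> y n"] X by linarith
    then show ?case by (simp add: y c)
  qed (simp add: y c)
  have y_diff: "norm (y (Suc n) - y n) \<le> c (Suc n) - c n" for n
  proof (induction n)
    case 0
    then show ?case using X by (simp add: y c)
  next
    case (Suc n)
    let ?a = "y (Suc n)" and ?b = "y n"
    \<comment> \<open>A difference of squares, factored without commutativity; \<open>c\<close> is
      treated in the same way below.\<close>
    have eq: "y (Suc (Suc n)) - y (Suc n) = (1/2) *\<^sub>R (?a \<diamondop> (?a - ?b) + (?a - ?b) \<diamondop> ?b)"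
    proof -
      have "y (Suc (Suc n)) - y (Suc n)
          = (1/2) *\<^sub>R (X + ?a \<diamondop> ?a) - (1/2) *\<^sub>R (X + ?b \<diamondop> ?b)"
        by (rule arg_cong2[where f = minus]; rule y)
      also have "\<dots> = (1/2) *\<^sub>R (?a \<diamondop> (?a - ?b) + (?a - ?b) \<diamondop> ?b)"
        by (rule blinfun_eqI) (simp add: blinfun.bilinear_simps algebra_simps)
      finally show ?thesis .
    qed
    have "norm (?a \<diamondop> (?a - ?b) + (?a - ?b) \<diamondop> ?b)
        \<le> norm ?a * norm (?a - ?b) + norm (?a - ?b) * norm ?b"
      by (intro norm_triangle_le add_mono norm_blinfun_compose)
    also have "\<dots> \<le> c (Suc n) * (c (Suc n) - c n) + (c (Suc n) - c n) * c n"
      using Suc y_le[of n] y_le[of "Suc n"] c01 c_mono[of n] by (intro add_mono mult_mono) auto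
    also have "\<dots> = 2 * (c (Suc (Suc n)) - c (Suc n))"
      by (subst c(2)[of "Suc n"], subst (5) c(2)[of n]) (simp add: power2_eq_square algebra_simps)
    finally show ?case unfolding eq by simp
  qed
  have diff: "norm (y (n + k) - y n) \<le> c (n + k) - c n" for n k
  proof (induction k)
    case (Suc k)
    show ?case
      using norm_triangle_ineq[of "y (Suc (n + k)) - y (n + k)" "y (n + k) - y n"]
        y_diff[of "n + k"] Suc by simp
  qed simp
  have "incseq c" using c_mono by (rule incseq_SucI)
  then have "convergent c"
    using c01 by (intro Bseq_monoseq_convergent BseqI'[of c 1]) (auto simp: monoseq_def incseq_def)
  then have "Cauchy c" by (rule convergent_Cauchy)
  have "Cauchy y"
  proof (rule CauchyI')
    fix e :: real assume "e > 0"
    then obtain M where M: "\<And>m n. m \<ge> M \<Longrightarrow> n \<ge> M \<Longrightarrow> norm (c m - c n) < e"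
      using CauchyD[OF \<open>Cauchy c\<close>] by blast
    have "norm (y m - y n) < e" if "m \<ge> M" "n > m" for m n
      using diff[of m "n - m"] M[of n m] that by (simp add: norm_minus_commute)
    then show "\<exists>M. \<forall>m\<ge>M. \<forall>n>m. dist (y m) (y n) < e"
      by (auto simp: dist_norm)
  qed
  then obtain Y where lim: "y \<longlonglongrightarrow> Y" using Cauchy_convergent convergent_def by blast
  have "(\<lambda>n. y (Suc n)) \<longlonglongrightarrow> (1/2) *\<^sub>R (X + Y \<diamondop> Y)"
    unfolding y by (intro tendsto_intros bounded_bilinear.tendsto[OF bounded_bilinear_blinfun_compose] lim)
  with LIMSEQ_Suc[OF lim] have "Y = (1/2) *\<^sub>R (X + Y \<diamondop> Y)" by (rule LIMSEQ_unique)
  then have "2 *\<^sub>R Y = X + Y \<diamondop> Y"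
    by (metis scaleR_half_double scaleR_2 scaleR_right_distrib)
  moreover have "Y \<in> Q" if Q: "closed Q" "0 \<in> Q" "\<And>Z. Z \<in> Q \<Longrightarrow> (1/2) *\<^sub>R (X + Z \<diamondop> Z) \<in> Q" for Q
  proof -
    have "y n \<in> Q" for n by (induction n) (auto simp: y Q)
    then show ?thesis using closed_sequentially[OF Q(1) _ lim] by blast
  qed
  ultimately show ?thesis by (intro that[of Y]) auto
qed

section \<open>Adjoints of bounded operators on the algebra\<close>

lemma op_adjointD: "op_adjoint T T' \<Longrightarrow> star (T d) * e = star d * T' e"
  by (simp add: op_adjoint_def)

lemma closed_selfadjoint: "closed {T. selfadjoint T}"
  unfolding op_adjoint_def
  by (intro closed_Collect_all closed_Collect_eq continuous_intros
      bounded_linear.continuous_on[OF bounded_linear_star])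

lemma op_adjoint_compose:
  assumes "op_adjoint S S'" "op_adjoint T T'"
  shows "op_adjoint (S \<diamondop> T) (T' \<diamondop> S')"
  using assms by (simp add: op_adjoint_def)

lemma op_adjoint_add: "op_adjoint S S' \<Longrightarrow> op_adjoint T T' \<Longrightarrow> op_adjoint (S + T) (S' + T')"
  by (simp add: op_adjoint_def blinfun.bilinear_simps star_add algebra_simps)

lemma op_adjoint_diff: "op_adjoint S S' \<Longrightarrow> op_adjoint T T' \<Longrightarrow> op_adjoint (S - T) (S' - T')"
  by (simp add: op_adjoint_def blinfun.bilinear_simps star_diff algebra_simps)

lemma op_adjoint_scaleR: "op_adjoint S S' \<Longrightarrow> op_adjoint (r *\<^sub>R S) (r *\<^sub>R S')"
  by (simp add: op_adjoint_def blinfun.bilinear_simps star_scaleR)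

lemma op_adjoint_id: "op_adjoint id_blinfun id_blinfun"
  by (simp add: op_adjoint_def)

lemma op_adjoint_zero: "op_adjoint 0 0"
  by (simp add: op_adjoint_def star_zero)

lemmas op_adjoint_intros = op_adjoint_compose op_adjoint_add op_adjoint_diff op_adjoint_scaleR
  op_adjoint_id op_adjoint_zero

lemma op_adjoint_sym: "op_adjoint T T' \<Longrightarrow> op_adjoint T' T"
  unfolding op_adjoint_def by (metis star_mult star_star)

lemma star_mult_cancel: "(\<And>e. star e * a = star e * b) \<Longrightarrow> a = (b::'b::cstar_algebra)"
  using star_mult_self_eq_0[of "a - b"] by (simp add: right_diff_distrib)

lemma op_adjoint_norm_le:
  assumes "op_adjoint T T'" shows "norm T' \<le> norm T"
proof (rule norm_blinfun_bound)
  fix d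
  have "(norm (T' d))\<^sup>2 = norm (star d * T (T' d))"
    using assms op_adjoint_sym[OF assms] by (simp add: op_adjoint_def flip: cstar_identity)
  also have "\<dots> \<le> norm d * (norm T * norm (T' d))"
    by (intro order_trans[OF norm_mult_ineq] mult_mono) (simp_all add: norm_star norm_blinfun)
  finally show "norm (T' d) \<le> norm T * norm d"
    by (cases "T' d = 0") (simp_all add: power2_eq_square algebra_simps)
qed simp

lemma op_adjoint_norm_sq_le:
  assumes "op_adjoint T T'" shows "(norm T)\<^sup>2 \<le> norm (T' \<diamondop> T)"
proof -
  have "norm T \<le> sqrt (norm (T' \<diamondop> T))"
  proof (rule norm_blinfun_bound)
    fix d
    have "(norm (T d))\<^sup>2 = norm (star d * (T' \<diamondop> T) d)"
      using assms by (simp add: op_adjoint_def flip: cstar_identity)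
    also have "\<dots> \<le> norm d * (norm (T' \<diamondop> T) * norm d)"
      by (intro order_trans[OF norm_mult_ineq] mult_mono norm_blinfun) (simp_all add: norm_star)
    finally have "(norm (T d))\<^sup>2 \<le> (sqrt (norm (T' \<diamondop> T)) * norm d)\<^sup>2"
      by (simp add: power2_eq_square algebra_simps)
    then show "norm (T d) \<le> sqrt (norm (T' \<diamondop> T)) * norm d"
      by (rule power2_le_imp_le) simp
  qed simp
  then have "(norm T)\<^sup>2 \<le> (sqrt (norm (T' \<diamondop> T)))\<^sup>2" by (intro power_mono) auto
  then show ?thesis by simp
qed

text \<open>The norm bound, self-adjointness and commutation with whatever commutes with
  \<open>X\<close> are closed conditions preserved by the iteration, so they hold for its limit
  \<open>Y\<close>.\<close>

lemma selfadjoint_sqrt_contraction: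
  assumes "norm X \<le> 1" "selfadjoint X"
  obtains Y where "(id_blinfun - Y) \<diamondop> (id_blinfun - Y) = id_blinfun - X" "norm Y \<le> 1"
    "selfadjoint Y" "\<And>Z. Z \<diamondop> X = X \<diamondop> Z \<Longrightarrow> Z \<diamondop> Y = Y \<diamondop> Z"
proof -
  obtain Y where Y: "2 *\<^sub>R Y - Y \<diamondop> Y = X"
    and Q: "\<And>Q. closed Q \<Longrightarrow> 0 \<in> Q \<Longrightarrow> (\<And>Z. Z \<in> Q \<Longrightarrow> (1/2) *\<^sub>R (X + Z \<diamondop> Z) \<in> Q) \<Longrightarrow> Y \<in> Q"
    using blinfun_power_half_sqrt[OF assms(1)] by metis
  have "X d = Y d + Y d - Y (Y d)" for d
    by (simp add: Y[symmetric] blinfun.bilinear_simps scaleR_2)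
  then have "(id_blinfun - Y) \<diamondop> (id_blinfun - Y) = id_blinfun - X"
    by (intro blinfun_eqI) (simp add: blinfun.bilinear_simps)
  moreover have "norm Y \<le> 1"
  proof -
    have "norm ((1/2) *\<^sub>R (X + Z \<diamondop> Z)) \<le> 1" if "norm Z \<le> 1" for Z
      using norm_triangle_ineq[of X "Z \<diamondop> Z"] norm_blinfun_compose[of Z Z] assms(1)
        mult_le_one[OF that _ that] by simp
    then show ?thesis
      using Q[of "{Z. norm Z \<le> 1}"] by (simp add: closed_Collect_le continuous_intros)
  qed
  moreover have "selfadjoint Y"
    using Q[OF closed_selfadjoint] assms(2) by (simp add: op_adjoint_intros)
  moreover have "Z \<diamondop> Y = Y \<diamondop> Z" if "Z \<diamondop> X = X \<diamondop> Z" for Z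
  proof -
    have *: "Z (X d) = X (Z d)" for d using that by (metis blinfun_apply_blinfun_compose)
    have "Y \<in> {T. \<forall>d. Z (blinfun_apply T d) = blinfun_apply T (Z d)}"
      by (rule Q) (auto simp: blinfun.bilinear_simps * intro!: closed_Collect_all closed_Collect_eq continuous_intros)
    then show ?thesis by (auto intro!: blinfun_eqI)
  qed
  ultimately show ?thesis by (rule that)
qed

lemma op_positive_sqrt:
  assumes "op_positive T"
  obtains K where "op_positive K" "K \<diamondop> K = T" "\<And>Z. Z \<diamondop> T = T \<diamondop> Z \<Longrightarrow> Z \<diamondop> K = K \<diamondop> Z"
proof -
  from assms obtain t where t: "t > 0" "norm (t *\<^sub>R id_blinfun - T) \<le> t" and sa: "selfadjoint T"
    by (auto simp: op_positive_def)
  \<comment> \<open>The norm condition in \<open>op_positive\<close> says exactly that this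
    \<open>X\<close> is a contraction.\<close>
  define X where "X = id_blinfun - (1/t) *\<^sub>R T"
  have "X = (1/t) *\<^sub>R (t *\<^sub>R id_blinfun - T)"
    using t by (simp add: X_def scaleR_diff_right)
  then have "norm X \<le> 1" using t by simp
  moreover have "selfadjoint X" unfolding X_def by (intro op_adjoint_intros sa)
  ultimately obtain Y where Y: "(id_blinfun - Y) \<diamondop> (id_blinfun - Y) = id_blinfun - X"
    "norm Y \<le> 1" "selfadjoint Y" "\<And>Z. Z \<diamondop> X = X \<diamondop> Z \<Longrightarrow> Z \<diamondop> Y = Y \<diamondop> Z"
    using selfadjoint_sqrt_contraction by metis
  define K where "K = sqrt t *\<^sub>R (id_blinfun - Y)"
  have "sqrt t *\<^sub>R id_blinfun - K = sqrt t *\<^sub>R Y" by (simp add: K_def scaleR_diff_right)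
  then have "norm (sqrt t *\<^sub>R id_blinfun - K) \<le> sqrt t"
    using Y(2) t by (simp add: mult_left_le)
  moreover have "selfadjoint K" unfolding K_def by (intro op_adjoint_intros Y)
  ultimately have "op_positive K" using t by (auto simp: op_positive_def intro!: exI[of _ "sqrt t"])
  moreover have "K \<diamondop> K = T"
  proof -
    have "K \<diamondop> K = (sqrt t * sqrt t) *\<^sub>R ((id_blinfun - Y) \<diamondop> (id_blinfun - Y))"
      by (rule blinfun_eqI) (simp add: K_def blinfun.bilinear_simps scaleR_diff_right)
    then show ?thesis unfolding Y using t by (simp add: X_def)
  qed
  moreover have "Z \<diamondop> K = K \<diamondop> Z" if "Z \<diamondop> T = T \<diamondop> Z" for Z
  proof -
    have *: "Z (T d) = T (Z d)" for d using that by (metis blinfun_apply_blinfun_compose)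
    have "Z \<diamondop> X = X \<diamondop> Z"
      by (rule blinfun_eqI) (simp add: X_def blinfun.bilinear_simps *)
    from Y(4)[OF this] have "Z (Y d) = Y (Z d)" for d by (metis blinfun_apply_blinfun_compose)
    then show ?thesis by (auto intro!: blinfun_eqI simp: K_def blinfun.bilinear_simps)
  qed
  ultimately show ?thesis by (rule that)
qed

text \<open>If \<open>k\<^sup>2 + m\<^sup>2 = \<nu>\<close>, then \<open>u = k + i m\<close> is \<open>sqrt \<nu>\<close> times an isometry, and so is its adjoint.\<close>

lemma norm_square_le_of_square_sum:
  assumes k: "selfadjoint k" and m: "selfadjoint m" and km: "k \<diamondop> m = m \<diamondop> k"
    and sum: "k \<diamondop> k + m \<diamondop> m = \<nu> *\<^sub>R id_blinfun" and "\<nu> \<ge> 0"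
  shows "norm (k \<diamondop> k) \<le> \<nu>"
proof -
  have bd: "norm (k d + scaleC c (m d)) \<le> sqrt \<nu> * norm d" if c: "c = \<i> \<or> c = - \<i>" for c d
  proof -
    have cc: "cnj c = - c" "c * c = - 1" using c by auto
    have "star (k d + scaleC c (m d)) * (k d + scaleC c (m d))
        = star d * (k \<diamondop> k) d + star d * (m \<diamondop> m) d
          + scaleC c (star d * (k \<diamondop> m) d - star d * (m \<diamondop> k) d)"
      using k m by (simp add: op_adjoint_def star_add star_scaleC distrib_left distrib_right
          left_diff_distrib scaleC_mult_left scaleC_mult_right cc scaleC_scaleC scaleC_diff_right scaleC_minus_left scaleC_one)
    also have "\<dots> = star d * (k \<diamondop> k + m \<diamondop> m) d"
      unfolding km by (simp add: scaleC_zero_right blinfun.bilinear_simps distrib_left)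
    also have "\<dots> = \<nu> *\<^sub>R (star d * d)" unfolding sum by (simp add: blinfun.bilinear_simps)
    finally have "(norm (k d + scaleC c (m d)))\<^sup>2 = (sqrt \<nu> * norm d)\<^sup>2"
      using \<open>\<nu> \<ge> 0\<close> by (simp flip: cstar_identity add: power_mult_distrib)
    then show ?thesis using \<open>\<nu> \<ge> 0\<close> by simp
  qed
  have "norm k \<le> sqrt \<nu>"
  proof (rule norm_blinfun_bound)
    fix d
    have "2 *\<^sub>R k d = (k d + scaleC \<i> (m d)) + (k d + scaleC (- \<i>) (m d))"
      by (simp add: scaleC_minus_left scaleR_2)
    then have "2 * norm (k d) \<le> 2 * (sqrt \<nu> * norm d)"
      using bd[of \<i> d] bd[of "- \<i>" d]
        norm_triangle_ineq[of "k d + scaleC \<i> (m d)" "k d + scaleC (- \<i>) (m d)"]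
      using norm_scaleR[of 2 "k d"] by simp
    then show "norm (k d) \<le> sqrt \<nu> * norm d" by simp
  qed (simp add: \<open>\<nu> \<ge> 0\<close>)
  then have "norm k * norm k \<le> sqrt \<nu> * sqrt \<nu>" using \<open>\<nu> \<ge> 0\<close> by (intro mult_mono) auto
  then show ?thesis using norm_blinfun_compose[of k k] \<open>\<nu> \<ge> 0\<close> by simp
qed

text \<open>For a contraction \<open>k\<close>, the self-adjoint root \<open>m = 1 - Y\<close> of
  \<open>1 - k k\<close> commutes with \<open>k\<close>. So \<open>m m + k k = 1\<close>, and
  \<open>norm_square_le_of_square_sum\<close> bounds the norm of \<open>1 - k k\<close> by
  \<open>1\<close>. This is the condition in \<open>op_positive\<close>, rescaled by
  \<open>c\<^sup>2\<close>.\<close>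

lemma op_positive_square:
  assumes "selfadjoint K" shows "op_positive (K \<diamondop> K)"
proof -
  \<comment> \<open>Adding \<open>1\<close> keeps the divisor positive when
    \<open>K = 0\<close>.\<close>
  define c where "c = norm K + 1"
  define k where "k = (1/c) *\<^sub>R K"
  have c: "c > 0" by (simp add: c_def add_nonneg_pos)
  have k: "selfadjoint k" unfolding k_def by (intro op_adjoint_intros assms)
  have "norm k \<le> 1" using c by (simp add: k_def c_def)
  then have "norm (k \<diamondop> k) \<le> 1"
    using norm_blinfun_compose[of k k] mult_le_one[of "norm k" "norm k"] by simp
  moreover have "selfadjoint (k \<diamondop> k)" by (intro op_adjoint_intros k)
  ultimately obtain Y where Y: "(id_blinfun - Y) \<diamondop> (id_blinfun - Y) = id_blinfun - k \<diamondop> k"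
    "selfadjoint Y" "\<And>Z. Z \<diamondop> (k \<diamondop> k) = (k \<diamondop> k) \<diamondop> Z \<Longrightarrow> Z \<diamondop> Y = Y \<diamondop> Z"
    using selfadjoint_sqrt_contraction by metis
  have "k \<diamondop> Y = Y \<diamondop> k" by (rule Y) (auto intro: blinfun_eqI)
  then have "k (Y d) = Y (k d)" for d by (metis blinfun_apply_blinfun_compose)
  then have "norm ((id_blinfun - Y) \<diamondop> (id_blinfun - Y)) \<le> 1"
    by (intro norm_square_le_of_square_sum[of _ k] op_adjoint_intros Y k)
      (auto intro!: blinfun_eqI simp: Y(1) blinfun.bilinear_simps)
  moreover have "c\<^sup>2 *\<^sub>R id_blinfun - K \<diamondop> K = c\<^sup>2 *\<^sub>R (id_blinfun - k \<diamondop> k)"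
    using c by (intro blinfun_eqI) (simp add: k_def blinfun.bilinear_simps scaleR_diff_right power2_eq_square)
  ultimately have "norm (c\<^sup>2 *\<^sub>R id_blinfun - K \<diamondop> K) \<le> c\<^sup>2"
    unfolding Y(1) using c by (simp add: mult_left_le)
  then show ?thesis
    unfolding op_positive_def using c by (intro conjI op_adjoint_intros assms exI[of _ "c\<^sup>2"]) auto
qed

section \<open>The cone of positive operators\<close>

lemma op_positive_add:
  assumes "op_positive S" "op_positive T" shows "op_positive (S + T)"
proof -
  from assms obtain t u where "t > 0" "norm (t *\<^sub>R id_blinfun - S) \<le> t"
    "u > 0" "norm (u *\<^sub>R id_blinfun - T) \<le> u" and sa: "selfadjoint S" "selfadjoint T"
    by (auto simp: op_positive_def)
  then have "norm ((t + u) *\<^sub>R id_blinfun - (S + T)) \<le> t + u"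
    using norm_triangle_ineq[of "t *\<^sub>R id_blinfun - S" "u *\<^sub>R id_blinfun - T"]
    by (simp add: algebra_simps)
  then show ?thesis
    using sa \<open>t > 0\<close> \<open>u > 0\<close> unfolding op_positive_def
    by (intro conjI op_adjoint_intros exI[of _ "t + u"]) auto
qed

lemma op_positive_zero: "op_positive 0"
  unfolding op_positive_def using norm_blinfun_id_le
  by (intro conjI op_adjoint_intros exI[of _ 1]) auto

lemma op_positive_scaleR:
  assumes "op_positive T" "c \<ge> 0" shows "op_positive (c *\<^sub>R T)"
proof (cases "c = 0")
  case False
  with assms obtain t where t: "t > 0" "norm (t *\<^sub>R id_blinfun - T) \<le> t" "selfadjoint T"
    by (auto simp: op_positive_def)
  have "(c * t) *\<^sub>R id_blinfun - c *\<^sub>R T = c *\<^sub>R (t *\<^sub>R id_blinfun - T)"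
    by (simp add: scaleR_diff_right)
  then have "norm ((c * t) *\<^sub>R id_blinfun - c *\<^sub>R T) \<le> c * t"
    using t assms(2) by (simp add: mult_left_mono)
  then show ?thesis
    using t assms(2) False unfolding op_positive_def
    by (intro conjI op_adjoint_intros exI[of _ "c * t"]) auto
qed (simp add: op_positive_zero)

lemma op_positive_norm_diff:
  assumes "selfadjoint T" "norm T \<le> c" shows "op_positive (c *\<^sub>R id_blinfun - T)"
proof (cases "c = 0")
  case False
  then have "c > 0" using norm_ge_zero[of T] assms(2) by linarith
  then show ?thesis
    using assms unfolding op_positive_def
    by (intro conjI op_adjoint_intros exI[of _ c]) auto
qed (use assms in \<open>simp add: op_positive_zero\<close>)

text \<open>The roots \<open>k\<close> of \<open>P\<close> and \<open>m\<close> of its complement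
  commute, because \<open>m\<close> commutes with everything that commutes with the complement;
  their squares add up to \<open>\<nu>\<close>.\<close>

lemma norm_le_of_op_positive:
  assumes "op_positive P" "op_positive (\<nu> *\<^sub>R id_blinfun - P)" "\<nu> \<ge> 0"
  shows "norm P \<le> \<nu>"
proof -
  obtain k where k: "op_positive k" "k \<diamondop> k = P" using op_positive_sqrt[OF assms(1)] by metis
  obtain m where m: "op_positive m" "m \<diamondop> m = \<nu> *\<^sub>R id_blinfun - P"
    "\<And>Z. Z \<diamondop> (\<nu> *\<^sub>R id_blinfun - P) = (\<nu> *\<^sub>R id_blinfun - P) \<diamondop> Z \<Longrightarrow> Z \<diamondop> m = m \<diamondop> Z"
    using op_positive_sqrt[OF assms(2)] by metis
  have "k \<diamondop> m = m \<diamondop> k"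
    by (rule m, rule blinfun_eqI) (simp add: blinfun.bilinear_simps k(2)[symmetric])
  then have "norm (k \<diamondop> k) \<le> \<nu>"
    using k m(1,2) assms(3) by (intro norm_square_le_of_square_sum[of k m]) (auto simp: op_positive_def)
  then show ?thesis by (simp add: k)
qed

text \<open>With \<open>\<nu>\<close> the norm of \<open>S + T\<close>, the complement
  \<open>\<nu> - S\<close> is the sum of \<open>T\<close> and \<open>\<nu> - (S + T)\<close>, both
  positive.\<close>

lemma op_positive_mono_norm:
  assumes "op_positive S" "op_positive T" shows "norm S \<le> norm (S + T)"
proof (rule norm_le_of_op_positive)
  have "selfadjoint (S + T)" using op_positive_add[OF assms] by (simp add: op_positive_def)
  then have "op_positive (T + (norm (S + T) *\<^sub>R id_blinfun - (S + T)))"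
    by (intro op_positive_add[OF assms(2)] op_positive_norm_diff) simp_all
  moreover have "T + (norm (S + T) *\<^sub>R id_blinfun - (S + T)) = norm (S + T) *\<^sub>R id_blinfun - S"
    by (rule blinfun_eqI) (simp add: blinfun.bilinear_simps)
  ultimately show "op_positive (norm (S + T) *\<^sub>R id_blinfun - S)" by simp
qed (simp_all add: assms)

definition scaleC_blinfun :: "complex \<Rightarrow> 'b::cstar_algebra \<Rightarrow>\<^sub>L 'b" where
  "scaleC_blinfun c = Blinfun (scaleC c)"

lemma scaleC_blinfun_apply: "blinfun_apply (scaleC_blinfun c) d = scaleC c d"
  unfolding scaleC_blinfun_def
  by (simp add: bounded_linear_Blinfun_apply
      bounded_bilinear.bounded_linear_right[OF bounded_bilinear_scaleC])

text \<open>Bounded operators here are only real linear; having an adjoint forces complex linearity,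
  since the inner product is complex linear in its second argument.\<close>

lemma op_adjoint_scaleC:
  assumes "op_adjoint T T'" shows "T (scaleC c d) = scaleC c (T d)"
proof (rule star_mult_cancel)
  fix e
  have T: "star e * T y = star (T' e) * y" for y
    using op_adjoint_sym[OF assms] by (simp add: op_adjoint_def)
  show "star e * T (scaleC c d) = star e * scaleC c (T d)"
    unfolding T scaleC_mult_right by (simp add: T)
qed

text \<open>Kaplansky's trick: with the real and imaginary parts \<open>H\<close>, \<open>G\<close> of \<open>X\<close>, the operator
  \<open>X X' = 2 H\<^sup>2 + 2 G\<^sup>2 + C\<close> is positive, so \<open>X' (t - X X') X = - (t C + C\<^sup>2)\<close> has norm at most
  \<open>t \<parallel>C\<parallel>\<close>. This bounds \<open>C\<close> through \<open>(t + 2 N) C + (C - N)\<^sup>2 = t C + C\<^sup>2 + N\<^sup>2\<close>, \<open>N = \<parallel>C\<parallel>\<close>.\<close>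

lemma op_positive_negative_square:
  assumes X: "op_adjoint X X'" and C: "op_positive C" and XC: "X' \<diamondop> X = - C"
  shows "C = 0"
proof -
  define H where "H = (1/2) *\<^sub>R (X + X')"
  define G where "G = (1/2) *\<^sub>R (scaleC_blinfun \<i> \<diamondop> (X - X'))"
  have H: "selfadjoint H"
    using op_adjoint_scaleR[OF op_adjoint_add[OF X op_adjoint_sym[OF X]]]
    by (simp add: H_def add.commute)
  have G: "selfadjoint G"
    unfolding op_adjoint_def
  proof (intro allI)
    fix d e
    have X_simps: "star (X d) * e = star d * X' e" "star (X' d) * e = star d * X e"
      by (rule op_adjointD[OF X], rule op_adjointD[OF op_adjoint_sym[OF X]])
    have G_apply: "G d = (1/2) *\<^sub>R scaleC \<i> (X d - X' d)" for d
      by (simp add: G_def scaleC_blinfun_apply blinfun.bilinear_simps scaleC_diff_right)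
    show "star (G d) * e = star d * G e"
      by (simp add: G_apply star_scaleR star_scaleC star_diff scaleC_mult_left scaleC_mult_right
          left_diff_distrib right_diff_distrib scaleC_minus_left scaleC_diff_right X_simps)
  qed
  have "X \<diamondop> X' = 2 *\<^sub>R (H \<diamondop> H) + 2 *\<^sub>R (G \<diamondop> G) - X' \<diamondop> X"
    by (rule blinfun_eqI)
      (simp add: G_def H_def scaleC_blinfun_apply blinfun.bilinear_simps scaleC_scaleC scaleC_diff_right scaleC_minus_left scaleC_one
        op_adjoint_scaleC[OF X] op_adjoint_scaleC[OF op_adjoint_sym[OF X]] algebra_simps
        flip: scaleR_add_left)
  then have D: "X \<diamondop> X' = 2 *\<^sub>R (H \<diamondop> H) + 2 *\<^sub>R (G \<diamondop> G) + C" using XC by simp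
  have "op_positive (X \<diamondop> X')"
    unfolding D by (intro op_positive_add op_positive_scaleR op_positive_square H G C) auto
  then obtain t where t: "t > 0" "norm (t *\<^sub>R id_blinfun - X \<diamondop> X') \<le> t"
    by (auto simp: op_positive_def)
  define N where "N = norm C"
  have N: "N \<ge> 0" "norm (X' \<diamondop> X) = N" by (simp_all add: N_def XC)
  have XCd: "X' (X d) = - C d" for d
    using XC by (metis blinfun_apply_blinfun_compose uminus_blinfun.rep_eq)
  have "t *\<^sub>R C + C \<diamondop> C = - (X' \<diamondop> ((t *\<^sub>R id_blinfun - X \<diamondop> X') \<diamondop> X))"
    by (rule blinfun_eqI) (simp add: blinfun.bilinear_simps XCd)
  then have "norm (t *\<^sub>R C + C \<diamondop> C) = norm (X' \<diamondop> ((t *\<^sub>R id_blinfun - X \<diamondop> X') \<diamondop> X))" by simp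
  also have "\<dots> \<le> norm X' * (norm (t *\<^sub>R id_blinfun - X \<diamondop> X') * norm X)"
    by (intro order_trans[OF norm_blinfun_compose] mult_left_mono norm_blinfun_compose) simp
  also have "\<dots> \<le> norm X * (t * norm X)"
    using t op_adjoint_norm_le[OF X] by (intro mult_mono) auto
  also have "\<dots> \<le> t * N"
    using op_adjoint_norm_sq_le[OF X] t unfolding N by (simp add: power2_eq_square)
  finally have le: "norm (t *\<^sub>R C + C \<diamondop> C) \<le> t * N" .
  have sa: "selfadjoint C" using C by (simp add: op_positive_def)
  have "op_positive ((t * N) *\<^sub>R id_blinfun - (t *\<^sub>R C + C \<diamondop> C)
      + (C - N *\<^sub>R id_blinfun) \<diamondop> (C - N *\<^sub>R id_blinfun))"
    by (intro op_positive_add op_positive_norm_diff op_positive_square op_adjoint_intros sa le)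
  also have "\<dots> = (t * N + N * N) *\<^sub>R id_blinfun - (t + 2 * N) *\<^sub>R C"
    by (rule blinfun_eqI) (simp add: blinfun.bilinear_simps algebra_simps flip: scaleR_2)
  finally have "norm ((t + 2 * N) *\<^sub>R C) \<le> t * N + N * N"
    using t N by (intro norm_le_of_op_positive op_positive_scaleR C) auto
  moreover have "norm ((t + 2 * N) *\<^sub>R C) = (t + 2 * N) * N"
    using t N by (simp add: N_def)
  ultimately have "N * N \<le> 0" by (simp add: algebra_simps)
  then show "C = 0" using N by (simp add: N_def mult_le_0_iff)
qed

section \<open>Elements \<open>star b * b\<close> as positive left multiplications\<close>

lemma selfadjoint_norm_sq: "selfadjoint T \<Longrightarrow> T \<diamondop> T = 0 \<Longrightarrow> T = 0"
  using op_adjoint_norm_sq_le[of T T] by simp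

text \<open>Despite its name, \<open>blinfun_mult_right a\<close> is multiplication by
  \<open>a\<close> on the left.\<close>

lemma op_adjoint_mult_left: "op_adjoint (blinfun_mult_right a) (blinfun_mult_right (star a))"
  by (simp add: op_adjoint_def star_mult mult.assoc)

text \<open>\<open>K\<close> is the absolute value of \<open>A\<close>, and
  \<open>M = (K - A) / 2\<close> is the negative part, so that \<open>A M = - M M\<close>. The
  operator \<open>X\<close>, left multiplication by \<open>b\<close> after \<open>M\<close>,
  satisfies \<open>X' X = M A M = - M M M\<close>, and \<open>M M M\<close> is positive as the
  square of \<open>Q M\<close> with \<open>Q\<close> a root of \<open>K\<close>. Now
  \<open>op_positive_negative_square\<close> gives \<open>M M M = 0\<close>, hence
  \<open>M = 0\<close> and \<open>A = K\<close>.\<close>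

lemma op_positive_mult_left: "op_positive (blinfun_mult_right (star b * b))"
proof -
  define A where "A = blinfun_mult_right (star b * b)"
  have A: "selfadjoint A"
    using op_adjoint_mult_left[of "star b * b"] by (simp add: A_def star_mult star_star)
  obtain K where K: "op_positive K" "K \<diamondop> K = A \<diamondop> A"
    "\<And>Z. Z \<diamondop> (A \<diamondop> A) = (A \<diamondop> A) \<diamondop> Z \<Longrightarrow> Z \<diamondop> K = K \<diamondop> Z"
    using op_positive_sqrt[OF op_positive_square[OF A]] by metis
  have "A \<diamondop> K = K \<diamondop> A" by (rule K) (auto intro: blinfun_eqI)
  then have AK: "A (K d) = K (A d)" and KK: "K (K d) = A (A d)" for d
    using K(2) by (metis blinfun_apply_blinfun_compose)+
  obtain Q where Q: "op_positive Q" "Q \<diamondop> Q = K" "\<And>Z. Z \<diamondop> K = K \<diamondop> Z \<Longrightarrow> Z \<diamondop> Q = Q \<diamondop> Z"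
    using op_positive_sqrt[OF K(1)] by metis
  have QQ: "Q (Q d) = K d" for d using Q(2) by (metis blinfun_apply_blinfun_compose)
  define M where "M = (1/2) *\<^sub>R (K - A)"
  have M: "selfadjoint M" unfolding M_def using K(1) A by (intro op_adjoint_intros) (auto simp: op_positive_def)
  have KM: "K (M d) = M (M d)" "A (M d) = - M (M d)" for d
    by (simp_all add: M_def blinfun.bilinear_simps AK KK algebra_simps flip: scaleR_add_left)
  have "M \<diamondop> K = K \<diamondop> M"
    by (rule blinfun_eqI) (simp add: M_def blinfun.bilinear_simps AK)
  from Q(3)[OF this] have MQ: "M (Q d) = Q (M d)" for d by (metis blinfun_apply_blinfun_compose)
  have sQ: "selfadjoint Q" using Q(1) by (simp add: op_positive_def)
  have "Q \<diamondop> M = M \<diamondop> Q" by (rule blinfun_eqI) (simp add: MQ)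
  then have "selfadjoint (Q \<diamondop> M)" using op_adjoint_compose[OF sQ M] by simp
  then have "op_positive ((Q \<diamondop> M) \<diamondop> (Q \<diamondop> M))" by (rule op_positive_square)
  moreover have "(Q \<diamondop> M) \<diamondop> (Q \<diamondop> M) = M \<diamondop> (M \<diamondop> M)"
    by (rule blinfun_eqI) (simp add: MQ QQ KM)
  ultimately have C: "op_positive (M \<diamondop> (M \<diamondop> M))" by simp
  have "op_adjoint (blinfun_mult_right b \<diamondop> M) (M \<diamondop> blinfun_mult_right (star b))"
    by (intro op_adjoint_compose op_adjoint_mult_left M)
  moreover have "(M \<diamondop> blinfun_mult_right (star b)) \<diamondop> (blinfun_mult_right b \<diamondop> M) = - (M \<diamondop> (M \<diamondop> M))"
  proof (rule blinfun_eqI)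
    fix d
    have "star b * (b * M d) = A (M d)" by (simp add: A_def mult.assoc)
    then show "((M \<diamondop> blinfun_mult_right (star b)) \<diamondop> (blinfun_mult_right b \<diamondop> M)) d = (- (M \<diamondop> (M \<diamondop> M))) d"
      by (simp add: blinfun.bilinear_simps KM)
  qed
  ultimately have "M \<diamondop> (M \<diamondop> M) = 0" using C op_positive_negative_square by blast
  then have "M (M (M d)) = 0" for d by (metis blinfun_apply_blinfun_compose zero_blinfun.rep_eq)
  then have "(M \<diamondop> M) \<diamondop> (M \<diamondop> M) = 0" by (intro blinfun_eqI) simp
  then have "M \<diamondop> M = 0" using selfadjoint_norm_sq[OF op_adjoint_compose[OF M M]] by blast
  then have "M = 0" using selfadjoint_norm_sq[OF M] by blast
  then have "K = A" by (simp add: M_def)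
  then show ?thesis using K(1) by (simp add: A_def)
qed

text \<open>Without a unit to evaluate at, the lower bound is read off at
  \<open>star a\<close>.\<close>

lemma norm_mult_left_blinfun: "norm (blinfun_mult_right (a::'b::cstar_algebra)) = norm a"
proof (rule antisym)
  show "norm (blinfun_mult_right a) \<le> norm a"
    by (rule norm_blinfun_bound) (simp_all add: norm_mult_ineq)
  have "norm a * norm a = norm (blinfun_mult_right a (star a))"
    using cstar_identity[of "star a"] by (simp add: star_star norm_star power2_eq_square)
  also have "\<dots> \<le> norm (blinfun_mult_right a) * norm a"
    using norm_blinfun[of "blinfun_mult_right a" "star a"] by (simp add: norm_star)
  finally show "norm a \<le> norm (blinfun_mult_right a)"
    by (cases "a = 0") simp_all
qed

text \<open>Left multiplication is isometric and turns elements \<open>star b * b\<close> into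
  positive operators, on which the norm is monotone. Three summands are what the expansion in
  \<open>Cauchy_Schwarz\<close> produces.\<close>

lemma cstar_positive_mono_norm:
  assumes "cstar_positive a" "cstar_positive b" "cstar_positive c"
  shows "norm a \<le> norm (a + b + c)"
proof -
  let ?L = "blinfun_mult_right"
  have "op_positive (?L a)" "op_positive (?L b)" "op_positive (?L c)"
    using assms op_positive_mult_left unfolding cstar_positive_def by metis+
  then have "norm (?L a) \<le> norm (?L a + (?L b + ?L c))"
    by (intro op_positive_mono_norm op_positive_add)
  also have "?L a + (?L b + ?L c) = ?L (a + b + c)"
    by (rule blinfun_eqI) (simp add: blinfun.bilinear_simps algebra_simps)
  finally show ?thesis by (simp add: norm_mult_left_blinfun)
qed

text \<open>For positive \<open>p\<close> of norm at most \<open>N\<close>, the element below is \<open>(l a)\<^sup>* (l a)\<close> with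
  \<open>l\<close> the square root of \<open>N - p\<close>.\<close>

lemma cstar_positive_conj_diff:
  assumes "cstar_positive p" "norm p \<le> N"
  shows "cstar_positive (N *\<^sub>R (star a * a) - star a * p * a)"
proof -
  let ?L = "blinfun_mult_right"
  have "star p = p" using assms(1) by (auto simp: cstar_positive_def star_mult star_star)
  then have "op_positive (N *\<^sub>R id_blinfun - ?L p)"
    using op_adjoint_mult_left[of p] assms(2)
    by (intro op_positive_norm_diff) (simp_all add: norm_mult_left_blinfun)
  then obtain l where l: "op_positive l" "l \<diamondop> l = N *\<^sub>R id_blinfun - ?L p"
    using op_positive_sqrt by metis
  have "star (l a) * l a = star a * (l \<diamondop> l) a"
    using l(1) by (simp add: op_positive_def op_adjoint_def)
  also have "\<dots> = N *\<^sub>R (star a * a) - star a * p * a"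
    unfolding l by (simp add: blinfun.bilinear_simps right_diff_distrib mult.assoc)
  finally show ?thesis unfolding cstar_positive_def by metis
qed


section \<open>Contraction semigroups and their resolvents\<close>

text \<open>Formulated on a complete subspace so that it applies to the embedded carrier of a
  Hilbert module. It is used twice, for the isometries and for their adjoints.\<close>

locale contraction_semigroup =
  fixes S :: "'a::real_normed_vector set" and T :: "real \<Rightarrow> 'a \<Rightarrow> 'a"
  assumes subspace: "subspace S"
    and complete: "complete S"
    and T_in: "0 \<le> t \<Longrightarrow> x \<in> S \<Longrightarrow> T t x \<in> S"
    and T_add: "0 \<le> t \<Longrightarrow> x \<in> S \<Longrightarrow> y \<in> S \<Longrightarrow> T t (x + y) = T t x + T t y"
    and T_scaleR: "0 \<le> t \<Longrightarrow> x \<in> S \<Longrightarrow> T t (r *\<^sub>R x) = r *\<^sub>R T t x"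
    and T_norm: "0 \<le> t \<Longrightarrow> x \<in> S \<Longrightarrow> norm (T t x) \<le> norm x"
    and T_semigroup: "0 \<le> r \<Longrightarrow> 0 \<le> t \<Longrightarrow> x \<in> S \<Longrightarrow> T r (T t x) = T (r + t) x"
    and T_0: "x \<in> S \<Longrightarrow> T 0 x = x"
    and T_cont: "x \<in> S \<Longrightarrow> ((\<lambda>t. T t x) \<longlongrightarrow> x) (at_right 0)"
begin

lemmas S_intros = subspace_0[OF subspace] subspace_add[OF subspace] subspace_diff[OF subspace]
  subspace_scale[OF subspace] subspace_neg[OF subspace] T_in

lemma T_diff: "0 \<le> t \<Longrightarrow> x \<in> S \<Longrightarrow> y \<in> S \<Longrightarrow> T t (x - y) = T t x - T t y"
  using T_add[of t x "(-1) *\<^sub>R y"] T_scaleR[of t y "-1"] S_intros(4)[of y "-1"] by simp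

lemma T_small:
  assumes "x \<in> S" "e > 0"
  obtains d where "d > 0" "\<And>r. 0 \<le> r \<Longrightarrow> r < d \<Longrightarrow> norm (T r x - x) < e"
proof -
  obtain d where d: "d > 0" "\<And>r. 0 < r \<Longrightarrow> r < d \<Longrightarrow> dist (T r x) x < e"
    using T_cont[OF assms(1)] assms(2) unfolding tendsto_iff eventually_at_right_field
    by (metis field_lbound_gt_zero zero_less_one)
  have "norm (T r x - x) < e" if "0 \<le> r" "r < d" for r
    using d(2)[of r] that T_0[OF assms(1)] assms(2) by (cases "r = 0") (auto simp: dist_norm)
  then show ?thesis using d(1) that by blast
qed

text \<open>Write \<open>T l x = T (t n) (T (l - t n) x)\<close>: the contraction
  \<open>T (t n)\<close> reduces the claim to continuity at \<open>0\<close>, and this requires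
  \<open>t n\<close> to stay below \<open>l\<close>.\<close>

lemma T_continuous_from_below:
  assumes x: "x \<in> S" and t: "\<And>n. 0 \<le> t n" "\<And>n. t n \<le> l" and lim: "t \<longlonglongrightarrow> l"
  shows "(\<lambda>n. T (t n) x) \<longlonglongrightarrow> T l x"
proof (rule LIMSEQ_I)
  fix e :: real assume "e > 0"
  then obtain d where d: "d > 0" "\<And>r. 0 \<le> r \<Longrightarrow> r < d \<Longrightarrow> norm (T r x - x) < e"
    using T_small[OF x] by metis
  from lim \<open>d > 0\<close> obtain N where N: "\<And>n. n \<ge> N \<Longrightarrow> \<bar>t n - l\<bar> < d"
    by (metis LIMSEQ_D real_norm_def)
  have "norm (T (t n) x - T l x) < e" if "n \<ge> N" for n
  proof -
    have nn: "0 \<le> l - t n" "l - t n < d" using t(2)[of n] N[OF that] by auto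
    have "T l x = T (t n) (T (l - t n) x)" using T_semigroup[OF t(1)[of n] nn(1) x] by simp
    then have "T (t n) x - T l x = T (t n) (x - T (l - t n) x)"
      using t(1)[of n] nn(1) x by (simp add: T_diff T_in)
    then have "norm (T (t n) x - T l x) \<le> norm (x - T (l - t n) x)"
      using T_norm[OF t(1)[of n]] x nn(1) by (simp add: S_intros)
    also have "\<dots> < e" using d(2)[OF nn] by (simp add: norm_minus_commute)
    finally show ?thesis .
  qed
  then show "\<exists>N. \<forall>n\<ge>N. norm (T (t n) x - T l x) < e" by blast
qed

text \<open>The hypothesis on \<open>u\<close> says that \<open>u\<close> is the resolvent at \<open>1\<close> of the discrete semigroup generated
  by \<open>T h\<close>; the bound compares it with the integral of \<open>exp (- r) *\<^sub>R T r x\<close> over \<open>[0, n h]\<close>.\<close>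

lemma discrete_resolvent_bound:
  fixes h \<epsilon> :: real
  assumes x: "x \<in> S" and u: "u \<in> S" and h: "0 \<le> h"
    and fp: "u = (1 - exp (- h)) *\<^sub>R x + exp (- h) *\<^sub>R T h u"
    and v: "\<And>k. k < n \<Longrightarrow> norm (T (real k * h) x - v) \<le> \<epsilon>"
  shows "norm (u - exp (- (real n * h)) *\<^sub>R T (real n * h) u - (1 - exp (- (real n * h))) *\<^sub>R v)
    \<le> (1 - exp (- (real n * h))) * \<epsilon>"
  using v
proof (induction n)
  case 0
  then show ?case using T_0[OF u] by simp
next
  case (Suc n)
  define q where "q = exp (- h)"
  define p where "p = exp (- (real n * h))"
  have q: "0 < q" "q \<le> 1" and p: "0 < p" using h by (simp_all add: q_def p_def)
  have pq: "exp (- (real (Suc n) * h)) = p * q"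
    by (simp add: p_def q_def algebra_simps flip: exp_add)
  let ?t = "real n * h"
  have t: "0 \<le> ?t" using h by simp
  have "T ?t (u - q *\<^sub>R T h u) = T ?t u - q *\<^sub>R T (real (Suc n) * h) u"
    using T_semigroup[OF t h u] t u h by (simp add: T_diff T_scaleR S_intros algebra_simps)
  moreover have "u - q *\<^sub>R T h u = (1 - q) *\<^sub>R x"
    using fp unfolding q_def by (metis add_diff_cancel_right')
  ultimately have step: "T ?t u - q *\<^sub>R T (real (Suc n) * h) u = (1 - q) *\<^sub>R T ?t x"
    using T_scaleR[OF t x] by simp
  have "u - (p * q) *\<^sub>R T (real (Suc n) * h) u - (1 - p * q) *\<^sub>R v
      = (u - p *\<^sub>R T ?t u - (1 - p) *\<^sub>R v) + p *\<^sub>R (T ?t u - q *\<^sub>R T (real (Suc n) * h) u) - (p * (1 - q)) *\<^sub>R v"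
    by (simp add: algebra_simps)
  also have "\<dots> = (u - p *\<^sub>R T ?t u - (1 - p) *\<^sub>R v) + (p * (1 - q)) *\<^sub>R (T ?t x - v)"
    unfolding step by (simp add: algebra_simps)
  also have "norm \<dots> \<le> (1 - p) * \<epsilon> + (p * (1 - q)) * \<epsilon>"
  proof (rule norm_triangle_le, rule add_mono)
    show "norm (u - p *\<^sub>R T ?t u - (1 - p) *\<^sub>R v) \<le> (1 - p) * \<epsilon>"
      unfolding p_def using Suc by simp
    show "norm ((p * (1 - q)) *\<^sub>R (T ?t x - v)) \<le> (p * (1 - q)) * \<epsilon>"
      using Suc.prems[of n] p q by (simp add: abs_mult mult_left_mono)
  qed
  also have "\<dots> = (1 - p * q) * \<epsilon>" by (simp add: algebra_simps)
  finally show ?case unfolding pq .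
qed

lemma discrete_resolvent_ex:
  assumes x: "x \<in> S" and h: "0 < h"
  shows "\<exists>u\<in>S. u = (1 - exp (- h)) *\<^sub>R x + exp (- h) *\<^sub>R T h u"
proof -
  let ?f = "\<lambda>u. (1 - exp (- h)) *\<^sub>R x + exp (- h) *\<^sub>R T h u"
  have "\<exists>!u. u \<in> S \<and> ?f u = u"
  proof (rule Banach_fix[OF complete, where c = "exp (- h)"])
    show "S \<noteq> {}" "?f ` S \<subseteq> S" using x h by (auto intro!: S_intros)
    fix u v assume "u \<in> S" "v \<in> S"
    then have "?f u - ?f v = exp (- h) *\<^sub>R T h (u - v)"
      using h by (simp add: T_diff scaleR_diff_right)
    then show "dist (?f u) (?f v) \<le> exp (- h) * dist u v"
      using T_norm[of h "u - v"] h \<open>u \<in> S\<close> \<open>v \<in> S\<close> by (simp add: dist_norm S_intros)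
  qed (use h in auto)
  then show ?thesis by metis
qed

text \<open>This property characterises \<open>u\<close> as the integral of \<open>exp (- r) *\<^sub>R T r x\<close> over the half line,
  without mentioning integrals.\<close>

definition is_resolvent :: "'a \<Rightarrow> 'a \<Rightarrow> bool" where
  "is_resolvent x u \<longleftrightarrow> u \<in> S \<and> (\<forall>t\<ge>0. \<forall>v \<epsilon>. (\<forall>r\<in>{0..t}. norm (T r x - v) \<le> \<epsilon>) \<longrightarrow>
     norm (u - exp (- t) *\<^sub>R T t u - (1 - exp (- t)) *\<^sub>R v) \<le> (1 - exp (- t)) * \<epsilon>)"

text \<open>\<open>u n\<close> solves the discrete equation with step \<open>h n\<close>. For
  \<open>n\<close> at least \<open>N\<close> the step \<open>h N\<close> is a multiple of
  \<open>h n\<close>, so by \<open>discrete_resolvent_bound\<close> over \<open>[0, h N]\<close> the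
  vector \<open>u n\<close> nearly satisfies the equation that determines \<open>u N\<close>. That
  equation has contraction factor \<open>exp (- h N)\<close>, so \<open>u\<close> is Cauchy, and the
  bound passes to the limit.\<close>

lemma resolvent_ex:
  assumes x: "x \<in> S" shows "\<exists>u. is_resolvent x u"
proof -
  define h :: "nat \<Rightarrow> real" where "h n = 1 / 2 ^ n" for n
  have h: "0 < h n" for n by (simp add: h_def)
  have h_lim: "h \<longlonglongrightarrow> 0" unfolding h_def by (simp add: LIMSEQ_divide_realpow_zero)
  obtain u where u: "\<And>n. u n \<in> S" "\<And>n. u n = (1 - exp (- h n)) *\<^sub>R x + exp (- h n) *\<^sub>R T (h n) (u n)"
    using discrete_resolvent_ex[OF x h] by metis
  have "Cauchy u"
  proof (rule CauchyI')
    fix e :: real assume "e > 0"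
    then obtain d where d: "d > 0" "\<And>r. 0 \<le> r \<Longrightarrow> r < d \<Longrightarrow> norm (T r x - x) < e / 3"
      using T_small[OF x, of "e / 3"] by auto
    obtain N where N: "h N < d"
      using order_tendstoD(2)[OF h_lim d(1)] by (auto simp: eventually_sequentially)
    have near: "norm (u n - u N) \<le> e / 3" if "n \<ge> N" for n
    proof -
      define q where "q = exp (- h N)"
      have q: "0 < q" "q < 1" using h by (simp_all add: q_def)
      define m where "m = (2::nat) ^ (n - N)"
      have "real m * h n * 2 ^ n = h N * 2 ^ n"
        using that by (simp add: m_def h_def field_simps flip: power_add)
      then have m: "real m * h n = h N" by simp
      have close: "norm (T (real k * h n) x - x) \<le> e / 3" if "k < m" for k
      proof -
        have "real k * h n \<le> h N" unfolding m[symmetric] using that h[of n] by simp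
        then show ?thesis using d(2)[of "real k * h n"] N h[of n] by (simp add: less_imp_le)
      qed
      have *: "norm (u n - q *\<^sub>R T (h N) (u n) - (1 - q) *\<^sub>R x) \<le> (1 - q) * (e / 3)"
        using discrete_resolvent_bound[where n = m, OF x u(1) less_imp_le[OF h] u(2) close]
        unfolding m q_def by blast
      have "(u n - q *\<^sub>R T (h N) (u n) - (1 - q) *\<^sub>R x) + q *\<^sub>R T (h N) (u n - u N)
          = u n - ((1 - q) *\<^sub>R x + q *\<^sub>R T (h N) (u N))"
        unfolding T_diff[OF less_imp_le[OF h] u(1) u(1)] by (simp add: algebra_simps)
      also have "(1 - q) *\<^sub>R x + q *\<^sub>R T (h N) (u N) = u N"
        unfolding q_def by (rule u(2)[symmetric])
      finally have "norm (u n - u N) \<le> (1 - q) * (e / 3) + norm (q *\<^sub>R T (h N) (u n - u N))"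
        using norm_triangle_ineq * by (smt (verit))
      also have "\<dots> \<le> (1 - q) * (e / 3) + q * norm (u n - u N)"
        using T_norm[OF less_imp_le[OF h], of "u n - u N" N] q by (simp add: S_intros u(1))
      finally have "(1 - q) * norm (u n - u N) \<le> (1 - q) * (e / 3)"
        unfolding left_diff_distrib[of 1 q "norm (u n - u N)"] by linarith
      then show ?thesis using q by simp
    qed
    have "dist (u m) (u n) < e" if "m \<ge> N" "n > m" for m n
      using near[of m] near[of n] that \<open>e > 0\<close> norm_triangle_ineq4[of "u m - u N" "u n - u N"]
      by (simp add: dist_norm)
    then show "\<exists>M. \<forall>m\<ge>M. \<forall>n>m. dist (u m) (u n) < e" by blast
  qed
  then obtain U where U: "U \<in> S" "u \<longlonglongrightarrow> U"
    using complete u(1) unfolding complete_def by blast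
  have "norm (U - exp (- t) *\<^sub>R T t U - (1 - exp (- t)) *\<^sub>R v) \<le> (1 - exp (- t)) * \<epsilon>"
    if t: "0 \<le> t" and hyp: "\<And>r. 0 \<le> r \<Longrightarrow> r \<le> t \<Longrightarrow> norm (T r x - v) \<le> \<epsilon>" for t v \<epsilon>
  proof -
    \<comment> \<open>\<open>\<tau> n\<close> is the largest multiple of \<open>h n\<close> not
      exceeding \<open>t\<close>; it tends to \<open>t\<close> from below, as
      \<open>T_continuous_from_below\<close> demands.\<close>
    define k where "k n = nat \<lfloor>2 ^ n * t\<rfloor>" for n
    define \<tau> where "\<tau> n = real (k n) * h n" for n
    have k: "real (k n) \<le> 2 ^ n * t" "2 ^ n * t < real (k n) + 1" for n
      using t by (simp_all add: k_def)
    have \<tau>: "0 \<le> \<tau> n" "\<tau> n \<le> t" "t - h n \<le> \<tau> n" for n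
    proof -
      show "0 \<le> \<tau> n" "\<tau> n \<le> t"
        using k[of n] by (simp_all add: \<tau>_def h_def field_simps)
      have "t \<le> (real (k n) + 1) / 2 ^ n" using k(2)[of n] by (simp add: field_simps)
      then show "t - h n \<le> \<tau> n" by (simp add: \<tau>_def h_def add_divide_distrib)
    qed
    have "(\<lambda>n. t - h n) \<longlonglongrightarrow> t" using tendsto_diff[OF tendsto_const h_lim, of t] by simp
    then have \<tau>_lim: "\<tau> \<longlonglongrightarrow> t"
      by (rule tendsto_sandwich[rotated 2]) (auto simp: \<tau>)
    have bd: "norm (u n - exp (- \<tau> n) *\<^sub>R T (\<tau> n) (u n) - (1 - exp (- \<tau> n)) *\<^sub>R v)
        \<le> (1 - exp (- \<tau> n)) * \<epsilon>" for n
      unfolding \<tau>_def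
    proof (rule discrete_resolvent_bound[OF x u(1) less_imp_le[OF h] u(2)])
      fix j assume "j < k n"
      then have "real j * h n \<le> \<tau> n" using h[of n] by (simp add: \<tau>_def)
      then show "norm (T (real j * h n) x - v) \<le> \<epsilon>"
        using hyp[of "real j * h n"] \<tau>(2)[of n] h[of n] by simp
    qed
    have "(\<lambda>n. T (\<tau> n) (u n - U)) \<longlonglongrightarrow> 0"
    proof (rule Lim_null_comparison)
      show "\<forall>\<^sub>F n in sequentially. norm (T (\<tau> n) (u n - U)) \<le> norm (u n - U)"
        using T_norm \<tau>(1) u(1) U(1) by (simp add: S_intros)
      show "(\<lambda>n. norm (u n - U)) \<longlonglongrightarrow> 0"
        using U(2) by (simp add: LIM_zero tendsto_norm_zero)
    qed
    then have "(\<lambda>n. T (\<tau> n) (u n - U) + T (\<tau> n) U) \<longlonglongrightarrow> 0 + T t U"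
      by (intro tendsto_add T_continuous_from_below U \<tau> \<tau>_lim)
    then have Tu: "(\<lambda>n. T (\<tau> n) (u n)) \<longlonglongrightarrow> T t U"
      using T_diff[OF \<tau>(1) u(1) U(1)] by simp
    have "(\<lambda>n. norm (u n - exp (- \<tau> n) *\<^sub>R T (\<tau> n) (u n) - (1 - exp (- \<tau> n)) *\<^sub>R v))
        \<longlonglongrightarrow> norm (U - exp (- t) *\<^sub>R T t U - (1 - exp (- t)) *\<^sub>R v)"
      by (intro tendsto_intros U \<tau>_lim Tu)
    moreover have "(\<lambda>n. (1 - exp (- \<tau> n)) * \<epsilon>) \<longlonglongrightarrow> (1 - exp (- t)) * \<epsilon>"
      by (intro tendsto_intros \<tau>_lim)
    ultimately show ?thesis
      using bd by (intro LIMSEQ_le[of "\<lambda>n. norm (u n - exp (- \<tau> n) *\<^sub>R T (\<tau> n) (u n) - (1 - exp (- \<tau> n)) *\<^sub>R v)"]) auto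
  qed
  then show ?thesis using U(1) unfolding is_resolvent_def by (intro exI[of _ U]) auto
qed

section \<open>The resolvent and the generator\<close>

definition resolvent :: "'a \<Rightarrow> 'a" where
  "resolvent x = (SOME u. is_resolvent x u)"

lemma is_resolvent: "x \<in> S \<Longrightarrow> is_resolvent x (resolvent x)"
  unfolding resolvent_def using resolvent_ex by (rule someI_ex)

lemma resolvent_in: "x \<in> S \<Longrightarrow> resolvent x \<in> S"
  using is_resolvent by (simp add: is_resolvent_def)

lemma resolvent_bound:
  assumes "x \<in> S" "0 \<le> t" "\<And>r. 0 \<le> r \<Longrightarrow> r \<le> t \<Longrightarrow> norm (T r x - v) \<le> \<epsilon>"
  shows "norm (resolvent x - exp (- t) *\<^sub>R T t (resolvent x) - (1 - exp (- t)) *\<^sub>R v) \<le> (1 - exp (- t)) * \<epsilon>"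
  using is_resolvent[OF assms(1)] assms by (auto simp: is_resolvent_def)

lemma resolvent_norm_diff:
  assumes "x \<in> S" "0 \<le> t"
  shows "norm (resolvent x - exp (- t) *\<^sub>R T t (resolvent x)) \<le> (1 - exp (- t)) * norm x"
  using resolvent_bound[OF assms, of 0 "norm x"] T_norm assms by simp

lemma resolvent_norm:
  assumes "x \<in> S" shows "norm (resolvent x) \<le> norm x"
proof -
  let ?u = "resolvent x" and ?q = "exp (- 1 :: real)"
  have "norm ?u \<le> norm (?u - ?q *\<^sub>R T 1 ?u) + norm (?q *\<^sub>R T 1 ?u)"
    using norm_triangle_ineq[of "?u - ?q *\<^sub>R T 1 ?u" "?q *\<^sub>R T 1 ?u"] by simp
  also have "\<dots> \<le> (1 - ?q) * norm x + ?q * norm ?u"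
    using resolvent_norm_diff[OF assms, of 1] T_norm[of 1 ?u] resolvent_in[OF assms]
    by (intro add_mono) auto
  finally have "(1 - ?q) * norm ?u \<le> (1 - ?q) * norm x" by (simp add: algebra_simps)
  then show ?thesis by simp
qed

text \<open>With \<open>A\<close> the generator of \<open>T\<close>, the following says that \<open>A u = u - x\<close>. The normalisation
  by \<open>exp t - 1\<close> instead of \<open>t\<close> makes it immediate for the resolvent.\<close>

definition resolves :: "'a \<Rightarrow> 'a \<Rightarrow> bool" where
  "resolves x u \<longleftrightarrow> ((\<lambda>t. (1 / (exp t - 1)) *\<^sub>R (T t u - u)) \<longlongrightarrow> u - x) (at_right 0)"

text \<open>For short times \<open>T r x\<close> stays near \<open>x\<close>, so
  \<open>resolvent_bound\<close> is applied with \<open>v = x\<close>.\<close>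

lemma resolvent_approx:
  assumes x: "x \<in> S" and "0 < e"
  obtains d where "0 < d"
    "\<And>t. 0 < t \<Longrightarrow> t < d \<Longrightarrow>
      norm (resolvent x - exp (- t) *\<^sub>R T t (resolvent x) - (1 - exp (- t)) *\<^sub>R x) \<le> (1 - exp (- t)) * e"
proof -
  obtain d where d: "d > 0" "\<And>r. 0 \<le> r \<Longrightarrow> r < d \<Longrightarrow> norm (T r x - x) < e"
    using T_small[OF assms] by metis
  show ?thesis
  proof (rule that[OF d(1)])
    fix t assume "0 < t" "t < d"
    then show "norm (resolvent x - exp (- t) *\<^sub>R T t (resolvent x) - (1 - exp (- t)) *\<^sub>R x) \<le> (1 - exp (- t)) * e"
      by (intro resolvent_bound[OF x] less_imp_le[OF d(2)]) auto
  qed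
qed

lemma resolves_resolvent:
  assumes x: "x \<in> S" shows "resolves x (resolvent x)"
  unfolding resolves_def tendsto_iff
proof (intro allI impI)
  fix e :: real assume "e > 0"
  let ?u = "resolvent x"
  obtain d where d: "0 < d" "\<And>t. 0 < t \<Longrightarrow> t < d \<Longrightarrow>
      norm (?u - exp (- t) *\<^sub>R T t ?u - (1 - exp (- t)) *\<^sub>R x) \<le> (1 - exp (- t)) * (e / 2)"
    using resolvent_approx[OF x, of "e / 2"] \<open>e > 0\<close> by auto
  have "dist ((1 / (exp t - 1)) *\<^sub>R (T t ?u - ?u)) (?u - x) < e" if t: "0 < t" "t < d" for t
  proof -
    define g where "g = exp t - 1"
    have g: "g > 0" using t by (simp add: g_def)
    define w where "w = ?u - exp (- t) *\<^sub>R T t ?u - (1 - exp (- t)) *\<^sub>R x"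
    let ?D = "(1 / g) *\<^sub>R (T t ?u - ?u) - (?u - x)"
    \<comment> \<open>Since \<open>exp t * (1 - exp (- t)) = g\<close>, the bound on
      \<open>w\<close> contributes a factor \<open>g\<close>, which cancels against the one in front
      of \<open>?D\<close>.\<close>
    have "g *\<^sub>R ?D = - (exp t *\<^sub>R w)"
      using g by (simp add: scaleR_diff_right w_def) (simp add: g_def algebra_simps flip: exp_add)
    then have "norm (g *\<^sub>R ?D) = norm (exp t *\<^sub>R w)" by simp
    then have "g * norm ?D = exp t * norm w" using g by simp
    also have "\<dots> \<le> exp t * ((1 - exp (- t)) * (e / 2))"
      using d(2)[OF t] by (intro mult_left_mono) (simp_all add: w_def)
    also have "\<dots> = g * (e / 2)" by (simp add: g_def algebra_simps flip: exp_add)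
    finally have "norm ?D \<le> e / 2" using g by simp
    then show ?thesis using \<open>e > 0\<close> by (simp add: dist_norm g_def)
  qed
  then show "\<forall>\<^sub>F t in at_right 0. dist ((1 / (exp t - 1)) *\<^sub>R (T t ?u - ?u)) (?u - x) < e"
    using d(1) by (auto simp: eventually_at_right_field)
qed

text \<open>\<open>T t\<close> commutes with the difference quotients and contracts their
  error.\<close>

lemma resolves_T:
  assumes "x \<in> S" "u \<in> S" "resolves x u" "0 \<le> t"
  shows "resolves (T t x) (T t u)"
  unfolding resolves_def
proof (rule LIM_zero_cancel, rule Lim_null_comparison)
  let ?D = "\<lambda>r. (1 / (exp r - 1)) *\<^sub>R (T r u - u)"
  show "((\<lambda>r. norm (?D r - (u - x))) \<longlongrightarrow> 0) (at_right 0)"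
    using assms(3) unfolding resolves_def by (intro tendsto_norm_zero LIM_zero)
  have "norm ((1 / (exp r - 1)) *\<^sub>R (T r (T t u) - T t u) - (T t u - T t x)) \<le> norm (?D r - (u - x))"
    if "r > 0" for r
  proof -
    have "T r (T t u) = T t (T r u)" using assms that by (simp add: T_semigroup add.commute)
    then have "(1 / (exp r - 1)) *\<^sub>R (T r (T t u) - T t u) - (T t u - T t x) = T t (?D r - (u - x))"
      using assms that by (simp add: T_diff T_scaleR S_intros)
    also have "norm \<dots> \<le> norm (?D r - (u - x))"
      using assms that by (intro T_norm) (auto intro!: S_intros)
    finally show ?thesis .
  qed
  then show "\<forall>\<^sub>F r in at_right 0. norm ((1 / (exp r - 1)) *\<^sub>R (T r (T t u) - T t u) - (T t u - T t x))
      \<le> norm (?D r - (u - x))"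
    by (auto simp: eventually_at_right_field intro!: exI[of _ 1])
qed

end


section \<open>Pure semigroups of isometries\<close>

text \<open>The setting in which the density of \<open>generated\<close> is proved: a complete real
  subspace with an algebra-valued inner product. Linearity and the semigroup law of the adjoints
  \<open>sa\<close> are derived from nondegeneracy of \<open>ip\<close>.\<close>

locale pure_isometries =
  fixes S :: "'a::real_normed_vector set" and ip :: "'a \<Rightarrow> 'a \<Rightarrow> 'b::cstar_algebra"
    and s sa :: "real \<Rightarrow> 'a \<Rightarrow> 'a"
  assumes subspace: "subspace S"
    and complete: "complete S"
    and ip_add_right: "x \<in> S \<Longrightarrow> y \<in> S \<Longrightarrow> z \<in> S \<Longrightarrow> ip x (y + z) = ip x y + ip x z"
    and ip_scaleR_right: "x \<in> S \<Longrightarrow> y \<in> S \<Longrightarrow> ip x (r *\<^sub>R y) = r *\<^sub>R ip x y"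
    and ip_star: "x \<in> S \<Longrightarrow> y \<in> S \<Longrightarrow> star (ip x y) = ip y x"
    and norm_ip: "x \<in> S \<Longrightarrow> norm (ip x x) = (norm x)\<^sup>2"
    and ip_le: "x \<in> S \<Longrightarrow> y \<in> S \<Longrightarrow> norm (ip x y) \<le> norm x * norm y"
    and s_in: "0 \<le> t \<Longrightarrow> x \<in> S \<Longrightarrow> s t x \<in> S"
    and sa_in: "0 \<le> t \<Longrightarrow> x \<in> S \<Longrightarrow> sa t x \<in> S"
    and s_isometry: "0 \<le> t \<Longrightarrow> x \<in> S \<Longrightarrow> y \<in> S \<Longrightarrow> ip (s t x) (s t y) = ip x y"
    and s_adjoint: "0 \<le> t \<Longrightarrow> x \<in> S \<Longrightarrow> y \<in> S \<Longrightarrow> ip (s t x) y = ip x (sa t y)"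
    and s_semigroup: "0 \<le> r \<Longrightarrow> 0 \<le> t \<Longrightarrow> x \<in> S \<Longrightarrow> s r (s t x) = s (r + t) x"
    and s_0: "x \<in> S \<Longrightarrow> s 0 x = x"
    and s_cont: "x \<in> S \<Longrightarrow> ((\<lambda>t. s t x) \<longlongrightarrow> x) (at_right 0)"
    and s_pure: "x \<in> S \<Longrightarrow> ((\<lambda>t. sa t x) \<longlongrightarrow> 0) at_top"
begin

lemmas S_intros = subspace_0[OF subspace] subspace_add[OF subspace] subspace_diff[OF subspace]
  subspace_scale[OF subspace] subspace_neg[OF subspace] s_in sa_in

lemma ip_add_left: "x \<in> S \<Longrightarrow> y \<in> S \<Longrightarrow> z \<in> S \<Longrightarrow> ip (x + y) z = ip x z + ip y z"
  using ip_add_right[of z x y] by (metis S_intros(2) ip_star star_add)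

lemma ip_scaleR_left: "x \<in> S \<Longrightarrow> y \<in> S \<Longrightarrow> ip (r *\<^sub>R x) y = r *\<^sub>R ip x y"
  using ip_scaleR_right[of y x r] by (metis S_intros(4) ip_star star_scaleR)

lemma ip_diff_right: "x \<in> S \<Longrightarrow> y \<in> S \<Longrightarrow> z \<in> S \<Longrightarrow> ip x (y - z) = ip x y - ip x z"
  using ip_add_right[of x y "(-1) *\<^sub>R z"] ip_scaleR_right[of x z "-1"] S_intros(4)[of z "-1"] by simp

lemma ip_diff_left: "x \<in> S \<Longrightarrow> y \<in> S \<Longrightarrow> z \<in> S \<Longrightarrow> ip (x - y) z = ip x z - ip y z"
  using ip_add_left[of x "(-1) *\<^sub>R y" z] ip_scaleR_left[of y z "-1"] S_intros(4)[of y "-1"] by simp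

lemmas ip_simps = ip_add_left ip_add_right ip_scaleR_left ip_scaleR_right ip_diff_left ip_diff_right

lemma ip_eqI:
  assumes "x \<in> S" "y \<in> S" "\<And>z. z \<in> S \<Longrightarrow> ip z x = ip z y" shows "x = y"
proof -
  have "ip (x - y) (x - y) = 0" using assms by (simp add: ip_diff_right S_intros)
  then have "(norm (x - y))\<^sup>2 = 0" using assms by (simp flip: norm_ip add: S_intros)
  then show ?thesis by simp
qed

lemma s_adjoint': "0 \<le> t \<Longrightarrow> x \<in> S \<Longrightarrow> y \<in> S \<Longrightarrow> ip x (s t y) = ip (sa t x) y"
  using s_adjoint[of t y x] by (metis S_intros(6,7) ip_star)

lemma sa_s: "0 \<le> t \<Longrightarrow> x \<in> S \<Longrightarrow> sa t (s t x) = x"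
  by (rule ip_eqI) (simp_all add: S_intros s_isometry flip: s_adjoint)

lemma s_norm:
  assumes "0 \<le> t" "x \<in> S" shows "norm (s t x) = norm x"
proof -
  have "(norm (s t x))\<^sup>2 = (norm x)\<^sup>2" using assms by (simp flip: norm_ip add: S_intros s_isometry)
  then show ?thesis by simp
qed

lemma sa_norm:
  assumes "0 \<le> t" "x \<in> S" shows "norm (sa t x) \<le> norm x"
proof -
  have "(norm (sa t x))\<^sup>2 = norm (ip (s t (sa t x)) x)"
    using assms by (simp add: norm_ip s_adjoint S_intros)
  also have "\<dots> \<le> norm (s t (sa t x)) * norm x" using assms by (intro ip_le S_intros)
  also have "\<dots> = norm (sa t x) * norm x" using assms by (simp add: s_norm S_intros)
  finally show ?thesis by (cases "norm (sa t x) = 0") (auto simp: power2_eq_square)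
qed

lemma sa_add: "0 \<le> t \<Longrightarrow> x \<in> S \<Longrightarrow> y \<in> S \<Longrightarrow> sa t (x + y) = sa t x + sa t y"
  by (rule ip_eqI) (simp_all add: S_intros ip_add_right flip: s_adjoint)

lemma sa_scaleR: "0 \<le> t \<Longrightarrow> x \<in> S \<Longrightarrow> sa t (r *\<^sub>R x) = r *\<^sub>R sa t x"
  by (rule ip_eqI) (simp_all add: S_intros ip_scaleR_right flip: s_adjoint)

lemma s_add: "0 \<le> t \<Longrightarrow> x \<in> S \<Longrightarrow> y \<in> S \<Longrightarrow> s t (x + y) = s t x + s t y"
  by (rule ip_eqI) (simp_all add: S_intros ip_add_right s_adjoint')

lemma s_scaleR: "0 \<le> t \<Longrightarrow> x \<in> S \<Longrightarrow> s t (r *\<^sub>R x) = r *\<^sub>R s t x"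
  by (rule ip_eqI) (simp_all add: S_intros ip_scaleR_right s_adjoint')

lemma sa_semigroup: "0 \<le> r \<Longrightarrow> 0 \<le> t \<Longrightarrow> x \<in> S \<Longrightarrow> sa r (sa t x) = sa (r + t) x"
  by (rule ip_eqI) (simp_all add: S_intros s_semigroup add.commute flip: s_adjoint)

lemma sa_0: "x \<in> S \<Longrightarrow> sa 0 x = x"
  by (rule ip_eqI) (simp_all add: S_intros s_0 flip: s_adjoint)

lemma sa_diff: "0 \<le> t \<Longrightarrow> x \<in> S \<Longrightarrow> y \<in> S \<Longrightarrow> sa t (x - y) = sa t x - sa t y"
  by (rule ip_eqI) (simp_all add: S_intros ip_diff_right flip: s_adjoint)

text \<open>\<open>sa t x - x = sa t (x - s t x)\<close>, because \<open>sa t\<close> is a left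
  inverse of \<open>s t\<close>. Strong continuity of the adjoints thus comes from the isometry
  property.\<close>

lemma sa_cont:
  assumes x: "x \<in> S" shows "((\<lambda>t. sa t x) \<longlongrightarrow> x) (at_right 0)"
proof (rule LIM_zero_cancel, rule Lim_null_comparison)
  show "((\<lambda>t. norm (x - s t x)) \<longlongrightarrow> 0) (at_right 0)"
    using tendsto_norm_zero[OF LIM_zero[OF s_cont[OF x]]] by (simp add: norm_minus_commute)
  have "norm (sa t x - x) \<le> norm (x - s t x)" if "t > 0" for t
    using sa_norm[of t "x - s t x"] x that by (simp add: sa_diff sa_s S_intros)
  then show "\<forall>\<^sub>F t in at_right 0. norm (sa t x - x) \<le> norm (x - s t x)"
    by (auto simp: eventually_at_right_field intro!: exI[of _ 1])
qed

sublocale fwd: contraction_semigroup S s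
  by unfold_locales
    (simp_all add: subspace complete s_in s_add s_scaleR s_norm s_semigroup s_0 s_cont)

sublocale adj: contraction_semigroup S sa
  by unfold_locales
    (simp_all add: subspace complete sa_in sa_add sa_scaleR sa_norm sa_semigroup sa_0 sa_cont)

section \<open>Resolvents of the isometries and of their adjoints\<close>

abbreviation "R \<equiv> fwd.resolvent"
abbreviation "R' \<equiv> adj.resolvent"

lemmas S_closed = S_intros fwd.resolvent_in adj.resolvent_in

lemma tendsto_ip:
  assumes "(f \<longlongrightarrow> a) F" "(g \<longlongrightarrow> b) F" "a \<in> S" "b \<in> S"
    "\<forall>\<^sub>F t in F. f t \<in> S" "\<forall>\<^sub>F t in F. g t \<in> S"
  shows "((\<lambda>t. ip (f t) (g t)) \<longlongrightarrow> ip a b) F"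
proof (rule LIM_zero_cancel, rule Lim_null_comparison)
  have "((\<lambda>t. norm (f t - a) * norm (g t) + norm a * norm (g t - b)) \<longlongrightarrow> 0 * norm b + norm a * 0) F"
    by (intro tendsto_intros tendsto_norm_zero LIM_zero assms)
  then show "((\<lambda>t. norm (f t - a) * norm (g t) + norm a * norm (g t - b)) \<longlongrightarrow> 0) F" by simp
  show "\<forall>\<^sub>F t in F. norm (ip (f t) (g t) - ip a b) \<le> norm (f t - a) * norm (g t) + norm a * norm (g t - b)"
    using assms(5,6)
  proof eventually_elim
    case (elim t)
    have "ip (f t) (g t) - ip a b = ip (f t - a) (g t) + ip a (g t - b)"
      using elim assms by (simp add: ip_simps)
    then show ?case
      using ip_le[of "f t - a" "g t"] ip_le[of a "g t - b"] elim assms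
        norm_triangle_ineq[of "ip (f t - a) (g t)" "ip a (g t - b)"]
      by (simp add: S_intros)
  qed
qed

lemma eventually_at_right_0: "(\<And>t. 0 < t \<Longrightarrow> P t) \<Longrightarrow> \<forall>\<^sub>F t in at_right (0::real). P t"
  by (auto simp: eventually_at_right_field intro!: exI[of _ 1])

text \<open>The difference quotients of \<open>s\<close> and \<open>sa\<close> are adjoint to each
  other. In the limit this gives \<open>ip u (w - y) = ip (u - x) w\<close>, where the common term
  \<open>ip u w\<close> cancels.\<close>

lemma resolves_adjoint:
  assumes S: "x \<in> S" "y \<in> S" "u \<in> S" "w \<in> S" and u: "fwd.resolves x u" and w: "adj.resolves y w"
  shows "ip x w = ip u y"
proof -
  let ?\<alpha> = "\<lambda>t. (1 / (exp t - 1)) *\<^sub>R (s t u - u)" and ?\<gamma> = "\<lambda>t. (1 / (exp t - 1)) *\<^sub>R (sa t w - w)"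
  have 1: "((\<lambda>t. ip (?\<alpha> t) w) \<longlongrightarrow> ip (u - x) w) (at_right 0)"
    using u S unfolding fwd.resolves_def
    by (intro tendsto_ip tendsto_const eventually_at_right_0) (auto intro!: S_intros)
  have 2: "((\<lambda>t. ip u (?\<gamma> t)) \<longlongrightarrow> ip u (w - y)) (at_right 0)"
    using w S unfolding adj.resolves_def
    by (intro tendsto_ip tendsto_const eventually_at_right_0) (auto intro!: S_intros)
  have "\<forall>\<^sub>F t in at_right 0. ip u (?\<gamma> t) = ip (?\<alpha> t) w"
    using S by (intro eventually_at_right_0) (simp add: ip_simps S_intros s_adjoint)
  from Lim_transform_eventually[OF 2 this] 1 have "ip u (w - y) = ip (u - x) w"
    by (intro tendsto_unique) auto
  then show ?thesis using S by (simp add: ip_simps)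
qed

lemma R_adjoint: "x \<in> S \<Longrightarrow> y \<in> S \<Longrightarrow> ip (R x) y = ip x (R' y)"
  by (rule resolves_adjoint[symmetric]) (simp_all add: S_closed fwd.resolves_resolvent adj.resolves_resolvent)

lemma R_adjoint': "x \<in> S \<Longrightarrow> y \<in> S \<Longrightarrow> ip x (R y) = ip (R' x) y"
  using R_adjoint[of y x] by (metis S_closed(8,9) ip_star)

text \<open>Differentiating \<open>\<langle>s\<^sub>t R x, s\<^sub>t R y\<rangle> = \<langle>R x, R y\<rangle>\<close> at \<open>t = 0\<close>.\<close>

lemma ip_R_R:
  assumes S: "x \<in> S" "y \<in> S"
  shows "2 *\<^sub>R ip (R x) (R y) = ip x (R y) + ip (R x) y"
proof -
  let ?u = "R x" and ?v = "R y"
  let ?\<alpha> = "\<lambda>t. (1 / (exp t - 1)) *\<^sub>R (s t ?u - ?u)" and ?\<beta> = "\<lambda>t. (1 / (exp t - 1)) *\<^sub>R (s t ?v - ?v)"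
  have uv: "?u \<in> S" "?v \<in> S" using S by (simp_all add: S_closed)
  have "((\<lambda>t. ip (?\<alpha> t) (s t ?v) + ip ?u (?\<beta> t)) \<longlongrightarrow> ip (?u - x) ?v + ip ?u (?v - y)) (at_right 0)"
    using fwd.resolves_resolvent[OF S(1)] fwd.resolves_resolvent[OF S(2)] S uv s_cont[OF uv(2)]
    unfolding fwd.resolves_def
    by (intro tendsto_add tendsto_ip tendsto_const eventually_at_right_0) (auto intro!: S_intros)
  moreover have "\<forall>\<^sub>F t in at_right 0. ip (?\<alpha> t) (s t ?v) + ip ?u (?\<beta> t) = 0"
    using uv by (intro eventually_at_right_0)
      (simp add: ip_simps S_intros s_isometry flip: scaleR_add_right)
  ultimately have "((\<lambda>t. 0) \<longlongrightarrow> ip (?u - x) ?v + ip ?u (?v - y)) (at_right (0::real))"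
    by (rule Lim_transform_eventually)
  then have "0 = ip (?u - x) ?v + ip ?u (?v - y)"
    by (simp only: tendsto_const_iff[OF trivial_limit_at_right_real])
  then show ?thesis using S uv by (simp add: ip_simps scaleR_2 algebra_simps)
qed

lemma R'_R: "x \<in> S \<Longrightarrow> 2 *\<^sub>R R' (R x) = R x + R' x"
  by (rule ip_eqI)
    (simp_all add: S_closed ip_simps ip_R_R flip: R_adjoint)

lemma R'_add: "x \<in> S \<Longrightarrow> y \<in> S \<Longrightarrow> R' (x + y) = R' x + R' y"
  by (rule ip_eqI) (simp_all add: S_closed ip_simps flip: R_adjoint)

lemma R'_diff: "x \<in> S \<Longrightarrow> y \<in> S \<Longrightarrow> R' (x - y) = R' x - R' y"
  by (rule ip_eqI) (simp_all add: S_closed ip_simps flip: R_adjoint)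

lemma R'_scaleR: "x \<in> S \<Longrightarrow> R' (r *\<^sub>R x) = r *\<^sub>R R' x"
  by (rule ip_eqI) (simp_all add: S_closed ip_simps flip: R_adjoint)

lemma R_diff: "x \<in> S \<Longrightarrow> y \<in> S \<Longrightarrow> R (x - y) = R x - R y"
  by (rule ip_eqI) (simp_all add: S_closed ip_simps R_adjoint')

lemma R_scaleR: "x \<in> S \<Longrightarrow> R (r *\<^sub>R x) = r *\<^sub>R R x"
  by (rule ip_eqI) (simp_all add: S_closed ip_simps R_adjoint')

text \<open>By \<open>resolves_T\<close>, the vector \<open>sa t (R' z)\<close> resolves
  \<open>sa t z\<close>. Pairing with an arbitrary \<open>x\<close> and applying
  \<open>resolves_adjoint\<close> to \<open>R x\<close> identifies it with
  \<open>R' (sa t z)\<close>.\<close>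

lemma sa_R':
  assumes "0 \<le> t" "z \<in> S" shows "sa t (R' z) = R' (sa t z)"
proof (rule ip_eqI)
  fix x assume "x \<in> S"
  then have "ip x (sa t (R' z)) = ip (R x) (sa t z)"
    using assms by (intro resolves_adjoint fwd.resolves_resolvent adj.resolves_T adj.resolves_resolvent)
      (simp_all add: S_closed)
  then show "ip x (sa t (R' z)) = ip x (R' (sa t z))"
    using assms \<open>x \<in> S\<close> by (simp add: R_adjoint S_closed)
qed (use assms in \<open>simp_all add: S_closed\<close>)

text \<open>Under the equivalence with the right shift over \<open>F\<close>, the vectors \<open>exp (- t) \<otimes> y\<close> with \<open>y \<in> F\<close>
  are exactly the joint eigenvectors of the adjoints \<open>sa t\<close> with eigenvalues \<open>exp (- t)\<close>.\<close>

definition eigenspace :: "'a set" where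
  "eigenspace = {y \<in> S. \<forall>t\<ge>0. \<forall>z\<in>S. ip (s t z) y = exp (- t) *\<^sub>R ip z y}"

text \<open>With \<open>w = R' y = y / 2\<close>, the resolvent equation says that
  \<open>sa t w\<close> has derivative \<open>- w\<close> at \<open>0\<close>. Its deviation
  \<open>c\<close> from \<open>exp (- t) *\<^sub>R w\<close> is therefore \<open>o(h)\<close> over
  one step of length \<open>h\<close>. By \<open>c_mult\<close> it grows at most linearly in the
  number of steps, so it vanishes.\<close>

lemma sa_eq_exp:
  assumes y: "y \<in> S" and fp: "2 *\<^sub>R R' y = y" and t: "0 \<le> t"
  shows "sa t y = exp (- t) *\<^sub>R y"
proof -
  define w where "w = R' y"
  have w: "w \<in> S" "y = 2 *\<^sub>R w" using y fp by (simp_all add: w_def S_closed)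
  define c where "c t = norm (sa t w - exp (- t) *\<^sub>R w)" for t
  have c_mult: "c (real n * t) \<le> real n * c t" if t: "0 \<le> t" for n t
  proof (induction n)
    case 0
    then show ?case using w by (simp add: c_def sa_0)
  next
    case (Suc n)
    have "sa (real (Suc n) * t) w - exp (- (real (Suc n) * t)) *\<^sub>R w
        = sa t (sa (real n * t) w - exp (- (real n * t)) *\<^sub>R w)
          + exp (- (real n * t)) *\<^sub>R (sa t w - exp (- t) *\<^sub>R w)"
      using t w by (simp add: sa_diff sa_scaleR sa_semigroup S_intros algebra_simps flip: exp_add)
    also have "norm \<dots> \<le> c (real n * t) + c t"
    proof (rule norm_triangle_le, rule add_mono)
      show "norm (sa t (sa (real n * t) w - exp (- (real n * t)) *\<^sub>R w)) \<le> c (real n * t)"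
        unfolding c_def using t w by (intro sa_norm) (auto intro!: S_intros)
      show "norm (exp (- (real n * t)) *\<^sub>R (sa t w - exp (- t) *\<^sub>R w)) \<le> c t"
        using t by (simp add: c_def mult_left_le_one_le)
    qed
    finally show ?case using Suc by (simp add: c_def algebra_simps)
  qed
  have "c t \<le> e" if "e > 0" for e
  proof (cases "t = 0")
    case True
    then show ?thesis using w sa_0 that by (simp add: c_def)
  next
    case False
    \<comment> \<open>Each step of length \<open>h\<close> will cost at most
      \<open>4 * h * e'\<close>, and the steps have total length \<open>t\<close>.\<close>
    define e' where "e' = e / (4 * t)"
    have e': "e' > 0" using that t False by (simp add: e'_def)
    obtain d where d: "0 < d" "\<And>t. 0 < t \<Longrightarrow> t < d \<Longrightarrow>
        norm (R' y - exp (- t) *\<^sub>R sa t (R' y) - (1 - exp (- t)) *\<^sub>R y) \<le> (1 - exp (- t)) * e'"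
      using adj.resolvent_approx[OF y e'] by metis
    obtain n :: nat where n: "n > 0" "t / real n < d" "t / real n \<le> 1" "t / real n * norm w \<le> e'"
    proof -
      have "(\<lambda>n. t / real n) \<longlonglongrightarrow> 0" by (rule lim_const_over_n)
      moreover have "(\<lambda>n. t / real n * norm w) \<longlonglongrightarrow> 0"
        using tendsto_mult_right[OF lim_const_over_n[of t], of "norm w"] by simp
      ultimately have "\<forall>\<^sub>F n in sequentially. n > 0 \<and> t / real n < d \<and> t / real n < 1 \<and> t / real n * norm w < e'"
        using d(1) e' by (intro eventually_conj eventually_gt_at_top order_tendstoD(2)) auto
      then obtain n where "n > 0 \<and> t / real n < d \<and> t / real n < 1 \<and> t / real n * norm w < e'"
        using eventually_happens'[OF sequentially_bot] by blast
      then show ?thesis by (intro that[of n]) auto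
    qed
    define h where "h = t / real n"
    have h: "0 < h" "h < d" "h \<le> 1" "h * norm w \<le> e'" using n t False by (simp_all add: h_def)
    have "h * h \<le> h" using h by (intro mult_left_le) auto
    then have exp_h: "exp h - 1 \<le> 2 * h"
      using exp_bound[of h] h unfolding power2_eq_square by linarith
    \<comment> \<open>The first term on the right is bounded through the choice of \<open>d\<close>;
      the second is of order \<open>h * h\<close>.\<close>
    have "sa h w - exp (- h) *\<^sub>R w
        = - exp h *\<^sub>R (w - exp (- h) *\<^sub>R sa h w - (1 - exp (- h)) *\<^sub>R y) - ((exp h - 1) * (1 - exp (- h))) *\<^sub>R w"
      unfolding w(2) by (simp add: algebra_simps scaleR_2 flip: exp_add)
    also have "norm \<dots> \<le> (exp h - 1) * e' + (exp h - 1) * (h * norm w)"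
    proof (rule order_trans[OF norm_triangle_ineq4], rule add_mono)
      have "norm (- exp h *\<^sub>R (w - exp (- h) *\<^sub>R sa h w - (1 - exp (- h)) *\<^sub>R y)) \<le> exp h * ((1 - exp (- h)) * e')"
        using d(2)[OF h(1,2)] by (simp flip: w_def)
      also have "\<dots> = (exp h - 1) * e'" by (simp add: algebra_simps flip: exp_add)
      finally show "norm (- exp h *\<^sub>R (w - exp (- h) *\<^sub>R sa h w - (1 - exp (- h)) *\<^sub>R y)) \<le> (exp h - 1) * e'" .
      have "1 - exp (- h) \<le> h" using exp_ge_add_one_self[of "- h"] by linarith
      then show "norm (((exp h - 1) * (1 - exp (- h))) *\<^sub>R w) \<le> (exp h - 1) * (h * norm w)"
        using h by (simp add: abs_mult mult.assoc mult_left_mono mult_right_mono)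
    qed
    also have "\<dots> \<le> (2 * h) * e' + (2 * h) * e'"
      using exp_h h e' by (intro add_mono mult_mono) auto
    finally have "c h \<le> 4 * h * e'" by (simp add: c_def ac_simps)
    then have "real n * c h \<le> real n * (4 * h * e')" by (intro mult_left_mono) auto
    moreover have "real n * h = t" using n(1) by (simp add: h_def)
    moreover have "real n * (4 * h * e') = 4 * (real n * h) * e'" by simp
    moreover have "c (real n * h) \<le> real n * c h" using c_mult h by simp
    ultimately have "c t \<le> 4 * t * e'" by simp
    then show ?thesis using t False by (simp add: e'_def)
  qed
  then have "c t \<le> 0" by (rule field_le_epsilon) simp
  then show ?thesis using w t by (simp add: c_def sa_scaleR)
qed

definition proj :: "'a \<Rightarrow> 'a" where
  "proj z = R z + R' z - 2 *\<^sub>R R (R' z)"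

text \<open>Applying \<open>2 R'\<close> to the definition and using \<open>R'_R\<close> on
  \<open>R z\<close> and on \<open>R (R' z)\<close> returns \<open>proj z\<close>, which is the
  hypothesis of \<open>sa_eq_exp\<close>.\<close>

lemma proj_in_eigenspace:
  assumes z: "z \<in> S" shows "proj z \<in> eigenspace"
proof -
  let ?y = "proj z"
  have y: "?y \<in> S" using z by (simp add: proj_def S_closed)
  have "2 *\<^sub>R R' ?y = 2 *\<^sub>R R' (R z) + 2 *\<^sub>R R' (R' z) - 2 *\<^sub>R (2 *\<^sub>R R' (R (R' z)))"
    using z by (simp add: proj_def S_closed R'_add R'_diff R'_scaleR scaleR_diff_right scaleR_add_right)
  also have "\<dots> = ?y"
    using z by (simp only: R'_R S_closed) (simp add: proj_def algebra_simps scaleR_2)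
  finally have "2 *\<^sub>R R' ?y = ?y" .
  from sa_eq_exp[OF y this] show ?thesis
    using y by (simp add: eigenspace_def s_adjoint ip_scaleR_right)
qed

section \<open>Density of the translates of the eigenspace\<close>

abbreviation generated :: "'a set" where
  "generated \<equiv> span (\<Union>t\<in>{0..}. s t ` eigenspace)"

lemma eigenspace_subset: "eigenspace \<subseteq> S" by (auto simp: eigenspace_def)

lemma sa_eigenspace:
  assumes "y \<in> eigenspace" "0 \<le> t" shows "sa t y = exp (- t) *\<^sub>R y"
  using assms by (intro ip_eqI) (auto simp: eigenspace_def S_intros ip_scaleR_right simp flip: s_adjoint)

lemma generated_subset: "generated \<subseteq> S"
  by (rule span_minimal[OF _ subspace]) (use eigenspace_subset in \<open>auto intro: s_in\<close>)

lemma s_generated: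
  assumes t: "0 \<le> t" and m: "m \<in> generated"
  shows "s t m \<in> generated"
proof -
  have "m \<in> S \<and> s t m \<in> generated"
    using m
  proof (induction rule: span_induct_alt)
    case base
    then show ?case using s_scaleR[OF t subspace_0[OF subspace], of 0] by (simp add: S_intros span_zero)
  next
    case (step c x y)
    then obtain r f where r: "0 \<le> r" "f \<in> eigenspace" "x = s r f" by auto
    then have "s t x = s (t + r) f" "x \<in> S" using t eigenspace_subset by (auto simp: s_semigroup s_in)
    moreover have "s (t + r) f \<in> generated" using r t by (intro span_base) auto
    ultimately show ?case
      using step t by (auto simp: s_add s_scaleR S_intros intro!: span_add span_scale)
  qed
  then show ?thesis ..
qed

text \<open>Here \<open>x - s\<^sub>h s\<^sub>h\<^sup>* x\<close> is split off at each of the \<open>n\<close> steps. Up to a vector of length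
  \<open>O(h)\<close> it is \<open>proj z - exp (- h) s\<^sub>h (proj z)\<close>, because \<open>R' z - proj z\<close> lies in the range of \<open>R\<close>.
  The errors of the steps are mutually orthogonal, so that the squares of their norms add up.\<close>

lemma R'_approx_generated:
  assumes h: "0 \<le> h" and z: "z \<in> S"
  shows "\<exists>m\<in>generated. (norm (R' z - s (real n * h) (sa (real n * h) (R' z)) - m))\<^sup>2
    \<le> real n * (6 * h * norm z)\<^sup>2"
  using z
proof (induction n arbitrary: z)
  case 0
  then show ?case using span_zero by (intro bexI[of _ 0]) (simp_all add: s_0 sa_0 S_closed)
next
  case (Suc n)
  let ?t = "real n * h"
  have t: "0 \<le> ?t" using h by simp
  \<comment> \<open>\<open>Q\<close> projects onto the kernel of \<open>sa h\<close> along the range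
    of \<open>s h\<close>.\<close>
  define Q where "Q x = x - s h (sa h x)" for x
  have Q_S: "Q x \<in> S" if "x \<in> S" for x using that h by (simp add: Q_def S_intros)
  have Q_norm: "norm (Q x) \<le> 2 * norm x" if "x \<in> S" for x
    using norm_triangle_ineq4[of x "s h (sa h x)"] s_norm[OF h, of "sa h x"] sa_norm[OF h that] that h
    by (simp add: Q_def S_intros)
  have Q_lin: "Q (x - c *\<^sub>R y) = Q x - c *\<^sub>R Q y" if "x \<in> S" "y \<in> S" for x y c
    using that h by (simp add: Q_def fwd.T_diff adj.T_diff s_scaleR sa_scaleR S_intros algebra_simps)
  have Q_s: "Q (s h x) = 0" if "x \<in> S" for x using that h by (simp add: Q_def sa_s)
  have sa_Q: "sa h (Q x) = 0" if "x \<in> S" for x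
    using that h by (simp add: Q_def sa_diff sa_s S_intros)
  let ?z1 = "sa h z"
  have z: "z \<in> S" "?z1 \<in> S" using Suc.prems h by (simp_all add: S_intros)
  have pS: "proj z \<in> S" using z by (simp add: proj_def S_closed)
  obtain m where m: "m \<in> generated"
    "(norm (R' ?z1 - s ?t (sa ?t (R' ?z1)) - m))\<^sup>2 \<le> real n * (6 * h * norm ?z1)\<^sup>2"
    using Suc.IH[OF z(2)] by blast
  have mS: "m \<in> S" using m generated_subset by blast
  define X where "X = R' ?z1 - s ?t (sa ?t (R' ?z1)) - m"
  have XS: "X \<in> S" using z mS t by (simp add: X_def S_closed)
  define v where "v = 2 *\<^sub>R R' z - z"
  have vS: "v \<in> S" using z by (simp add: v_def S_closed)
  define e where "e = Q (R v)"
  have eS: "e \<in> S" using vS by (simp add: e_def Q_S S_closed)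
  have "Q (proj z) = proj z - exp (- h) *\<^sub>R s h (proj z)"
    using sa_eigenspace[OF proj_in_eigenspace[OF z(1)] h] s_scaleR[OF h pS] by (simp add: Q_def)
  moreover have G: "s r (proj z) \<in> generated" if "0 \<le> r" for r
    using that proj_in_eigenspace[OF z(1)] by (intro span_base) blast
  moreover have "proj z \<in> generated" using G[of 0] s_0[OF pS] by simp
  ultimately have Qp: "Q (proj z) \<in> generated" using h by (simp add: span_diff span_scale)
  have "R' z - 1 *\<^sub>R proj z = R v"
    using z by (simp add: proj_def v_def R_diff R_scaleR S_closed)
  then have Qe: "Q (R' z) - Q (proj z) = e"
    unfolding e_def using Q_lin[of "R' z" "proj z" 1] z pS by (simp add: S_closed)
  have "norm (R' z) \<le> norm z" using z by (intro adj.resolvent_norm)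
  then have v_norm: "norm v \<le> 3 * norm z"
    using norm_triangle_ineq4[of "2 *\<^sub>R R' z" z] by (simp add: v_def)
  \<comment> \<open>\<open>Q\<close> kills the range of \<open>s h\<close>, so a multiple of
    \<open>s h (R v)\<close> may be subtracted first; what remains is of order \<open>h\<close> by
    \<open>resolvent_norm_diff\<close>. The constant \<open>6\<close> is the product of the
    \<open>2\<close> in \<open>Q_norm\<close> and the \<open>3\<close> in
    \<open>v_norm\<close>.\<close>
  have "e = Q (R v - exp (- h) *\<^sub>R s h (R v))"
    using vS h by (simp add: e_def Q_lin Q_s S_closed)
  then have "norm e \<le> 2 * norm (R v - exp (- h) *\<^sub>R s h (R v))"
    using vS h by (simp add: Q_norm S_closed)
  also have "\<dots> \<le> 2 * (h * norm v)"
    using fwd.resolvent_norm_diff[OF vS h] exp_ge_add_one_self[of "- h"]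
    by (smt (verit) mult_right_mono norm_ge_zero)
  also have "\<dots> \<le> 6 * h * norm z" using mult_left_mono[OF v_norm h] by simp
  finally have e_norm: "(norm e)\<^sup>2 \<le> (6 * h * norm z)\<^sup>2" by (intro power_mono) auto
  have tS: "real (Suc n) * h = ?t + h" by (simp add: algebra_simps)
  have "s (real (Suc n) * h) (sa (real (Suc n) * h) (R' z)) = s h (s ?t (sa ?t (sa h (R' z))))"
    using z t h unfolding tS by (simp add: s_semigroup sa_semigroup S_closed add.commute)
  also have "\<dots> = s h (sa h (R' z)) - s h (X + m)"
    using z t h mS by (simp add: X_def sa_R' fwd.T_diff S_closed)
  finally have "R' z - s (real (Suc n) * h) (sa (real (Suc n) * h) (R' z)) = Q (R' z) + s h (X + m)"
    by (simp add: Q_def)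
  then have split: "R' z - s (real (Suc n) * h) (sa (real (Suc n) * h) (R' z)) - (Q (proj z) + s h m) = e + s h X"
    using XS mS h by (simp add: s_add Qe[symmetric])
  \<comment> \<open>\<open>e\<close> lies in the kernel of \<open>sa h\<close>, hence is orthogonal
    to the range of \<open>s h\<close>.\<close>
  have "ip e (s h X) = 0" "ip (s h X) e = 0"
    using eS XS vS h sa_Q[of "R v"] ip_scaleR_right[of X e 0] ip_scaleR_left[of e X 0]
    by (simp_all add: s_adjoint s_adjoint' e_def S_closed Q_S)
  then have "ip (e + s h X) (e + s h X) = ip e e + ip X X"
    using eS XS h by (simp add: ip_simps S_intros s_isometry)
  then have "(norm (e + s h X))\<^sup>2 \<le> (norm e)\<^sup>2 + (norm X)\<^sup>2"
    using norm_triangle_ineq[of "ip e e" "ip X X"] norm_ip[of "e + s h X"] norm_ip[OF eS] norm_ip[OF XS] eS XS h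
    by (simp add: S_intros)
  also have "\<dots> \<le> (6 * h * norm z)\<^sup>2 + real n * (6 * h * norm z)\<^sup>2"
  proof (intro add_mono e_norm)
    have "(6 * h * norm ?z1)\<^sup>2 \<le> (6 * h * norm z)\<^sup>2"
      using sa_norm[OF h z(1)] h by (intro power_mono mult_left_mono) auto
    then have "real n * (6 * h * norm ?z1)\<^sup>2 \<le> real n * (6 * h * norm z)\<^sup>2" by (intro mult_left_mono) auto
    then show "(norm X)\<^sup>2 \<le> real n * (6 * h * norm z)\<^sup>2" using m(2) by (simp add: X_def)
  qed
  finally have "(norm (e + s h X))\<^sup>2 \<le> real (Suc n) * (6 * h * norm z)\<^sup>2" by (simp add: algebra_simps)
  moreover have "Q (proj z) + s h m \<in> generated" using Qp s_generated[OF h m(1)] by (rule span_add)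
  ultimately show ?case unfolding split[symmetric] by blast
qed

lemma R'_in_closure:
  assumes z: "z \<in> S" and e: "0 < e"
  shows "\<exists>m\<in>generated. norm (R' z - m) < e"
proof -
  have "\<forall>\<^sub>F t in at_top. norm (sa t (R' z)) < e / 2"
    using order_tendstoD(2)[OF tendsto_norm_zero[OF s_pure[of "R' z"]], of "e / 2"] z e
    by (simp add: S_closed)
  then have "\<forall>\<^sub>F t in at_top. t > 0 \<and> norm (sa t (R' z)) < e / 2"
    using eventually_gt_at_top by (rule eventually_conj[rotated])
  then obtain t where t: "t > 0" "norm (sa t (R' z)) < e / 2"
    using eventually_happens'[OF trivial_limit_at_top_linorder] by blast
  have "(\<lambda>n. (6 * t * norm z)\<^sup>2 / real n) \<longlonglongrightarrow> 0" by (rule lim_const_over_n)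
  then have "\<forall>\<^sub>F n in sequentially. n > 0 \<and> (6 * t * norm z)\<^sup>2 / real n < (e / 2)\<^sup>2"
    using e by (intro eventually_conj eventually_gt_at_top order_tendstoD(2)) auto
  then obtain n :: nat where n: "n > 0" "(6 * t * norm z)\<^sup>2 / real n < (e / 2)\<^sup>2"
    using eventually_happens'[OF sequentially_bot] by blast
  define h where "h = t / real n"
  have h: "0 \<le> h" "real n * h = t" using n t by (simp_all add: h_def)
  obtain m where m: "m \<in> generated" "(norm (R' z - s t (sa t (R' z)) - m))\<^sup>2 \<le> real n * (6 * h * norm z)\<^sup>2"
    using R'_approx_generated[OF h(1) z, of n] unfolding h(2) by blast
  have "real n * (6 * h * norm z)\<^sup>2 = (6 * t * norm z)\<^sup>2 / real n"
    using n by (simp add: h_def power2_eq_square field_simps)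
  then have "(norm (R' z - s t (sa t (R' z)) - m))\<^sup>2 < (e / 2)\<^sup>2" using m n by linarith
  then have "norm (R' z - s t (sa t (R' z)) - m) < e / 2" by (rule power2_less_imp_less) (use e in simp)
  moreover have "norm (s t (sa t (R' z))) < e / 2" using t z by (simp add: s_norm S_closed)
  ultimately have "norm (R' z - m) < e"
    using norm_triangle_ineq[of "R' z - s t (sa t (R' z)) - m" "s t (sa t (R' z))"] by (simp add: algebra_simps)
  then show ?thesis using m(1) by blast
qed

text \<open>It suffices to approximate \<open>x\<close> from the range of \<open>R'\<close>. Since
  \<open>R'\<close> commutes with \<open>sa t\<close>, the vector \<open>z\<close> below satisfies
  \<open>g *\<^sub>R R' z = R' x - exp (- t) *\<^sub>R sa t (R' x)\<close>, and
  \<open>resolvent_approx\<close> places \<open>R' z\<close> near \<open>x\<close> for small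
  \<open>t\<close>.\<close>

theorem generated_dense:
  assumes x: "x \<in> S" and e: "0 < e"
  shows "\<exists>m\<in>generated. norm (x - m) < e"
proof -
  obtain d where d: "0 < d" "\<And>t. 0 < t \<Longrightarrow> t < d \<Longrightarrow>
      norm (R' x - exp (- t) *\<^sub>R sa t (R' x) - (1 - exp (- t)) *\<^sub>R x) \<le> (1 - exp (- t)) * (e / 3)"
    using adj.resolvent_approx[OF x, of "e / 3"] e by auto
  define t where "t = d / 2"
  define g where "g = 1 - exp (- t)"
  have t: "0 < t" "t < d" and g: "g > 0" using d(1) by (simp_all add: t_def g_def)
  define z where "z = (1 / g) *\<^sub>R (x - exp (- t) *\<^sub>R sa t x)"
  have z: "z \<in> S" using x t by (simp add: z_def S_intros)
  have "R' z = (1 / g) *\<^sub>R (R' x - exp (- t) *\<^sub>R sa t (R' x))"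
    using x t by (simp add: z_def R'_scaleR R'_diff sa_R' S_closed)
  then have "R' z - x = (1 / g) *\<^sub>R (R' x - exp (- t) *\<^sub>R sa t (R' x) - g *\<^sub>R x)"
    using g by (simp add: scaleR_diff_right)
  then have "norm (R' z - x) = (1 / g) * norm (R' x - exp (- t) *\<^sub>R sa t (R' x) - g *\<^sub>R x)"
    using g by simp
  also have "\<dots> \<le> (1 / g) * (g * (e / 3))"
    using d(2)[OF t] g by (intro mult_left_mono) (simp_all add: g_def)
  finally have "norm (R' z - x) \<le> e / 3" using g by simp
  moreover obtain m where "m \<in> generated" "norm (R' z - m) < e / 3"
    using R'_in_closure[OF z, of "e / 3"] e by auto
  ultimately show ?thesis
    using e norm_triangle_ineq4[of "R' z - m" "R' z - x"] by (intro bexI[of _ m]) auto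
qed

end


section \<open>Square integrable functions on the half line\<close>

definition l2sq :: "(real \<Rightarrow> complex) \<Rightarrow> real" where
  "l2sq h = (\<integral>x. (cmod (h x))\<^sup>2 \<partial>lborel)"

definition l2ip :: "(real \<Rightarrow> complex) \<Rightarrow> (real \<Rightarrow> complex) \<Rightarrow> complex" where
  "l2ip h k = (\<integral>x. cnj (h x) * k x \<partial>lborel)"

lemma L2_measurable [measurable_dest]: "h \<in> L2_halfline \<Longrightarrow> h \<in> borel_measurable borel"
  by (simp add: L2_halfline_def)

lemma L2_integrable: "h \<in> L2_halfline \<Longrightarrow> integrable lborel (\<lambda>x. (cmod (h x))\<^sup>2)"
  by (simp add: L2_halfline_def)

lemma L2_neg: "h \<in> L2_halfline \<Longrightarrow> x < 0 \<Longrightarrow> h x = 0"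
  by (simp add: L2_halfline_def)

lemma L2I_bound:
  assumes "h \<in> borel_measurable borel" "integrable lborel g" "\<And>x. (cmod (h x))\<^sup>2 \<le> g x"
    "\<And>x. x < 0 \<Longrightarrow> h x = 0"
  shows "h \<in> L2_halfline"
proof -
  have "integrable lborel (\<lambda>x. (cmod (h x))\<^sup>2)"
    using assms(1,3) by (intro Bochner_Integration.integrable_bound[OF assms(2)])
      (auto intro!: AE_I2 order_trans[OF _ abs_ge_self])
  then show ?thesis using assms(1,4) by (simp add: L2_halfline_def)
qed

lemma cmod_add_sq: "(cmod (a + b))\<^sup>2 \<le> 2 * (cmod a)\<^sup>2 + 2 * (cmod b)\<^sup>2"
proof -
  have "(cmod (a + b))\<^sup>2 \<le> (cmod a + cmod b)\<^sup>2" by (intro power_mono norm_triangle_ineq) simp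
  also have "\<dots> \<le> 2 * (cmod a)\<^sup>2 + 2 * (cmod b)\<^sup>2"
    using sum_squares_ge_zero[of "cmod a - cmod b" 0] by (simp add: power2_eq_square algebra_simps)
  finally show ?thesis .
qed

lemma L2_add: "h \<in> L2_halfline \<Longrightarrow> k \<in> L2_halfline \<Longrightarrow> (\<lambda>x. h x + k x) \<in> L2_halfline"
  by (rule L2I_bound[where g = "\<lambda>x. 2 * (cmod (h x))\<^sup>2 + 2 * (cmod (k x))\<^sup>2"])
    (auto simp: L2_integrable L2_neg cmod_add_sq L2_measurable)

lemma L2_cmult: "h \<in> L2_halfline \<Longrightarrow> (\<lambda>x. c * h x) \<in> L2_halfline"
  by (rule L2I_bound[where g = "\<lambda>x. (cmod c)\<^sup>2 * (cmod (h x))\<^sup>2"])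
    (auto simp: L2_integrable L2_neg L2_measurable norm_mult power_mult_distrib)

lemma L2_zero: "(\<lambda>x. 0) \<in> L2_halfline"
  by (simp add: L2_halfline_def)

lemma L2_diff: "h \<in> L2_halfline \<Longrightarrow> k \<in> L2_halfline \<Longrightarrow> (\<lambda>x. h x - k x) \<in> L2_halfline"
  using L2_add[of h "\<lambda>x. (-1) * k x"] L2_cmult[of k "-1"] by simp

lemma L2_shift:
  assumes h: "h \<in> L2_halfline" and t: "0 \<le> t" shows "(\<lambda>x. h (x - t)) \<in> L2_halfline"
proof (rule L2I_bound[where g = "\<lambda>x. (cmod (h (x - t)))\<^sup>2"])
  show "integrable lborel (\<lambda>x. (cmod (h (x - t)))\<^sup>2)"
    using lborel_integrable_real_affine[OF L2_integrable[OF h], of 1 "- t"] by (simp add: add.commute)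
qed (use h t in \<open>auto simp: L2_neg intro: measurable_compose[OF _ L2_measurable]\<close>)

lemma l2sq_shift: "l2sq (\<lambda>x. h (x - t)) = l2sq h"
  using lborel_integral_real_affine[of 1 "\<lambda>x. (cmod (h x))\<^sup>2" "- t"]
  by (simp add: l2sq_def add.commute)

lemma L2_integrable_mult:
  assumes "h \<in> L2_halfline" "k \<in> L2_halfline"
  shows "integrable lborel (\<lambda>x. cnj (h x) * k x)"
proof (rule Bochner_Integration.integrable_bound)
  show "integrable lborel (\<lambda>x. (cmod (h x))\<^sup>2 + (cmod (k x))\<^sup>2)"
    using assms by (intro Bochner_Integration.integrable_add L2_integrable)
  have "a * b \<le> a\<^sup>2 + b\<^sup>2" for a b :: real
    using zero_le_power2[of "a - b"] sum_power2_ge_zero[of a b] unfolding power2_diff by linarith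
  then show "AE x in lborel. norm (cnj (h x) * k x) \<le> norm ((cmod (h x))\<^sup>2 + (cmod (k x))\<^sup>2)"
    by (intro AE_I2) (auto simp: norm_mult abs_of_nonneg)
  have "(\<lambda>x. cnj (h x)) \<in> borel_measurable borel"
    by (rule borel_measurable_continuous_on[OF _ L2_measurable[OF assms(1)]]) (intro continuous_intros)
  then show "(\<lambda>x. cnj (h x) * k x) \<in> borel_measurable lborel"
    using L2_measurable[OF assms(2)] by simp
qed

lemma l2ip_add_right: "h \<in> L2_halfline \<Longrightarrow> k \<in> L2_halfline \<Longrightarrow> l \<in> L2_halfline \<Longrightarrow>
    l2ip h (\<lambda>x. k x + l x) = l2ip h k + l2ip h l"
  by (simp add: l2ip_def distrib_left L2_integrable_mult)

lemma l2ip_diff_right: "h \<in> L2_halfline \<Longrightarrow> k \<in> L2_halfline \<Longrightarrow> l \<in> L2_halfline \<Longrightarrow>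
    l2ip h (\<lambda>x. k x - l x) = l2ip h k - l2ip h l"
  by (simp add: l2ip_def right_diff_distrib L2_integrable_mult)

lemma l2ip_cmult_right: "l2ip h (\<lambda>x. c * k x) = c * l2ip h k"
  by (simp add: l2ip_def mult.left_commute)

lemma l2ip_cnj: "cnj (l2ip h k) = l2ip k h"
proof -
  have "l2ip k h = (\<integral>x. cnj (cnj (h x) * k x) \<partial>lborel)" by (simp add: l2ip_def mult.commute)
  also have "\<dots> = cnj (l2ip h k)" unfolding l2ip_def by (rule Bochner_Integration.integral_cnj)
  finally show ?thesis ..
qed

lemma l2ip_add_left: "h \<in> L2_halfline \<Longrightarrow> k \<in> L2_halfline \<Longrightarrow> l \<in> L2_halfline \<Longrightarrow>
    l2ip (\<lambda>x. k x + l x) h = l2ip k h + l2ip l h"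
  using l2ip_add_right[of h k l] by (metis complex_cnj_add l2ip_cnj)

lemma l2ip_diff_left: "h \<in> L2_halfline \<Longrightarrow> k \<in> L2_halfline \<Longrightarrow> l \<in> L2_halfline \<Longrightarrow>
    l2ip (\<lambda>x. k x - l x) h = l2ip k h - l2ip l h"
  using l2ip_diff_right[of h k l] by (metis complex_cnj_diff l2ip_cnj)

lemma l2ip_cmult_left: "l2ip (\<lambda>x. c * k x) h = cnj c * l2ip k h"
  using l2ip_cmult_right[of h c k] by (metis complex_cnj_mult l2ip_cnj)



lemma l2ip_zero [simp]: "l2ip (\<lambda>x. 0) h = 0" "l2ip h (\<lambda>x. 0) = 0"
  by (simp_all add: l2ip_def)

lemma l2ip_self: "l2ip h h = of_real (l2sq h)"
  by (simp add: l2ip_def l2sq_def mult.commute complex_norm_square[symmetric] flip: integral_complex_of_real of_real_power)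

lemma l2sq_nonneg: "0 \<le> l2sq h"
  by (simp add: l2sq_def)

lemma l2sq_add_le:
  assumes "h \<in> L2_halfline" "k \<in> L2_halfline"
  shows "l2sq (\<lambda>x. h x + k x) \<le> 2 * l2sq h + 2 * l2sq k"
proof -
  have "l2sq (\<lambda>x. h x + k x) \<le> (\<integral>x. 2 * (cmod (h x))\<^sup>2 + 2 * (cmod (k x))\<^sup>2 \<partial>lborel)"
    unfolding l2sq_def using assms
    by (intro integral_mono L2_integrable L2_add) (auto simp: L2_integrable cmod_add_sq)
  also have "\<dots> = 2 * l2sq h + 2 * l2sq k"
    using assms by (simp add: l2sq_def L2_integrable)
  finally show ?thesis .
qed

lemma l2sq_cmult: "l2sq (\<lambda>x. c * h x) = (cmod c)\<^sup>2 * l2sq h"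
  by (simp add: l2sq_def norm_mult power_mult_distrib)

text \<open>Expand \<open>l2sq\<close> of \<open>a h - s k\<close> with \<open>a = l2ip h k\<close>
  and real \<open>s\<close>. The minimising \<open>s\<close> divides by \<open>l2sq k\<close>; when
  that is zero, a large \<open>s\<close> gives a contradiction unless \<open>a = 0\<close>.\<close>

lemma l2ip_Cauchy_Schwarz:
  assumes h: "h \<in> L2_halfline" and k: "k \<in> L2_halfline"
  shows "(cmod (l2ip h k))\<^sup>2 \<le> l2sq h * l2sq k"
proof -
  let ?a = "l2ip h k"
  have expand: "0 \<le> s\<^sup>2 * l2sq k - 2 * s * (cmod ?a)\<^sup>2 + (cmod ?a)\<^sup>2 * l2sq h" for s :: real
  proof -
    let ?f = "\<lambda>x. ?a * h x - of_real s * k x"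
    have L: "(\<lambda>x. ?a * h x) \<in> L2_halfline" "(\<lambda>x. of_real s * k x) \<in> L2_halfline" "?f \<in> L2_halfline"
      using h k by (simp_all add: L2_cmult L2_diff)
    have "of_real (l2sq ?f) = l2ip ?f ?f" by (simp add: l2ip_self)
    also have "l2ip ?f ?f = cnj ?a * l2ip h ?f - of_real s * l2ip k ?f"
      using L by (simp add: l2ip_diff_left l2ip_cmult_left)
    also have "\<dots> = of_real (s\<^sup>2) * l2ip k k - of_real s * (?a * l2ip k h) - of_real s * (cnj ?a * l2ip h k)
        + cnj ?a * ?a * l2ip h h"
    proof -
      have *: "l2ip l ?f = ?a * l2ip l h - of_real s * l2ip l k" if "l \<in> L2_halfline" for l
        using that L by (simp add: l2ip_diff_right l2ip_cmult_right)
      show ?thesis unfolding *[OF h] *[OF k] by (simp add: power2_eq_square algebra_simps)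
    qed
    also have "?a * l2ip k h = of_real ((cmod ?a)\<^sup>2)"
      using l2ip_cnj[of h k] by (metis complex_norm_square of_real_power)
    also have "cnj ?a * l2ip h k = of_real ((cmod ?a)\<^sup>2)"
      by (metis complex_norm_square of_real_power mult.commute)
    finally have "complex_of_real (l2sq ?f)
        = of_real (s\<^sup>2 * l2sq k - 2 * s * (cmod ?a)\<^sup>2 + (cmod ?a)\<^sup>2 * l2sq h)"
      by (simp add: l2ip_self algebra_simps)
    then show ?thesis using l2sq_nonneg[of ?f] by (simp only: of_real_eq_iff)
  qed
  show ?thesis
  proof (cases "?a = 0")
    case True
    then show ?thesis by (simp add: l2sq_nonneg)
  next
    case False
    then have a: "(cmod ?a)\<^sup>2 > 0" by simp
    show ?thesis
    proof (cases "l2sq k = 0")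
      case True
      \<comment> \<open>The expansion is affine in \<open>s\<close> here, and this value of
        \<open>s\<close> makes it \<open>- (cmod ?a)\<^sup>2\<close>.\<close>
      with expand[of "(l2sq h + 1) / 2"] have "(cmod ?a)\<^sup>2 \<le> 0" by (simp add: algebra_simps add_divide_distrib)
      then show ?thesis using a by simp
    next
      case False
      then have K: "l2sq k > 0" using l2sq_nonneg[of k] by simp
      have "0 \<le> (cmod ?a)\<^sup>2 * (l2sq h - (cmod ?a)\<^sup>2 / l2sq k)"
        using expand[of "(cmod ?a)\<^sup>2 / l2sq k"] K by (simp add: power2_eq_square field_simps)
      then have "(cmod ?a)\<^sup>2 / l2sq k \<le> l2sq h" using a by (simp add: zero_le_mult_iff)
      then show ?thesis using K by (simp add: field_simps)
    qed
  qed
qed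

lemma l2ip_tendsto:
  assumes h: "\<And>n. h n \<in> L2_halfline" "h' \<in> L2_halfline" "(\<lambda>n. l2sq (\<lambda>x. h n x - h' x)) \<longlonglongrightarrow> 0"
    and k: "\<And>n. k n \<in> L2_halfline" "k' \<in> L2_halfline" "(\<lambda>n. l2sq (\<lambda>x. k n x - k' x)) \<longlonglongrightarrow> 0"
  shows "(\<lambda>n. l2ip (h n) (k n)) \<longlonglongrightarrow> l2ip h' k'"
proof -
  have CS: "cmod (l2ip f g) \<le> sqrt (l2sq f) * sqrt (l2sq g)" if "f \<in> L2_halfline" "g \<in> L2_halfline" for f g
    using real_sqrt_le_mono[OF l2ip_Cauchy_Schwarz[OF that]] by (simp add: real_sqrt_mult)
  let ?dh = "\<lambda>n x. h n x - h' x" and ?dk = "\<lambda>n x. k n x - k' x"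
  have eq: "l2ip (h n) (k n) - l2ip h' k' = l2ip (?dh n) (?dk n) + l2ip (?dh n) k' + l2ip h' (?dk n)" for n
    using h k by (simp add: l2ip_diff_left l2ip_diff_right L2_diff)
  have "(\<lambda>n. l2ip (?dh n) (?dk n) + l2ip (?dh n) k' + l2ip h' (?dk n)) \<longlonglongrightarrow> 0"
  proof (rule Lim_null_comparison)
    show "\<forall>\<^sub>F n in sequentially. norm (l2ip (?dh n) (?dk n) + l2ip (?dh n) k' + l2ip h' (?dk n))
        \<le> sqrt (l2sq (?dh n)) * sqrt (l2sq (?dk n)) + sqrt (l2sq (?dh n)) * sqrt (l2sq k')
          + sqrt (l2sq h') * sqrt (l2sq (?dk n))"
      using h k by (intro always_eventually allI norm_triangle_le add_mono CS L2_diff)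
    have "(\<lambda>n. sqrt (l2sq (?dh n)) * sqrt (l2sq (?dk n)) + sqrt (l2sq (?dh n)) * sqrt (l2sq k')
          + sqrt (l2sq h') * sqrt (l2sq (?dk n))) \<longlonglongrightarrow> sqrt 0 * sqrt 0 + sqrt 0 * sqrt (l2sq k') + sqrt (l2sq h') * sqrt 0"
      by (intro tendsto_intros h k)
    then show "(\<lambda>n. sqrt (l2sq (?dh n)) * sqrt (l2sq (?dk n)) + sqrt (l2sq (?dh n)) * sqrt (l2sq k')
          + sqrt (l2sq h') * sqrt (l2sq (?dk n))) \<longlonglongrightarrow> 0" by simp
  qed
  then have "(\<lambda>n. l2ip (h n) (k n) - l2ip h' k') \<longlonglongrightarrow> 0" by (simp only: eq)
  then show ?thesis by (rule LIM_zero_cancel)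
qed

text \<open>The integrand stays on the complex line through \<open>b\<close>, so the scalar Lebesgue
  integral is carried over by a bounded linear map. This connects \<open>l2ip\<close> with the
  integral in \<open>L2_alg\<close>.\<close>

lemma has_integral_l2ip:
  fixes b :: "'b::cstar_algebra"
  assumes "h \<in> L2_halfline" "k \<in> L2_halfline"
  shows "((\<lambda>x. scaleC (cnj (h x) * k x) b) has_integral scaleC (l2ip h k) b) {0..}"
proof -
  have "((\<lambda>x. cnj (h x) * k x) has_integral l2ip h k) UNIV"
    using has_integral_integral_lborel[OF L2_integrable_mult[OF assms]] by (simp add: l2ip_def)
  moreover have "(\<lambda>x. cnj (h x) * k x) = (\<lambda>x. if x \<in> {0..} then cnj (h x) * k x else 0)"
    using assms by (auto simp: L2_neg)
  ultimately have "((\<lambda>x. cnj (h x) * k x) has_integral l2ip h k) {0..}"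
    by (metis (mono_tags) has_integral_restrict_UNIV)
  from has_integral_linear[OF this bounded_bilinear.bounded_linear_left[OF bounded_bilinear_scaleC]]
  show ?thesis by (simp add: o_def)
qed


section \<open>Shifted exponentials span a dense subspace\<close>

text \<open>The factor \<open>sqrt 2\<close> makes this a unit vector in the square integrable
  functions.\<close>

definition shifted_exp :: "real \<Rightarrow> real \<Rightarrow> complex" where
  "shifted_exp r x = (if r \<le> x then of_real (sqrt 2 * exp (- (x - r))) else 0)"

lemma shifted_exp_measurable [measurable]: "shifted_exp r \<in> borel_measurable borel"
  unfolding shifted_exp_def by measurable

lemma has_bochner_integral_exp_halfline:
  "has_bochner_integral lborel (\<lambda>x::real. if c \<le> x then exp (- (2 * x)) else 0) (exp (- (2 * c)) / 2)"
proof (rule has_bochner_integral_nn_integral)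
  have "((\<lambda>x. exp (- 2 * x)) has_integral exp (- 2 * c) / 2) {c..}"
    by (rule has_integral_exp_minus_to_infinity) simp
  then have "((\<lambda>x. if c \<le> x then exp (- (2 * x)) else 0) has_integral exp (- (2 * c)) / 2) UNIV"
    using has_integral_restrict_UNIV[of "{c..}" "\<lambda>x. exp (- (2 * x))"] by simp
  then show "(\<integral>\<^sup>+x. ennreal (if c \<le> x then exp (- (2 * x)) else 0) \<partial>lborel) = ennreal (exp (- (2 * c)) / 2)"
    by (intro nn_integral_has_integral_lborel) auto
qed auto

lemma cnj_shifted_exp_mult:
  "cnj (shifted_exp r x) * shifted_exp u x
    = of_real (2 * exp (r + u) * (if max r u \<le> x then exp (- (2 * x)) else 0))"
proof (cases "max r u \<le> x")
  case True
  have "sqrt 2 * exp (r - x) * (sqrt 2 * exp (u - x)) = 2 * (exp (r - x) * exp (u - x))" by simp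
  also have "exp (r - x) * exp (u - x) = exp (r + u) * exp (- (2 * x))"
    by (simp add: algebra_simps flip: exp_add)
  finally show ?thesis
    using True by (simp add: shifted_exp_def flip: of_real_mult)
qed (auto simp: shifted_exp_def)

lemma shifted_exp_L2: assumes "0 \<le> r" shows "shifted_exp r \<in> L2_halfline"
proof (rule L2I_bound)
  show "integrable lborel (\<lambda>x. 2 * exp (r + r) * (if r \<le> x then exp (- (2 * x)) else 0))"
    using has_bochner_integral_exp_halfline[of r]
    by (intro integrable_mult_right) (auto simp: has_bochner_integral_iff)
  show "(cmod (shifted_exp r x))\<^sup>2 \<le> 2 * exp (r + r) * (if r \<le> x then exp (- (2 * x)) else 0)" for x
  proof -
    have "complex_of_real ((cmod (shifted_exp r x))\<^sup>2) = cnj (shifted_exp r x) * shifted_exp r x"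
      by (metis complex_norm_square mult.commute of_real_power)
    then show ?thesis unfolding cnj_shifted_exp_mult by (simp only: of_real_eq_iff max.idem)
  qed
qed (use assms in \<open>auto simp: shifted_exp_def\<close>)

lemma l2ip_shifted_exp: "l2ip (shifted_exp r) (shifted_exp u) = of_real (exp (- \<bar>r - u\<bar>))"
proof -
  have *: "(\<integral>x. (if max r u \<le> x then exp (- (2 * x)) else 0) \<partial>lborel) = exp (- (2 * max r u)) / 2"
    using has_bochner_integral_exp_halfline by (rule has_bochner_integral_integral_eq)
  have "l2ip (shifted_exp r) (shifted_exp u) = of_real (2 * exp (r + u) * (exp (- (2 * max r u)) / 2))"
    unfolding l2ip_def cnj_shifted_exp_mult integral_complex_of_real
    by (simp only: integral_mult_right_zero *)
  also have "2 * exp (r + u) * (exp (- (2 * max r u)) / 2) = exp (r + u - 2 * max r u)"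
    by (simp flip: exp_add)
  also have "r + u - 2 * max r u = - \<bar>r - u\<bar>" by (simp add: max_def)
  finally show ?thesis .
qed

text \<open>Adding one summand at a time lets \<open>exp_rel\<close> carry along the corresponding
  vector of the module.\<close>

inductive_set exp_span :: "(real \<Rightarrow> complex) set" where
  zero: "(\<lambda>x. 0) \<in> exp_span"
| step: "h \<in> exp_span \<Longrightarrow> 0 \<le> r \<Longrightarrow> (\<lambda>x. h x + c * shifted_exp r x) \<in> exp_span"

lemma exp_span_L2: "h \<in> exp_span \<Longrightarrow> h \<in> L2_halfline"
  by (induction rule: exp_span.induct) (simp_all add: L2_zero L2_add L2_cmult shifted_exp_L2)

lemma exp_span_add: "k \<in> exp_span \<Longrightarrow> h \<in> exp_span \<Longrightarrow> (\<lambda>x. h x + k x) \<in> exp_span"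
proof (induction rule: exp_span.induct)
  case (step k r c)
  then show ?case using exp_span.step[of "\<lambda>x. h x + k x" r c] by (simp add: add.assoc)
qed simp

lemma exp_span_cmult: "k \<in> exp_span \<Longrightarrow> (\<lambda>x. a * k x) \<in> exp_span"
proof (induction rule: exp_span.induct)
  case (step k r c)
  then show ?case using exp_span.step[of "\<lambda>x. a * k x" r "a * c"] by (simp add: distrib_left mult.assoc)
qed (simp add: exp_span.zero)

section \<open>Every square integrable function is a limit of combinations of shifted
  exponentials\<close>

definition exp_closure :: "(real \<Rightarrow> complex) set" where
  "exp_closure = {h \<in> L2_halfline. \<forall>e>0. \<exists>k\<in>exp_span. l2sq (\<lambda>x. k x - h x) < e}"

lemma exp_closureD: "h \<in> exp_closure \<Longrightarrow> 0 < e \<Longrightarrow> \<exists>k\<in>exp_span. l2sq (\<lambda>x. k x - h x) < e"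
  by (simp add: exp_closure_def)

lemma exp_closure_L2: "h \<in> exp_closure \<Longrightarrow> h \<in> L2_halfline"
  by (simp add: exp_closure_def)

lemma exp_span_closure: "h \<in> exp_span \<Longrightarrow> h \<in> exp_closure"
  by (auto simp: exp_closure_def exp_span_L2 l2sq_def intro!: bexI[of _ h])

lemma exp_closure_add:
  assumes "h \<in> exp_closure" "k \<in> exp_closure" shows "(\<lambda>x. h x + k x) \<in> exp_closure"
proof -
  have "\<exists>l\<in>exp_span. l2sq (\<lambda>x. l x - (h x + k x)) < e" if "e > 0" for e
  proof -
    obtain f g where f: "f \<in> exp_span" "l2sq (\<lambda>x. f x - h x) < e / 4"
      and g: "g \<in> exp_span" "l2sq (\<lambda>x. g x - k x) < e / 4"
      using exp_closureD[OF assms(1), of "e / 4"] exp_closureD[OF assms(2), of "e / 4"] \<open>e > 0\<close> by auto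
    have "l2sq (\<lambda>x. (f x - h x) + (g x - k x)) < e"
      using l2sq_add_le[of "\<lambda>x. f x - h x" "\<lambda>x. g x - k x"] f g assms
      by (simp add: L2_diff exp_span_L2 exp_closure_L2)
    then show ?thesis using exp_span_add[OF g(1) f(1)]
      by (intro bexI[of _ "\<lambda>x. f x + g x"]) (simp_all add: algebra_simps)
  qed
  then show ?thesis using assms by (simp add: exp_closure_def L2_add)
qed

lemma exp_closure_cmult:
  assumes "h \<in> exp_closure" shows "(\<lambda>x. c * h x) \<in> exp_closure"
proof -
  have "\<exists>l\<in>exp_span. l2sq (\<lambda>x. l x - c * h x) < e" if "e > 0" for e
  proof -
    have pos: "(cmod c)\<^sup>2 + 1 > 0" by (simp add: add_nonneg_pos)
    obtain f where f: "f \<in> exp_span" "l2sq (\<lambda>x. f x - h x) < e / ((cmod c)\<^sup>2 + 1)"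
      using exp_closureD[OF assms divide_pos_pos[OF \<open>e > 0\<close> pos]] by blast
    have "l2sq (\<lambda>x. c * (f x - h x)) \<le> ((cmod c)\<^sup>2 + 1) * l2sq (\<lambda>x. f x - h x)"
      unfolding l2sq_cmult by (intro mult_right_mono l2sq_nonneg) simp
    also have "\<dots> < e" using f(2) pos by (simp add: pos_less_divide_eq mult.commute)
    finally show ?thesis using exp_span_cmult[OF f(1), of c]
      by (intro bexI[of _ "\<lambda>x. c * f x"]) (simp_all add: right_diff_distrib)
  qed
  then show ?thesis using assms by (simp add: exp_closure_def L2_cmult)
qed

lemma exp_closure_sum:
  "finite I \<Longrightarrow> (\<And>i. i \<in> I \<Longrightarrow> h i \<in> exp_closure) \<Longrightarrow> (\<lambda>x. \<Sum>i\<in>I. h i x) \<in> exp_closure"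
  by (induction rule: finite_induct) (simp_all add: exp_closure_add exp_span_closure exp_span.zero)

text \<open>Dominated convergence sends the squared distances to \<open>0\<close>. Countable unions
  and limits of simple functions enter the closure in this form.\<close>

lemma exp_closure_dominated:
  assumes k: "\<And>n. k n \<in> exp_closure" and h: "h \<in> borel_measurable borel"
    and lim: "\<And>x. (\<lambda>n. k n x) \<longlonglongrightarrow> h x"
    and g: "g \<in> L2_halfline" and le: "\<And>n x. cmod (k n x) \<le> cmod (g x)"
  shows "h \<in> exp_closure"
proof -
  have hg: "cmod (h x) \<le> cmod (g x)" for x
    by (rule LIMSEQ_le_const2[OF tendsto_norm[OF lim]]) (auto simp: le)
  have hL: "h \<in> L2_halfline"
  proof (rule L2I_bound[OF h L2_integrable[OF g]])
    show "(cmod (h x))\<^sup>2 \<le> (cmod (g x))\<^sup>2" for x using hg by (intro power_mono) auto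
    show "h x = 0" if "x < 0" for x using hg[of x] L2_neg[OF g that] by simp
  qed
  have [measurable]: "k n \<in> borel_measurable borel" for n
    using k by (intro L2_measurable exp_closure_L2)
  note h[measurable]
  have "(\<lambda>n. l2sq (\<lambda>x. k n x - h x)) \<longlonglongrightarrow> integral\<^sup>L lborel (\<lambda>x::real. 0)"
    unfolding l2sq_def
  proof (rule integral_dominated_convergence[where w = "\<lambda>x. 4 * (cmod (g x))\<^sup>2"])
    show "integrable lborel (\<lambda>x. 4 * (cmod (g x))\<^sup>2)" using L2_integrable[OF g] by simp
    have "(\<lambda>n. (cmod (k n x - h x))\<^sup>2) \<longlonglongrightarrow> 0" for x
      using tendsto_power[OF tendsto_norm_zero[OF LIM_zero[OF lim]], of x 2] by simp
    then show "AE x in lborel. (\<lambda>n. (cmod (k n x - h x))\<^sup>2) \<longlonglongrightarrow> 0" by simp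
    have "(cmod (k n x - h x))\<^sup>2 \<le> (2 * cmod (g x))\<^sup>2" for n x
      using le[of n x] hg[of x] norm_triangle_ineq4[of "k n x" "h x"] by (intro power_mono) auto
    then show "AE x in lborel. norm ((cmod (k n x - h x))\<^sup>2) \<le> 4 * (cmod (g x))\<^sup>2" for n
      by (simp add: power_mult_distrib)
  qed measurable
  then have lim0: "(\<lambda>n. l2sq (\<lambda>x. k n x - h x)) \<longlonglongrightarrow> 0" by simp
  have "\<exists>l\<in>exp_span. l2sq (\<lambda>x. l x - h x) < e" if "e > 0" for e
  proof -
    obtain n where n: "l2sq (\<lambda>x. k n x - h x) < e / 4"
      using order_tendstoD(2)[OF lim0, of "e / 4"] \<open>e > 0\<close> by (auto simp: eventually_sequentially)
    obtain l where l: "l \<in> exp_span" "l2sq (\<lambda>x. l x - k n x) < e / 4"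
      using exp_closureD[OF k[of n], of "e / 4"] \<open>e > 0\<close> by auto
    have "l2sq (\<lambda>x. (l x - k n x) + (k n x - h x)) < e"
      using l2sq_add_le[of "\<lambda>x. l x - k n x" "\<lambda>x. k n x - h x"] n l hL k
      by (simp add: L2_diff exp_span_L2 exp_closure_L2)
    then show ?thesis using l(1) by auto
  qed
  then show ?thesis using hL by (simp add: exp_closure_def)
qed

lemma shifted_exp_scaled:
  "of_real (1 / sqrt 2) * shifted_exp r x = (if r \<le> x then of_real (exp (- (x - r))) else 0)"
proof -
  have "complex_of_real (1 / sqrt 2) * of_real (sqrt 2 * exp (- (x - r))) = of_real (exp (- (x - r)))"
    by (subst of_real_mult[symmetric]) simp
  then show ?thesis by (simp add: shifted_exp_def)
qed

text \<open>The weight \<open>exp (- x)\<close> makes this square integrable for every Borel set,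
  even for the whole half line, so that complements can be taken.\<close>

definition exp_indicator :: "real set \<Rightarrow> real \<Rightarrow> complex" where
  "exp_indicator A x = (if x \<in> A \<and> 0 \<le> x then of_real (exp (- x)) else 0)"

text \<open>Beyond \<open>a\<close>, the function \<open>exp (- x)\<close> is
  \<open>exp (- a)\<close> times the exponential that starts at \<open>a\<close>, so two shifted
  exponentials suffice.\<close>

lemma exp_indicator_lessThan: "exp_indicator {..<a} \<in> exp_closure"
proof (cases "0 < a")
  case True
  have "exp_indicator {..<a} = (\<lambda>x. (0 + of_real (1 / sqrt 2) * shifted_exp 0 x)
      + (of_real (- exp (- a)) * of_real (1 / sqrt 2)) * shifted_exp a x)"
    unfolding mult.assoc shifted_exp_scaled
    using True by (auto simp: fun_eq_iff exp_indicator_def simp flip: exp_add of_real_mult)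
  also have "\<dots> \<in> exp_closure"
    using True by (intro exp_span_closure exp_span.intros) auto
  finally show ?thesis .
next
  case False
  then have "exp_indicator {..<a} = (\<lambda>x. 0)" by (auto simp: fun_eq_iff exp_indicator_def)
  then show ?thesis by (simp add: exp_span_closure exp_span.zero)
qed

lemma exp_indicator_UNIV: "exp_indicator UNIV \<in> exp_closure"
proof -
  have "exp_indicator UNIV = (\<lambda>x. 0 + of_real (1 / sqrt 2) * shifted_exp 0 x)"
    unfolding shifted_exp_scaled by (auto simp: fun_eq_iff exp_indicator_def)
  also have "\<dots> \<in> exp_closure" by (intro exp_span_closure exp_span.intros) auto
  finally show ?thesis .
qed

lemma exp_indicator_measurable: "A \<in> sets borel \<Longrightarrow> exp_indicator A \<in> borel_measurable borel"
proof -
  assume "A \<in> sets borel"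
  then have "(\<lambda>x. if x \<in> A \<inter> {0..} then complex_of_real (exp (- x)) else 0) \<in> borel_measurable borel"
    by (intro measurable_If_set) auto
  then show ?thesis by (simp add: exp_indicator_def[abs_def])
qed

text \<open>A Dynkin argument: the sets whose weighted indicator lies in the closure include the
  half lines, an intersection-stable generator, and are closed under complements and, by domination,
  under countable disjoint unions.\<close>

lemma exp_indicator_closure:
  assumes "A \<in> sets borel" shows "exp_indicator A \<in> exp_closure"
proof -
  let ?G = "range (\<lambda>a::real. {..<a})"
  have borel: "sets borel = sigma_sets UNIV ?G"
    by (subst borel_eq_lessThan) (simp add: eucl_lessThan)
  have "{..<a} \<inter> {..<b} = {..<min a b}" for a b :: real by auto
  then have "Int_stable ?G" unfolding Int_stable_def by blast
  moreover have "?G \<subseteq> Pow UNIV" by simp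
  moreover have "A \<in> sigma_sets UNIV ?G" using assms borel by simp
  ultimately show ?thesis
  proof (induction rule: sigma_sets_induct_disjoint)
    case (basic A)
    then show ?case using exp_indicator_lessThan by auto
  next
    case empty
    have "exp_indicator {} = (\<lambda>x. 0)" by (auto simp: fun_eq_iff exp_indicator_def)
    then show ?case by (simp add: exp_span_closure exp_span.zero)
  next
    case (compl A)
    have "exp_indicator (UNIV - A) = (\<lambda>x. exp_indicator UNIV x + (-1) * exp_indicator A x)"
      by (auto simp: fun_eq_iff exp_indicator_def)
    then show ?case using exp_closure_add[OF exp_indicator_UNIV exp_closure_cmult[OF compl(2), of "-1"]] by simp
  next
    case (union A)
    let ?k = "\<lambda>n x. \<Sum>i<n. exp_indicator (A i) x"
    have k: "?k n = exp_indicator (\<Union>i<n. A i)" for n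
    proof (induction n)
      case (Suc n)
      have "A n \<inter> (\<Union>i<n. A i) = {}"
        using union(1) unfolding disjoint_family_on_def by (auto; metis less_irrefl disjoint_iff UNIV_I)
      then show ?case using Suc by (auto simp: fun_eq_iff exp_indicator_def lessThan_Suc)
    qed (auto simp: fun_eq_iff exp_indicator_def)
    show ?case
    proof (rule exp_closure_dominated[where k = ?k and g = "exp_indicator UNIV"])
      show "?k n \<in> exp_closure" for n using union by (intro exp_closure_sum) auto
      have "(\<Union>i. A i) \<in> sets borel" using union(2) unfolding borel by (auto intro: sigma_sets.Union)
      then show "exp_indicator (\<Union>i. A i) \<in> borel_measurable borel" by (rule exp_indicator_measurable)
      show "exp_indicator UNIV \<in> L2_halfline" by (rule exp_closure_L2[OF exp_indicator_UNIV])
      show "cmod (?k n x) \<le> cmod (exp_indicator UNIV x)" for n x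
        using fun_cong[OF k[of n], of x] by (simp add: exp_indicator_def)
      show "(\<lambda>n. ?k n x) \<longlonglongrightarrow> exp_indicator (\<Union>i. A i) x" for x
      proof (rule tendsto_eventually)
        have "\<exists>N. \<forall>n\<ge>N. (x \<in> (\<Union>i<n. A i)) = (x \<in> (\<Union>i. A i))"
        proof (cases "x \<in> (\<Union>i. A i)")
          case True
          then obtain j where "x \<in> A j" by auto
          then show ?thesis by (intro exI[of _ "Suc j"]) auto
        qed auto
        then obtain N where N: "\<And>n. n \<ge> N \<Longrightarrow> (x \<in> (\<Union>i<n. A i)) = (x \<in> (\<Union>i. A i))"
          by blast
        have "?k n x = exp_indicator (\<Union>i. A i) x" if "n \<ge> N" for n
          using fun_cong[OF k[of n], of x] unfolding exp_indicator_def N[OF that] .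
        then show "\<forall>\<^sub>F n in sequentially. ?k n x = exp_indicator (\<Union>i. A i) x"
          by (rule eventually_sequentiallyI)
      qed
    qed
  qed
qed

text \<open>After multiplication by \<open>exp (- x)\<close> no truncation of the simple functions is needed.\<close>

lemma L2_subset_exp_closure:
  assumes h: "h \<in> L2_halfline" shows "h \<in> exp_closure"
proof -
  have [measurable]: "h \<in> borel_measurable borel" by (rule L2_measurable[OF h])
  define g where "g x = of_real (exp x) * h x" for x
  have "g \<in> borel_measurable borel" unfolding g_def by measurable
  from borel_measurable_implies_sequence_metric[OF this, of 0]
  obtain F where F: "\<And>i. simple_function borel (F i)" "\<And>x. (\<lambda>i. F i x) \<longlonglongrightarrow> g x"
    "\<And>i x. cmod (F i x) \<le> 2 * cmod (g x)"
    by (auto simp: dist_norm)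
  let ?k = "\<lambda>i x. \<Sum>v\<in>F i ` UNIV. v * exp_indicator (F i -` {v}) x"
  have k: "?k i x = (if 0 \<le> x then of_real (exp (- x)) * F i x else 0)" for i x
  proof -
    have fin: "finite (F i ` UNIV)" using simple_functionD(1)[OF F(1)[of i]] by simp
    have "?k i x = (\<Sum>v\<in>F i ` UNIV. if v = F i x then (if 0 \<le> x then of_real (exp (- x)) * F i x else 0) else 0)"
      by (rule sum.cong) (auto simp: exp_indicator_def)
    also have "\<dots> = (if 0 \<le> x then of_real (exp (- x)) * F i x else 0)"
      using fin by (subst sum.delta) auto
    finally show ?thesis .
  qed
  show ?thesis
  proof (rule exp_closure_dominated[where k = ?k and g = "\<lambda>x. 2 * h x"])
    have "F i -` {v} \<in> sets borel" for i v
      using simple_functionD(2)[OF F(1)[of i], of "{v}"] by simp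
    then show "?k i \<in> exp_closure" for i
      using simple_functionD(1)[OF F(1)[of i]]
      by (intro exp_closure_sum exp_closure_cmult exp_indicator_closure) auto
    show "(\<lambda>i. ?k i x) \<longlonglongrightarrow> h x" for x
    proof (cases "0 \<le> x")
      case True
      have "(\<lambda>i. of_real (exp (- x)) * F i x) \<longlonglongrightarrow> of_real (exp (- x)) * g x"
        by (intro tendsto_mult tendsto_const F)
      moreover have "of_real (exp (- x)) * g x = h x"
        by (simp add: g_def mult.assoc[symmetric] flip: of_real_mult exp_add)
      ultimately show ?thesis unfolding k using True by simp
    next
      case False
      then show ?thesis unfolding k using L2_neg[OF h, of x] by simp
    qed
    show "(\<lambda>x. 2 * h x) \<in> L2_halfline" using h by (rule L2_cmult)
    show "cmod (?k i x) \<le> cmod (2 * h x)" for i x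
    proof -
      have "exp (- x) * cmod (F i x) \<le> exp (- x) * (2 * cmod (g x))"
        using F(3) by (intro mult_left_mono) auto
      also have "\<dots> = (exp (- x) * exp x) * (2 * cmod (h x))" by (simp add: g_def norm_mult)
      also have "exp (- x) * exp x = 1" by (simp flip: exp_add)
      finally show ?thesis unfolding k by (simp add: norm_mult)
    qed
  qed measurable
qed

lemma exp_span_dense:
  assumes "h \<in> L2_halfline"
  obtains k where "\<And>n. k n \<in> exp_span" "(\<lambda>n. l2sq (\<lambda>x. k n x - h x)) \<longlonglongrightarrow> 0"
proof -
  have "\<exists>k\<in>exp_span. l2sq (\<lambda>x. k x - h x) < inverse (real (Suc n))" for n
    using L2_subset_exp_closure[OF assms] by (auto simp: exp_closure_def)
  then obtain k where k: "\<And>n. k n \<in> exp_span" "\<And>n. l2sq (\<lambda>x. k n x - h x) < inverse (real (Suc n))"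
    by metis
  have "(\<lambda>n. l2sq (\<lambda>x. k n x - h x)) \<longlonglongrightarrow> 0"
    by (rule tendsto_sandwich[OF _ _ tendsto_const LIMSEQ_inverse_real_of_nat])
      (use less_imp_le[OF k(2)] in \<open>auto simp: l2sq_nonneg intro!: always_eventually\<close>)
  then show ?thesis using k(1) that by blast
qed


section \<open>Hilbert modules as subspaces of a Banach space\<close>

lemma complex_ring_simps [simp]:
  "carrier complex_ring = UNIV" "\<zero>\<^bsub>complex_ring\<^esub> = 0" "\<one>\<^bsub>complex_ring\<^esub> = 1"
  "a \<oplus>\<^bsub>complex_ring\<^esub> b = a + b" "a \<otimes>\<^bsub>complex_ring\<^esub> b = a * b"
  by (simp_all add: complex_ring_def)

context hilbert_module
begin

lemma smult_in [simp]: "x \<in> carrier E \<Longrightarrow> k \<odot> x \<in> carrier E"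
  by simp

lemma smult_1 [simp]: "x \<in> carrier E \<Longrightarrow> 1 \<odot> x = x"
  using smult_one by simp

lemma smult_0 [simp]: "x \<in> carrier E \<Longrightarrow> 0 \<odot> x = \<zero>"
  using smult_l_null by simp

lemma smult_zero [simp]: "k \<odot> \<zero> = \<zero>"
  using smult_r_null by simp

lemma smult_add_left: "x \<in> carrier E \<Longrightarrow> (k + l) \<odot> x = k \<odot> x \<oplus> l \<odot> x"
  using smult_l_distr[of k l x] by simp

lemma smult_add_right: "x \<in> carrier E \<Longrightarrow> y \<in> carrier E \<Longrightarrow> k \<odot> (x \<oplus> y) = k \<odot> x \<oplus> k \<odot> y"
  using smult_r_distr[of k x y] by simp

lemma smult_smult: "x \<in> carrier E \<Longrightarrow> k \<odot> (l \<odot> x) = (k * l) \<odot> x"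
  using smult_assoc1[of k l x] by simp

lemma minus_conv: "x \<in> carrier E \<Longrightarrow> y \<in> carrier E \<Longrightarrow> x \<ominus> y = x \<oplus> (-1) \<odot> y"
proof -
  assume x: "x \<in> carrier E" and y: "y \<in> carrier E"
  have "y \<oplus> (-1) \<odot> y = (1 + (-1)) \<odot> y" using y by (subst smult_add_left) simp_all
  also have "\<dots> = \<zero>" using y by simp
  finally have "(-1) \<odot> y \<oplus> y = \<zero>" using y by (simp add: a_comm)
  then have "\<ominus> y = (-1) \<odot> y" using y by (intro minus_equality) auto
  then show ?thesis by (simp add: a_minus_def)
qed

lemma eq_if_minus_zero:
  assumes "x \<in> carrier E" "y \<in> carrier E" "x \<ominus> y = \<zero>" shows "x = y"
proof -
  have "x = (x \<ominus> y) \<oplus> y" using assms(1,2) by (simp add: a_minus_def a_assoc l_neg)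
  then show ?thesis using assms by simp
qed

section \<open>Inner product calculus and Cauchy-Schwarz\<close>

lemma ip_add_left: "x \<in> carrier E \<Longrightarrow> y \<in> carrier E \<Longrightarrow> z \<in> carrier E \<Longrightarrow>
    ip E (x \<oplus> y) z = ip E x z + ip E y z"
  using ip_add_right[of z x y] by (metis add.m_closed ip_star star_add)

lemma ip_smult_left: "x \<in> carrier E \<Longrightarrow> y \<in> carrier E \<Longrightarrow> ip E (k \<odot> x) y = scaleC (cnj k) (ip E x y)"
  using ip_smult_right[of y x k] by (metis smult_in ip_star star_scaleC)

lemma ip_diff_right: "x \<in> carrier E \<Longrightarrow> y \<in> carrier E \<Longrightarrow> z \<in> carrier E \<Longrightarrow>
    ip E x (y \<ominus> z) = ip E x y - ip E x z"
  by (simp add: minus_conv ip_add_right ip_smult_right scaleC_minus_left scaleC_one)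

lemma ip_diff_left: "x \<in> carrier E \<Longrightarrow> y \<in> carrier E \<Longrightarrow> z \<in> carrier E \<Longrightarrow>
    ip E (x \<ominus> y) z = ip E x z - ip E y z"
  by (simp add: minus_conv ip_add_left ip_smult_left scaleC_minus_left scaleC_one)

lemma ip_zero_right: "x \<in> carrier E \<Longrightarrow> ip E x \<zero> = 0"
  using ip_smult_right[of x \<zero> 0] by (simp add: scaleC_zero_left)

lemma ip_zero_left: "x \<in> carrier E \<Longrightarrow> ip E \<zero> x = 0"
  using ip_smult_left[of \<zero> x 0] by (simp add: scaleC_zero_left)

lemma ip_ract_left: "x \<in> carrier E \<Longrightarrow> y \<in> carrier E \<Longrightarrow> ip E (ract E x b) y = star b * ip E x y"
  using ip_ract_right[of y x b] by (metis ract_closed ip_star star_mult)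

lemmas ip_simps = ip_add_left ip_add_right ip_smult_left ip_smult_right ip_diff_left ip_diff_right
  ip_zero_left ip_zero_right

lemma ip_eqI:
  assumes x: "x \<in> carrier E" and y: "y \<in> carrier E" and eq: "\<And>z. z \<in> carrier E \<Longrightarrow> ip E z x = ip E z y"
  shows "x = y"
proof -
  have "ip E (x \<ominus> y) (x \<ominus> y) = 0" using x y eq[of "x \<ominus> y"] by (simp add: ip_diff_right)
  then have "x \<ominus> y = \<zero>" using x y by (intro ip_definite) auto
  then show ?thesis by (rule eq_if_minus_zero[OF x y])
qed

lemma hnorm_sq: "(hnorm E x)\<^sup>2 = norm (ip E x x)"
  by (simp add: hnorm_def)

lemma hnorm_nonneg: "0 \<le> hnorm E x"
  by (simp add: hnorm_def)

lemma hnorm_eq_0: "x \<in> carrier E \<Longrightarrow> hnorm E x = 0 \<Longrightarrow> x = \<zero>"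
  by (simp add: hnorm_def ip_definite)

text \<open>With \<open>N\<close> the norm of \<open>ip E x x\<close> and
  \<open>a = ip E x y\<close>, expanding \<open>ip E w w\<close> for \<open>w = x a - N y\<close>
  writes \<open>N\<^sup>2 *\<^sub>R ip E y y\<close> as a sum of three positive elements, one of
  them \<open>N *\<^sub>R (star a * a)\<close>. Monotonicity of the norm then bounds
  \<open>norm a\<close>.\<close>

lemma Cauchy_Schwarz:
  assumes x: "x \<in> carrier E" and y: "y \<in> carrier E"
  shows "norm (ip E x y) \<le> hnorm E x * hnorm E y"
proof -
  define N where "N = norm (ip E x x)"
  define a where "a = ip E x y"
  define w where "w = ract E x a \<ominus> complex_of_real N \<odot> y"
  have N: "N \<ge> 0" by (simp add: N_def)
  have star_a: "ip E y x = star a" using x y by (simp add: a_def ip_star)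
  have xa: "ract E x a \<in> carrier E" using x by (rule ract_closed)
  have w: "w \<in> carrier E" using xa y by (simp add: w_def)
  have "ip E w w = star a * ip E x x * a - N *\<^sub>R (star a * a) - N *\<^sub>R (star a * a) + N\<^sup>2 *\<^sub>R ip E y y"
    using x y xa
    by (simp add: w_def ip_diff_left ip_diff_right ip_smult_left ip_smult_right ip_ract_left ip_ract_right
        scaleC_of_real star_a a_def[symmetric] mult.assoc algebra_simps power2_eq_square)
  then have "N\<^sup>2 *\<^sub>R ip E y y = N *\<^sub>R (star a * a) + ip E w w + (N *\<^sub>R (star a * a) - star a * ip E x x * a)"
    by (simp add: algebra_simps)
  moreover have "norm (N *\<^sub>R (star a * a)) \<le> norm (N *\<^sub>R (star a * a) + ip E w w + (N *\<^sub>R (star a * a) - star a * ip E x x * a))"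
  proof (rule cstar_positive_mono_norm)
    have "N *\<^sub>R (star a * a) = star (sqrt N *\<^sub>R a) * (sqrt N *\<^sub>R a)"
      using N by (simp add: star_scaleR)
    then show "cstar_positive (N *\<^sub>R (star a * a))" unfolding cstar_positive_def by blast
    show "cstar_positive (N *\<^sub>R (star a * a) - star a * ip E x x * a)"
      using x by (intro cstar_positive_conj_diff ip_positive) (simp_all add: N_def)
  qed (intro ip_positive w)
  ultimately have "norm (N *\<^sub>R (star a * a)) \<le> norm (N\<^sup>2 *\<^sub>R ip E y y)" by (simp only:)
  then have le: "N * (norm a)\<^sup>2 \<le> N * (N * norm (ip E y y))"
    using N by (simp add: cstar_identity power2_eq_square mult.assoc)
  show ?thesis
  proof (cases "N = 0")
    case True
    then have "x = \<zero>" using x by (simp add: N_def ip_definite)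
    then show ?thesis using y by (simp add: ip_zero_left hnorm_nonneg)
  next
    case False
    then have "(norm a)\<^sup>2 \<le> N * norm (ip E y y)" using le N by simp
    also have "\<dots> = (hnorm E x * hnorm E y)\<^sup>2" by (simp add: power_mult_distrib hnorm_sq N_def)
    finally show ?thesis unfolding a_def[symmetric]
      by (rule power2_le_imp_le) (simp add: hnorm_nonneg)
  qed
qed

lemma hnorm_smult: "x \<in> carrier E \<Longrightarrow> hnorm E (k \<odot> x) = cmod k * hnorm E x"
  by (simp add: hnorm_def ip_simps norm_scaleC real_sqrt_mult flip: mult.assoc)

text \<open>An isometric real linear embedding that makes the analysis on normed vector spaces available.\<close>

definition emb :: "'e \<Rightarrow> 'e discrete \<Rightarrow>\<^sub>C 'b" where
  "emb x = Bcontfun (\<lambda>z. if of_discrete z \<in> carrier E \<and> hnorm E (of_discrete z) \<le> 1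
     then ip E (of_discrete z) x else 0)"

lemma emb_apply:
  assumes "x \<in> carrier E"
  shows "apply_bcontfun (emb x) z = (if of_discrete z \<in> carrier E \<and> hnorm E (of_discrete z) \<le> 1
     then ip E (of_discrete z) x else 0)"
  unfolding emb_def
proof (subst Bcontfun_inverse)
  show "(\<lambda>z. if of_discrete z \<in> carrier E \<and> hnorm E (of_discrete z) \<le> 1
     then ip E (of_discrete z) x else 0) \<in> bcontfun"
  proof (rule bcontfun_normI[where b = "hnorm E x"])
    show "continuous_on UNIV (\<lambda>z. if of_discrete z \<in> carrier E \<and> hnorm E (of_discrete z) \<le> 1
     then ip E (of_discrete z) x else 0)"
      by (simp add: continuous_on_open_vimage open_discrete)
    fix z :: "'e discrete"
    have "norm (ip E (of_discrete z) x) \<le> hnorm E x"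
      if "of_discrete z \<in> carrier E" "hnorm E (of_discrete z) \<le> 1"
      using Cauchy_Schwarz[OF that(1) assms] mult_right_mono[OF that(2) hnorm_nonneg[of x]] by simp
    then show "norm (if of_discrete z \<in> carrier E \<and> hnorm E (of_discrete z) \<le> 1
     then ip E (of_discrete z) x else 0) \<le> hnorm E x" by (simp add: hnorm_nonneg)
  qed
qed simp

lemma emb_add: "x \<in> carrier E \<Longrightarrow> y \<in> carrier E \<Longrightarrow> emb (x \<oplus> y) = emb x + emb y"
  by (rule bcontfun_eqI) (simp add: emb_apply ip_add_right)

lemma emb_scaleR: "x \<in> carrier E \<Longrightarrow> emb (complex_of_real r \<odot> x) = r *\<^sub>R emb x"
  by (rule bcontfun_eqI) (simp add: emb_apply ip_smult_right scaleC_of_real)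

lemma emb_diff: "x \<in> carrier E \<Longrightarrow> y \<in> carrier E \<Longrightarrow> emb (x \<ominus> y) = emb x - emb y"
  by (rule bcontfun_eqI) (simp add: emb_apply ip_diff_right)

lemma norm_emb:
  assumes x: "x \<in> carrier E" shows "norm (emb x) = hnorm E x"
proof (rule antisym)
  show "norm (emb x) \<le> hnorm E x"
  proof (rule norm_bound)
    fix z
    show "norm (apply_bcontfun (emb x) z) \<le> hnorm E x"
    proof (cases "of_discrete z \<in> carrier E \<and> hnorm E (of_discrete z) \<le> 1")
      case True
      then show ?thesis
        using Cauchy_Schwarz[of "of_discrete z" x] mult_right_mono[of "hnorm E (of_discrete z)" 1 "hnorm E x"] x
        by (simp add: emb_apply hnorm_nonneg)
    qed (use x in \<open>auto simp: emb_apply hnorm_nonneg\<close>)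
  qed
  show "hnorm E x \<le> norm (emb x)"
  proof (cases "hnorm E x = 0")
    case False
    then have pos: "hnorm E x > 0" using hnorm_nonneg[of x] by linarith
    define z where "z = complex_of_real (1 / hnorm E x) \<odot> x"
    have z: "z \<in> carrier E" "hnorm E z \<le> 1"
      using x pos unfolding z_def by (simp_all only: hnorm_smult norm_of_real) simp_all
    have "ip E z x = (1 / hnorm E x) *\<^sub>R ip E x x"
      using x scaleC_of_real[of "1 / hnorm E x" "ip E x x"] unfolding z_def by (simp only: ip_smult_left complex_cnj_complex_of_real)
    then have "norm (ip E z x) = (1 / hnorm E x) * (hnorm E x)\<^sup>2"
      using pos by (simp add: hnorm_sq)
    also have "\<dots> = hnorm E x" using pos by (simp add: power2_eq_square)
    finally have "hnorm E x = norm (apply_bcontfun (emb x) (discrete z))"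
      using x z by (simp add: emb_apply discrete_inverse)
    then show ?thesis using norm_bounded[of "emb x" "discrete z"] by simp
  qed simp
qed

lemma emb_inj: "inj_on emb (carrier E)"
proof (rule inj_onI)
  fix x y assume xy: "x \<in> carrier E" "y \<in> carrier E" "emb x = emb y"
  then have "hnorm E (x \<ominus> y) = 0" by (simp flip: norm_emb add: emb_diff)
  then have "x \<ominus> y = \<zero>" using xy by (intro hnorm_eq_0) auto
  then show "x = y" by (rule eq_if_minus_zero[OF xy(1,2)])
qed

abbreviation emb_range :: "('e discrete \<Rightarrow>\<^sub>C 'b) set" where
  "emb_range \<equiv> emb ` carrier E"

abbreviation unemb :: "('e discrete \<Rightarrow>\<^sub>C 'b) \<Rightarrow> 'e" where
  "unemb \<equiv> inv_into (carrier E) emb"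

lemma unemb_emb [simp]: "x \<in> carrier E \<Longrightarrow> unemb (emb x) = x"
  by (simp add: emb_inj)

lemma emb_zero: "emb \<zero> = 0"
  using emb_scaleR[of \<zero> 0] by simp

lemma subspace_emb_range: "subspace emb_range"
  unfolding subspace_def
proof (intro conjI ballI allI)
  show "0 \<in> emb_range" by (metis emb_zero image_eqI zero_closed)
  fix x assume "x \<in> emb_range"
  then obtain u where u: "u \<in> carrier E" "x = emb u" by auto
  show "c *\<^sub>R x \<in> emb_range" for c
    using u by (auto simp flip: emb_scaleR)
  fix y assume "y \<in> emb_range"
  then obtain v where v: "v \<in> carrier E" "y = emb v" by auto
  show "x + y \<in> emb_range" using u v by (auto simp flip: emb_add)
qed

lemma complete_emb_range: "complete emb_range"
  unfolding complete_def
proof (intro allI impI)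
  fix f :: "nat \<Rightarrow> 'e discrete \<Rightarrow>\<^sub>C 'b"
  assume f: "(\<forall>n. f n \<in> emb_range) \<and> Cauchy f"
  define X where "X n = unemb (f n)" for n
  have X: "X n \<in> carrier E" "emb (X n) = f n" for n
    using f by (simp_all add: X_def inv_into_into f_inv_into_f)
  have "hcauchy E X"
    unfolding hcauchy_def
  proof (intro conjI allI impI)
    fix \<epsilon> :: real assume "\<epsilon> > 0"
    then obtain N where "\<forall>m\<ge>N. \<forall>n\<ge>N. norm (f m - f n) < \<epsilon>" using f by (metis CauchyD)
    then have "\<forall>m\<ge>N. \<forall>n\<ge>N. hnorm E (X m \<ominus> X n) < \<epsilon>" using X by (simp flip: norm_emb add: emb_diff)
    then show "\<exists>N. \<forall>m\<ge>N. \<forall>n\<ge>N. hnorm E (X m \<ominus> X n) < \<epsilon>" by blast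
  qed (use X in auto)
  then obtain x where x: "x \<in> carrier E" "(\<lambda>n. hnorm E (X n \<ominus> x)) \<longlonglongrightarrow> 0"
    using complete by blast
  then have "(\<lambda>n. norm (f n - emb x)) \<longlonglongrightarrow> 0"
    using X by (simp flip: norm_emb add: emb_diff)
  then have "f \<longlonglongrightarrow> emb x" by (simp add: LIM_zero_iff tendsto_norm_zero_iff)
  then show "\<exists>l\<in>emb_range. f \<longlonglongrightarrow> l" using x(1) by blast
qed



text \<open>Expressed through \<open>emb\<close> so that the limit laws of normed spaces apply;
  \<open>hlim_iff\<close> translates back to \<open>hnorm\<close>.\<close>

definition hlim :: "(nat \<Rightarrow> 'e) \<Rightarrow> 'e \<Rightarrow> bool" where
  "hlim X x \<longleftrightarrow> range X \<subseteq> carrier E \<and> x \<in> carrier E \<and> (\<lambda>n. emb (X n)) \<longlonglongrightarrow> emb x"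

lemma hlim_in: "hlim X x \<Longrightarrow> X n \<in> carrier E" "hlim X x \<Longrightarrow> x \<in> carrier E"
  by (auto simp: hlim_def)

lemma hlim_iff: "hlim X x \<longleftrightarrow> range X \<subseteq> carrier E \<and> x \<in> carrier E \<and> (\<lambda>n. hnorm E (X n \<ominus> x)) \<longlonglongrightarrow> 0"
proof -
  have "((\<lambda>n. emb (X n)) \<longlonglongrightarrow> emb x) = ((\<lambda>n. hnorm E (X n \<ominus> x)) \<longlonglongrightarrow> 0)"
    if "range X \<subseteq> carrier E" "x \<in> carrier E"
  proof -
    have "hnorm E (X n \<ominus> x) = norm (emb (X n) - emb x)" for n
      using that by (simp add: image_subset_iff flip: norm_emb emb_diff)
    then show ?thesis by (simp add: LIM_zero_iff tendsto_norm_zero_iff)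
  qed
  then show ?thesis by (auto simp: hlim_def)
qed

lemma hcauchy_iff: "hcauchy E X \<longleftrightarrow> range X \<subseteq> carrier E \<and> Cauchy (\<lambda>n. emb (X n))"
proof -
  have "hnorm E (X m \<ominus> X n) = norm (emb (X m) - emb (X n))" if "range X \<subseteq> carrier E" for m n
    using that by (simp add: image_subset_iff flip: norm_emb emb_diff)
  then show ?thesis unfolding hcauchy_def Cauchy_iff by auto
qed

lemma hcauchy_hlim: "hcauchy E X \<Longrightarrow> \<exists>x. hlim X x"
  using complete[of X] by (auto simp: hlim_iff hcauchy_def)

lemma hlim_hcauchy: "hlim X x \<Longrightarrow> hcauchy E X"
  unfolding hlim_def hcauchy_iff by (blast intro: LIMSEQ_imp_Cauchy)

lemma hlim_unique: "hlim X x \<Longrightarrow> hlim X y \<Longrightarrow> x = y"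
  by (metis LIMSEQ_unique hlim_def unemb_emb)

lemma hlim_const: "x \<in> carrier E \<Longrightarrow> hlim (\<lambda>n. x) x"
  by (simp add: hlim_def)

lemma hlim_add: "hlim X x \<Longrightarrow> hlim Y y \<Longrightarrow> hlim (\<lambda>n. X n \<oplus> Y n) (x \<oplus> y)"
  by (auto simp: hlim_def emb_add image_subset_iff intro: tendsto_add)

lemma hlim_smult:
  assumes "hlim X x" shows "hlim (\<lambda>n. c \<odot> X n) (c \<odot> x)"
proof -
  have in_E: "X n \<in> carrier E" "x \<in> carrier E" for n using assms by (auto simp: hlim_def)
  have "hnorm E (c \<odot> X n \<ominus> c \<odot> x) = cmod c * hnorm E (X n \<ominus> x)" for n
  proof -
    have "c \<odot> X n \<ominus> c \<odot> x = c \<odot> (X n \<ominus> x)"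
      using in_E by (simp add: minus_conv smult_add_right smult_smult mult.commute)
    then show ?thesis using in_E by (simp add: hnorm_smult)
  qed
  moreover have "(\<lambda>n. cmod c * hnorm E (X n \<ominus> x)) \<longlonglongrightarrow> cmod c * 0"
    using assms by (intro tendsto_intros) (simp add: hlim_iff)
  ultimately show ?thesis using in_E by (auto simp: hlim_iff)
qed

lemma hlim_ip:
  assumes X: "hlim X x" and Y: "hlim Y y"
  shows "(\<lambda>n. ip E (X n) (Y n)) \<longlonglongrightarrow> ip E x y"
proof (rule LIM_zero_cancel, rule Lim_null_comparison)
  have in_E: "X n \<in> carrier E" "Y n \<in> carrier E" "x \<in> carrier E" "y \<in> carrier E" for n
    using X Y by (auto simp: hlim_def)
  have "(\<lambda>n. norm (emb (X n) - emb x) * norm (emb (Y n)) + norm (emb x) * norm (emb (Y n) - emb y))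
      \<longlonglongrightarrow> 0 * norm (emb y) + norm (emb x) * 0"
    using X Y by (intro tendsto_intros tendsto_norm_zero LIM_zero) (simp_all add: hlim_def)
  then show "(\<lambda>n. norm (emb (X n) - emb x) * norm (emb (Y n)) + norm (emb x) * norm (emb (Y n) - emb y)) \<longlonglongrightarrow> 0"
    by simp
  have "norm (ip E (X n) (Y n) - ip E x y)
      \<le> norm (emb (X n) - emb x) * norm (emb (Y n)) + norm (emb x) * norm (emb (Y n) - emb y)" for n
  proof -
    have "ip E (X n) (Y n) - ip E x y = ip E (X n \<ominus> x) (Y n) + ip E x (Y n \<ominus> y)"
      using in_E by (simp add: ip_simps)
    also have "norm \<dots> \<le> hnorm E (X n \<ominus> x) * hnorm E (Y n) + hnorm E x * hnorm E (Y n \<ominus> y)"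
      using in_E by (intro norm_triangle_le add_mono Cauchy_Schwarz) auto
    also have "\<dots> = norm (emb (X n) - emb x) * norm (emb (Y n)) + norm (emb x) * norm (emb (Y n) - emb y)"
      using in_E by (simp flip: norm_emb add: emb_diff)
    finally show ?thesis .
  qed
  then show "\<forall>\<^sub>F n in sequentially. norm (ip E (X n) (Y n) - ip E x y)
      \<le> norm (emb (X n) - emb x) * norm (emb (Y n)) + norm (emb x) * norm (emb (Y n) - emb y)"
    by simp
qed

lemma hlim_isometry:
  assumes lin: "hisometry E E T" and X: "hlim X x"
  shows "hlim (\<lambda>n. T (X n)) (T x)"
proof -
  have in_E: "X n \<in> carrier E" "x \<in> carrier E" for n using X by (auto simp: hlim_def)
  have T: "T y \<in> carrier E" "T (y \<oplus> z) = T y \<oplus> T z" "T (c \<odot> y) = c \<odot> T y" "ip E (T y) (T z) = ip E y z"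
    if "y \<in> carrier E" "z \<in> carrier E" for y z c
    using lin that by (auto simp: hisometry_def hlinear_def)
  have "hnorm E (T (X n) \<ominus> T x) = hnorm E (X n \<ominus> x)" for n
  proof -
    have "T (X n) \<ominus> T x = T (X n \<ominus> x)" using in_E T by (simp add: minus_conv)
    then show ?thesis using in_E T by (simp add: hnorm_def)
  qed
  then show ?thesis using X in_E T by (auto simp: hlim_iff)
qed

end

locale pure_shift_semigroup = hilbert_module E
  for E :: "('b::cstar_algebra, 'e) hmodule" (structure) +
  fixes s :: "real \<Rightarrow> 'e \<Rightarrow> 'e"
  assumes semigroup: "hsemigroup E s"
    and continuous: "strongly_continuous E s"
    and isometries: "adjointable_isometries E s"
    and pure: "pure_semigroup E s"
begin

lemma s_isometry: "0 \<le> t \<Longrightarrow> hisometry E E (s t)"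
  using isometries by (simp add: adjointable_isometries_def)

lemma s_in: "0 \<le> t \<Longrightarrow> x \<in> carrier E \<Longrightarrow> s t x \<in> carrier E"
  using s_isometry[of t] by (auto simp: hisometry_def hlinear_def)

lemma s_add: "0 \<le> t \<Longrightarrow> x \<in> carrier E \<Longrightarrow> y \<in> carrier E \<Longrightarrow> s t (x \<oplus> y) = s t x \<oplus> s t y"
  using s_isometry[of t] by (auto simp: hisometry_def hlinear_def)

lemma s_smult: "0 \<le> t \<Longrightarrow> x \<in> carrier E \<Longrightarrow> s t (c \<odot> x) = c \<odot> s t x"
  using s_isometry[of t] by (auto simp: hisometry_def hlinear_def)

lemma s_zero: "0 \<le> t \<Longrightarrow> s t \<zero> = \<zero>"
  using s_smult[of t \<zero> 0] s_in[of t \<zero>] by simp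

lemma s_ip: "0 \<le> t \<Longrightarrow> x \<in> carrier E \<Longrightarrow> y \<in> carrier E \<Longrightarrow> ip E (s t x) (s t y) = ip E x y"
  using s_isometry[of t] by (auto simp: hisometry_def)

lemma s_s: "0 \<le> r \<Longrightarrow> 0 \<le> t \<Longrightarrow> x \<in> carrier E \<Longrightarrow> s r (s t x) = s (r + t) x"
  using semigroup by (simp add: hsemigroup_def)

lemma s_0: "x \<in> carrier E \<Longrightarrow> s 0 x = x"
  using semigroup by (simp add: hsemigroup_def)

lemma s_hadjoint:
  assumes t: "0 \<le> t" and y: "y \<in> carrier E"
  shows "hadjoint E E (s t) y \<in> carrier E" (is "?x \<in> _")
    and "x \<in> carrier E \<Longrightarrow> ip E (s t x) y = ip E x (hadjoint E E (s t) y)"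
proof -
  have "hadjointable E E (s t)" using isometries t by (simp add: adjointable_isometries_def)
  then obtain S where S: "S \<in> carrier E \<rightarrow> carrier E"
    "\<forall>x\<in>carrier E. \<forall>y\<in>carrier E. ip E (s t x) y = ip E x (S y)"
    unfolding hadjointable_def by (elim conjE bexE)
  have "\<exists>!x. x \<in> carrier E \<and> (\<forall>z\<in>carrier E. ip E (s t z) y = ip E z x)"
  proof (rule ex1I)
    show *: "S y \<in> carrier E \<and> (\<forall>z\<in>carrier E. ip E (s t z) y = ip E z (S y))" using S y by auto
    fix x assume "x \<in> carrier E \<and> (\<forall>z\<in>carrier E. ip E (s t z) y = ip E z x)"
    with * show "x = S y" by (intro ip_eqI) auto
  qed
  from theI'[OF this] have adj: "?x \<in> carrier E \<and> (\<forall>z\<in>carrier E. ip E (s t z) y = ip E z ?x)"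
    unfolding hadjoint_def .
  then show "?x \<in> carrier E" by (rule conjunct1)
  show "ip E (s t x) y = ip E x ?x" if "x \<in> carrier E"
    using adj[THEN conjunct2] that by (rule bspec)
qed

lemma hadjoint_s:
  assumes t: "0 \<le> t" and x: "x \<in> carrier E" shows "hadjoint E E (s t) (s t x) = x"
proof (rule ip_eqI)
  fix z assume z: "z \<in> carrier E"
  have "ip E z (hadjoint E E (s t) (s t x)) = ip E (s t z) (s t x)"
    using s_hadjoint(2)[OF t s_in[OF t x] z] by simp
  then show "ip E z (hadjoint E E (s t) (s t x)) = ip E z x" using s_ip[OF t z x] by simp
qed (use assms in \<open>simp_all add: s_in s_hadjoint\<close>)

text \<open>Transport to the range of \<open>emb\<close>, after which \<open>generated_dense\<close>
  is available for the semigroup on the module.\<close>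

sublocale typed: pure_isometries emb_range "\<lambda>u v. ip E (unemb u) (unemb v)"
  "\<lambda>t u. emb (s t (unemb u))" "\<lambda>t u. emb (hadjoint E E (s t) (unemb u))"
proof
  fix x assume "x \<in> emb_range"
  then obtain u where u: "u \<in> carrier E" "x = emb u" by auto
  have "((\<lambda>r. hnorm E (s r u \<ominus> s 0 u)) \<longlongrightarrow> 0) (at 0 within {0..})"
    using continuous u unfolding strongly_continuous_def by blast
  then have "((\<lambda>r. hnorm E (s r u \<ominus> u)) \<longlongrightarrow> 0) (at_right 0)"
    using u s_0 by (auto intro: tendsto_within_subset)
  moreover have "\<forall>\<^sub>F r in at_right 0. hnorm E (s r u \<ominus> u) = norm (emb (s r u) - emb u)"
    using u s_in by (auto simp: eventually_at_right_field emb_diff simp flip: norm_emb intro!: exI[of _ 1])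
  ultimately have "((\<lambda>r. norm (emb (s r u) - emb u)) \<longlongrightarrow> 0) (at_right 0)"
    by (rule Lim_transform_eventually)
  then show "((\<lambda>t. emb (s t (unemb x))) \<longlongrightarrow> x) (at_right 0)"
    using u by (simp add: LIM_zero_iff tendsto_norm_zero_iff)
  have "((\<lambda>t. hnorm E (hadjoint E E (s t) u)) \<longlongrightarrow> 0) at_top"
    using pure u by (simp add: pure_semigroup_def)
  moreover have "\<forall>\<^sub>F t in at_top. hnorm E (hadjoint E E (s t) u) = norm (emb (hadjoint E E (s t) u))"
    using eventually_ge_at_top[of 0] by eventually_elim (use u s_hadjoint in \<open>simp add: norm_emb\<close>)
  ultimately have "((\<lambda>t. norm (emb (hadjoint E E (s t) u))) \<longlongrightarrow> 0) at_top"
    by (rule Lim_transform_eventually)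
  then show "((\<lambda>t. emb (hadjoint E E (s t) (unemb x))) \<longlongrightarrow> 0) at_top"
    using u by (simp add: tendsto_norm_zero_iff)
qed (auto simp: subspace_emb_range complete_emb_range ip_simps scaleC_of_real s_in s_ip s_s s_0 ip_star
    s_hadjoint hadjoint_s hnorm_sq norm_emb Cauchy_Schwarz simp flip: emb_add emb_scaleR)

end


section \<open>The fiber\<close>

text \<open>Negation in a record is a description over its carrier. The hypotheses ask for no group
  structure, so that negatives can also be computed in \<open>L2_alg Fib\<close>, which is not shown
  to be a module.\<close>

lemma a_inv_eqI:
  assumes "y \<in> carrier G" "z \<in> carrier G" "y \<oplus>\<^bsub>G\<^esub> z = \<zero>\<^bsub>G\<^esub>" "z \<oplus>\<^bsub>G\<^esub> y = \<zero>\<^bsub>G\<^esub>"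
    and "\<And>z'. z' \<in> carrier G \<Longrightarrow> y \<oplus>\<^bsub>G\<^esub> z' = \<zero>\<^bsub>G\<^esub> \<Longrightarrow> z' = z"
  shows "\<ominus>\<^bsub>G\<^esub> y = z"
  unfolding a_inv_def m_inv_def
proof (rule the_equality)
  show "z \<in> carrier (add_monoid G) \<and> y \<otimes>\<^bsub>add_monoid G\<^esub> z = \<one>\<^bsub>add_monoid G\<^esub>
      \<and> z \<otimes>\<^bsub>add_monoid G\<^esub> y = \<one>\<^bsub>add_monoid G\<^esub>"
    using assms(2-4) by simp
  fix z' assume "z' \<in> carrier (add_monoid G) \<and> y \<otimes>\<^bsub>add_monoid G\<^esub> z' = \<one>\<^bsub>add_monoid G\<^esub>
      \<and> z' \<otimes>\<^bsub>add_monoid G\<^esub> y = \<one>\<^bsub>add_monoid G\<^esub>"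
  then show "z' = z" by (intro assms(5)) simp_all
qed

context hilbert_module
begin

lemma add_neg:
  assumes "x \<in> carrier E" shows "x \<oplus> (-1) \<odot> x = \<zero>" "(-1) \<odot> x \<oplus> x = \<zero>"
proof -
  have "x \<oplus> (-1) \<odot> x = (1 + (-1)) \<odot> x" using assms by (subst smult_add_left) simp_all
  then show "x \<oplus> (-1) \<odot> x = \<zero>" using assms by simp
  then show "(-1) \<odot> x \<oplus> x = \<zero>" using assms by (simp add: a_comm)
qed

lemma add_eq_zero:
  assumes "x \<in> carrier E" "y \<in> carrier E" "x \<oplus> y = \<zero>" shows "y = (-1) \<odot> x"
  using add_neg(1)[OF assms(1)] assms by (metis a_comm add.inv_equality smult_in)

end

context pure_shift_semigroup
begin

text \<open>The eigenvector equation for the adjoint of \<open>s t\<close>, tested against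
  \<open>z\<close>. In this form, closure under the module operations and under limits follows from
  the rules for \<open>ip\<close>.\<close>

definition fiber :: "'e set" where
  "fiber = {y \<in> carrier E. \<forall>t\<ge>0. \<forall>z\<in>carrier E. ip E (s t z) y = scaleC (complex_of_real (exp (- t))) (ip E z y)}"

definition Fib :: "('b, 'e) hmodule" where
  "Fib = E\<lparr>carrier := fiber\<rparr>"

lemma Fib_simps [simp]:
  "carrier Fib = fiber" "\<zero>\<^bsub>Fib\<^esub> = \<zero>" "x \<oplus>\<^bsub>Fib\<^esub> y = x \<oplus> y" "c \<odot>\<^bsub>Fib\<^esub> x = c \<odot> x"
  "ract Fib x b = ract E x b" "ip Fib x y = ip E x y" "hnorm Fib x = hnorm E x"
  by (simp_all add: Fib_def hnorm_def)

lemma fiber_in [simp]: "y \<in> fiber \<Longrightarrow> y \<in> carrier E"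
  by (simp add: fiber_def)

lemma ip_s_fiber:
  "y \<in> fiber \<Longrightarrow> 0 \<le> t \<Longrightarrow> z \<in> carrier E \<Longrightarrow> ip E (s t z) y = scaleC (complex_of_real (exp (- t))) (ip E z y)"
  unfolding fiber_def by blast

lemma fiberI:
  "y \<in> carrier E \<Longrightarrow> (\<And>t z. 0 \<le> t \<Longrightarrow> z \<in> carrier E \<Longrightarrow>
    ip E (s t z) y = scaleC (complex_of_real (exp (- t))) (ip E z y)) \<Longrightarrow> y \<in> fiber"
  unfolding fiber_def by blast

lemma fiber_zero: "\<zero> \<in> fiber"
  by (rule fiberI) (simp_all add: ip_zero_right s_in scaleC_zero_right)

lemma fiber_add: "x \<in> fiber \<Longrightarrow> y \<in> fiber \<Longrightarrow> x \<oplus> y \<in> fiber"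
  by (rule fiberI) (simp_all add: ip_add_right s_in scaleC_add_right ip_s_fiber)

lemma fiber_smult: "x \<in> fiber \<Longrightarrow> c \<odot> x \<in> fiber"
  by (rule fiberI) (simp_all add: ip_smult_right s_in scaleC_scaleC mult.commute ip_s_fiber)

lemma fiber_ract: "x \<in> fiber \<Longrightarrow> ract E x b \<in> fiber"
  by (rule fiberI) (simp_all add: ip_ract_right s_in scaleC_mult_left ract_closed ip_s_fiber)

lemma fiber_hlim:
  assumes X: "hlim X x" and fib: "\<And>n. X n \<in> fiber" shows "x \<in> fiber"
proof -
  have x: "x \<in> carrier E" using X by (rule hlim_in)
  have "ip E (s t z) x = scaleC (complex_of_real (exp (- t))) (ip E z x)" if t: "0 \<le> t" and z: "z \<in> carrier E" for t z
  proof (rule LIMSEQ_unique)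
    show "(\<lambda>n. ip E (s t z) (X n)) \<longlonglongrightarrow> ip E (s t z) x"
      using X t z by (intro hlim_ip hlim_const s_in)
    have "(\<lambda>n. scaleC (complex_of_real (exp (- t))) (ip E z (X n))) \<longlonglongrightarrow> scaleC (complex_of_real (exp (- t))) (ip E z x)"
      by (intro bounded_bilinear.tendsto[OF bounded_bilinear_scaleC] tendsto_const hlim_ip hlim_const z X)
    then show "(\<lambda>n. ip E (s t z) (X n)) \<longlonglongrightarrow> scaleC (complex_of_real (exp (- t))) (ip E z x)"
      using ip_s_fiber[OF fib t z] by simp
  qed
  with x show ?thesis by (rule fiberI)
qed

lemma Fib_module: "Module.module complex_ring Fib"
proof -
  have "submodule fiber complex_ring E"
  proof (rule submoduleI)
    show "\<ominus> x \<in> fiber" if "x \<in> fiber" for x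
      using that fiber_smult[of x "-1"] a_inv_eqI[of x E "(-1) \<odot> x"] add_neg[of x] add_eq_zero[of x] by simp
  qed (auto simp: fiber_zero fiber_add fiber_smult)
  then show ?thesis
    unfolding Fib_def using submodule.submodule_is_module module_axioms by blast
qed

text \<open>The description of a negative ranges over the carrier, so the negatives in
  \<open>Fib\<close> and in \<open>E\<close> have to be compared.\<close>

lemma Fib_a_minus: "x \<in> fiber \<Longrightarrow> y \<in> fiber \<Longrightarrow> x \<ominus>\<^bsub>Fib\<^esub> y = x \<ominus> y"
  using a_inv_eqI[of y Fib "(-1) \<odot> y"] add_neg[of y] add_eq_zero[of y] fiber_smult[of y "-1"]
  by (simp add: minus_conv) (simp add: a_minus_def)

theorem Fib_hilbert_module: "hilbert_module Fib"
proof (intro hilbert_module.intro hilbert_module_axioms.intro Fib_module)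
  fix X assume X: "hcauchy Fib X"
  then have fib: "X n \<in> fiber" for n by (auto simp: hcauchy_def)
  then have "hcauchy E X" using X by (auto simp: hcauchy_def Fib_a_minus)
  then obtain x where x: "hlim X x" using hcauchy_hlim by blast
  then have "x \<in> fiber" using fib by (rule fiber_hlim)
  moreover have "(\<lambda>n. hnorm E (X n \<ominus> x)) \<longlonglongrightarrow> 0" using x by (simp add: hlim_iff)
  ultimately show "\<exists>x\<in>carrier Fib. (\<lambda>n. hnorm Fib (X n \<ominus>\<^bsub>Fib\<^esub> x)) \<longlonglongrightarrow> 0"
    using fib by (intro bexI[of _ x]) (simp_all add: Fib_a_minus)
qed (simp_all add: fiber_ract ract_add_left ract_add_right ract_mult ract_smult ract_scaleC ip_add_right
    ip_smult_right ip_ract_right ip_star ip_positive ip_definite)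

text \<open>The common shift cancels by isometry, and the remaining one is evaluated by the
  eigenvector equation. The result is \<open>exp (- \<bar>r - u\<bar>)\<close>, which is also the
  inner product of the shifted exponentials.\<close>

lemma ip_s_s:
  assumes y: "y \<in> fiber" and z: "z \<in> fiber" and r: "0 \<le> r" and u: "0 \<le> u"
  shows "ip E (s r y) (s u z) = scaleC (l2ip (shifted_exp r) (shifted_exp u)) (ip E y z)"
proof (cases "r \<le> u")
  case True
  have "ip E (s r y) (s u z) = ip E (s r y) (s r (s (u - r) z))"
    using True r z by (simp add: s_s)
  also have "\<dots> = ip E y (s (u - r) z)" using True r y z by (simp add: s_ip s_in)
  also have "\<dots> = star (ip E (s (u - r) z) y)" using True y z by (simp add: ip_star s_in)
  also have "\<dots> = scaleC (complex_of_real (exp (- (u - r)))) (ip E y z)"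
    using True y z by (simp add: ip_s_fiber star_scaleC ip_star)
  finally show ?thesis using True by (simp add: l2ip_shifted_exp)
next
  case False
  have "ip E (s r y) (s u z) = ip E (s u (s (r - u) y)) (s u z)"
    using False u y by (simp add: s_s)
  also have "\<dots> = ip E (s (r - u) y) z" using False u y z by (simp add: s_ip s_in)
  also have "\<dots> = scaleC (complex_of_real (exp (- (r - u)))) (ip E y z)"
    using False y z by (simp add: ip_s_fiber)
  finally show ?thesis using False by (simp add: l2ip_shifted_exp)
qed


section \<open>The isometry on elementary tensors\<close>

text \<open>The pairs \<open>(h, x)\<close> with \<open>x\<close> the image of \<open>h \<otimes> y\<close>; the image of \<open>shifted_exp r \<otimes> y\<close> is \<open>s r y\<close>.\<close>

inductive exp_rel :: "'e \<Rightarrow> (real \<Rightarrow> complex) \<Rightarrow> 'e \<Rightarrow> bool" for y where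
  zero: "exp_rel y (\<lambda>u. 0) \<zero>"
| step: "exp_rel y h x \<Longrightarrow> 0 \<le> r \<Longrightarrow> exp_rel y (\<lambda>u. h u + c * shifted_exp r u) (x \<oplus> c \<odot> s r y)"

lemma exp_rel_in: "exp_rel y h x \<Longrightarrow> y \<in> fiber \<Longrightarrow> x \<in> carrier E"
  by (induction rule: exp_rel.induct) (simp_all add: s_in)

lemma exp_rel_span: "exp_rel y h x \<Longrightarrow> h \<in> exp_span"
  by (induction rule: exp_rel.induct) (simp_all add: exp_span.intros)

lemma exp_rel_L2: "exp_rel y h x \<Longrightarrow> h \<in> L2_halfline"
  using exp_rel_span exp_span_L2 by blast

lemma exp_rel_ex: "h \<in> exp_span \<Longrightarrow> \<exists>x. exp_rel y h x"
  by (induction rule: exp_span.induct) (blast intro: exp_rel.intros)+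

text \<open>First half of a double induction: one factor is a single shifted exponential.
  \<open>exp_rel_ip\<close> then varies that factor.\<close>

lemma exp_rel_ip_s:
  assumes "exp_rel y h x" "y \<in> fiber" "z \<in> fiber" "0 \<le> r"
  shows "ip E (s r z) x = scaleC (l2ip (shifted_exp r) h) (ip E z y)"
  using assms(1)
proof (induction rule: exp_rel.induct)
  case zero
  then show ?case using assms by (simp add: ip_zero_right s_in scaleC_zero_left)
next
  case (step h x u c)
  then show ?case using assms exp_rel_in[OF step(1)] exp_rel_L2[OF step(1)]
    by (simp add: ip_add_right ip_smult_right s_in ip_s_s l2ip_add_right l2ip_cmult_right
        shifted_exp_L2 L2_cmult scaleC_add_left scaleC_scaleC)
qed

lemma exp_rel_ip:
  assumes "exp_rel z k w" "exp_rel y h x" "y \<in> fiber" "z \<in> fiber"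
  shows "ip E w x = scaleC (l2ip k h) (ip E z y)"
  using assms(1)
proof (induction rule: exp_rel.induct)
  case zero
  then show ?case using assms exp_rel_in by (simp add: ip_zero_left scaleC_zero_left)
next
  case (step k w u c)
  then show ?case
    using assms exp_rel_in[OF step(1)] exp_rel_L2[OF step(1)] exp_rel_in[OF assms(2)] exp_rel_L2[OF assms(2)]
    by (simp add: ip_add_left ip_smult_left s_in exp_rel_ip_s l2ip_add_left l2ip_cmult_left
        shifted_exp_L2 L2_cmult scaleC_add_left scaleC_scaleC)
qed

lemma exp_rel_shift:
  assumes "exp_rel y h x" "y \<in> fiber" "0 \<le> t"
  shows "exp_rel y (\<lambda>u. h (u - t)) (s t x)"
  using assms(1)
proof (induction rule: exp_rel.induct)
  case zero
  then show ?case using exp_rel.zero assms by (simp add: s_zero)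
next
  case (step h x r c)
  have "shifted_exp r (u - t) = shifted_exp (r + t) u" for u by (auto simp: shifted_exp_def algebra_simps)
  moreover have "s t (x \<oplus> c \<odot> s r y) = s t x \<oplus> c \<odot> s (r + t) y"
    using assms step exp_rel_in[OF step(1)] by (simp add: s_add s_smult s_in s_s add.commute)
  ultimately show ?case using exp_rel.step[OF step(3), of "r + t" c] step assms by simp
qed

lemma exp_rel_smult:
  assumes "exp_rel y h x" "y \<in> fiber"
  shows "exp_rel (a \<odot> y) h (a \<odot> x)"
  using assms(1)
proof (induction rule: exp_rel.induct)
  case zero
  then show ?case using exp_rel.zero by simp
next
  case (step h x r c)
  have "a \<odot> (x \<oplus> c \<odot> s r y) = a \<odot> x \<oplus> c \<odot> s r (a \<odot> y)"
    using assms step exp_rel_in[OF step(1)] by (simp add: smult_add_right smult_smult s_smult s_in mult.commute)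
  then show ?case using exp_rel.step[OF step(3), of r c] step by simp
qed

text \<open>The extension by continuity to all square integrable \<open>h\<close>. Existence of a
  value is \<open>tensor_rel_ex\<close>; independence of the approximating sequence is covered by
  \<open>span_rel_unique\<close>.\<close>

definition tensor_rel :: "'e \<Rightarrow> (real \<Rightarrow> complex) \<Rightarrow> 'e \<Rightarrow> bool" where
  "tensor_rel y h x \<longleftrightarrow> y \<in> fiber \<and> h \<in> L2_halfline \<and>
     (\<exists>H X. (\<forall>n. exp_rel y (H n) (X n)) \<and> (\<lambda>n. l2sq (\<lambda>u. H n u - h u)) \<longlonglongrightarrow> 0 \<and> hlim X x)"

lemma tensor_rel_in: "tensor_rel y h x \<Longrightarrow> x \<in> carrier E" "tensor_rel y h x \<Longrightarrow> y \<in> fiber"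
  "tensor_rel y h x \<Longrightarrow> h \<in> L2_halfline"
  by (auto simp: tensor_rel_def hlim_in)

lemma tensor_relE:
  assumes "tensor_rel y h x"
  obtains H X where "\<And>n. exp_rel y (H n) (X n)" "(\<lambda>n. l2sq (\<lambda>u. H n u - h u)) \<longlonglongrightarrow> 0" "hlim X x"
  using assms unfolding tensor_rel_def by blast

lemma exp_rel_tensor_rel:
  assumes "exp_rel y h x" "y \<in> fiber" shows "tensor_rel y h x"
  unfolding tensor_rel_def using assms exp_rel_in[OF assms] exp_rel_L2[OF assms(1)]
  by (intro conjI exI[of _ "\<lambda>n. h"] exI[of _ "\<lambda>n. x"] hlim_const) (auto simp: l2sq_def)

lemma tensor_rel_s:
  assumes "y \<in> fiber" "0 \<le> r" shows "tensor_rel y (shifted_exp r) (s r y)"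
  using exp_rel_tensor_rel[OF exp_rel.step[OF exp_rel.zero assms(2), of y 1] assms(1)] assms
  by (simp add: s_in)

text \<open>Approximate \<open>h\<close> by combinations \<open>H n\<close> of shifted exponentials.
  By \<open>exp_rel_ip\<close> the distance of two images is the distance of the functions times the
  length of \<open>y\<close>, so the images form a Cauchy sequence.\<close>

lemma tensor_rel_ex:
  assumes y: "y \<in> fiber" and h: "h \<in> L2_halfline"
  shows "\<exists>x. tensor_rel y h x"
proof -
  obtain H where H: "\<And>n. H n \<in> exp_span" and lim: "(\<lambda>n. l2sq (\<lambda>u. H n u - h u)) \<longlonglongrightarrow> 0"
    using exp_span_dense[OF h] by metis
  obtain X where X: "\<And>n. exp_rel y (H n) (X n)" using exp_rel_ex[OF H] by metis
  have in_E: "X n \<in> carrier E" for n using exp_rel_in[OF X y] .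
  have L2: "H n \<in> L2_halfline" for n using exp_rel_L2[OF X] .
  have diff: "(hnorm E (X m \<ominus> X n))\<^sup>2 = l2sq (\<lambda>u. H m u - H n u) * (hnorm E y)\<^sup>2" for m n
  proof -
    have "ip E (X m \<ominus> X n) (X m \<ominus> X n) = scaleC (l2ip (\<lambda>u. H m u - H n u) (\<lambda>u. H m u - H n u)) (ip E y y)"
      using in_E L2 by (simp add: ip_diff_left ip_diff_right exp_rel_ip[OF X X y y] l2ip_diff_left
          l2ip_diff_right L2_diff scaleC_diff_left)
    then show ?thesis by (simp add: hnorm_sq l2ip_self norm_scaleC l2sq_nonneg)
  qed
  have "hcauchy E X"
    unfolding hcauchy_def
  proof (intro conjI allI impI)
    show "range X \<subseteq> carrier E" using in_E by auto
    fix e :: real assume e: "e > 0"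
    \<comment> \<open>The \<open>1\<close> keeps \<open>c\<close> positive when \<open>y\<close> is
      zero; the \<open>4\<close> in \<open>d\<close> comes from the two factors \<open>2\<close> in
      \<open>l2sq_add_le\<close>.\<close>
    define c where "c = (hnorm E y)\<^sup>2 + 1"
    define d where "d = e\<^sup>2 / (4 * c)"
    have c: "c > 0" "(hnorm E y)\<^sup>2 < c" by (simp_all add: c_def add_nonneg_pos)
    have d: "d > 0" using e c by (simp add: d_def)
    obtain N where N: "\<And>n. n \<ge> N \<Longrightarrow> l2sq (\<lambda>u. H n u - h u) < d"
      using order_tendstoD(2)[OF lim d] by (auto simp: eventually_sequentially)
    have "hnorm E (X m \<ominus> X n) < e" if "m \<ge> N" "n \<ge> N" for m n
    proof -
      have sym: "l2sq (\<lambda>u. h u - H n u) = l2sq (\<lambda>u. H n u - h u)"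
        by (simp add: l2sq_def norm_minus_commute)
      have "l2sq (\<lambda>u. (H m u - h u) + (h u - H n u)) \<le> 2 * l2sq (\<lambda>u. H m u - h u) + 2 * l2sq (\<lambda>u. h u - H n u)"
        using L2 h by (intro l2sq_add_le L2_diff)
      then have "l2sq (\<lambda>u. H m u - H n u) < 4 * d"
        using N[OF that(1)] N[OF that(2)] by (simp add: sym)
      then have "(hnorm E (X m \<ominus> X n))\<^sup>2 \<le> (4 * d) * (hnorm E y)\<^sup>2"
        unfolding diff by (intro mult_right_mono) auto
      also have "\<dots> < (4 * d) * c" using d c by (intro mult_strict_left_mono) auto
      also have "\<dots> = e\<^sup>2" using c by (simp add: d_def)
      finally show ?thesis by (rule power2_less_imp_less) (use e in simp)
    qed
    then show "\<exists>N. \<forall>m\<ge>N. \<forall>n\<ge>N. hnorm E (X m \<ominus> X n) < e" by blast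
  qed
  then obtain x where "hlim X x" using hcauchy_hlim by blast
  then show ?thesis unfolding tensor_rel_def using X lim y h by blast
qed

lemma tensor_rel_ip:
  assumes "tensor_rel z k w" "tensor_rel y h x"
  shows "ip E w x = scaleC (l2ip k h) (ip E z y)"
proof -
  obtain K W where K: "\<And>n. exp_rel z (K n) (W n)" "(\<lambda>n. l2sq (\<lambda>u. K n u - k u)) \<longlonglongrightarrow> 0" "hlim W w"
    by (rule tensor_relE[OF assms(1)], rule that)
  obtain H X where H: "\<And>n. exp_rel y (H n) (X n)" "(\<lambda>n. l2sq (\<lambda>u. H n u - h u)) \<longlonglongrightarrow> 0" "hlim X x"
    by (rule tensor_relE[OF assms(2)], rule that)
  note in_F = tensor_rel_in(2)[OF assms(1)] tensor_rel_in(2)[OF assms(2)]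
  have "(\<lambda>n. scaleC (l2ip (K n) (H n)) (ip E z y)) \<longlonglongrightarrow> scaleC (l2ip k h) (ip E z y)"
    using assms by (intro bounded_bilinear.tendsto[OF bounded_bilinear_scaleC] tendsto_const l2ip_tendsto K H
        exp_rel_L2[OF K(1)] exp_rel_L2[OF H(1)] tensor_rel_in(3))
  then have "(\<lambda>n. ip E (W n) (X n)) \<longlonglongrightarrow> scaleC (l2ip k h) (ip E z y)"
    by (simp add: exp_rel_ip[OF K(1) H(1) in_F(2) in_F(1)])
  with hlim_ip[OF K(3) H(3)] show ?thesis by (rule LIMSEQ_unique)
qed

lemma tensor_rel_shift:
  assumes "tensor_rel y h x" "0 \<le> t"
  shows "tensor_rel y (\<lambda>u. h (u - t)) (s t x)"
proof -
  obtain H X where H: "\<And>n. exp_rel y (H n) (X n)" "(\<lambda>n. l2sq (\<lambda>u. H n u - h u)) \<longlonglongrightarrow> 0" "hlim X x"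
    by (rule tensor_relE[OF assms(1)], rule that)
  note y = tensor_rel_in(2)[OF assms(1)] and h = tensor_rel_in(3)[OF assms(1)]
  have "(\<lambda>n. l2sq (\<lambda>u. H n (u - t) - h (u - t))) \<longlonglongrightarrow> 0"
    using H(2) by (simp only: l2sq_shift[of "\<lambda>u. H n u - h u" t for n])
  moreover have "hlim (\<lambda>n. s t (X n)) (s t x)" by (rule hlim_isometry[OF s_isometry[OF assms(2)] H(3)])
  ultimately show ?thesis
    unfolding tensor_rel_def using exp_rel_shift[OF H(1) y assms(2)] y L2_shift[OF h assms(2)]
    by (intro conjI exI[of _ "\<lambda>n u. H n (u - t)"] exI[of _ "\<lambda>n. s t (X n)"]) auto
qed

lemma tensor_rel_smult:
  assumes "tensor_rel y h x" shows "tensor_rel (a \<odot> y) h (a \<odot> x)"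
proof -
  obtain H X where H: "\<And>n. exp_rel y (H n) (X n)" "(\<lambda>n. l2sq (\<lambda>u. H n u - h u)) \<longlonglongrightarrow> 0" "hlim X x"
    by (rule tensor_relE[OF assms(1)], rule that)
  note y = tensor_rel_in(2)[OF assms(1)] and h = tensor_rel_in(3)[OF assms(1)]
  show ?thesis
    unfolding tensor_rel_def using H(2) hlim_smult[OF H(3)] exp_rel_smult[OF H(1) y] y h fiber_smult
    by (intro conjI exI[of _ H] exI[of _ "\<lambda>n. a \<odot> X n"]) auto
qed


section \<open>The isometry on the algebraic tensor product\<close>

text \<open>The isometry on finite sums of elementary tensors. The value might depend on how a
  function is written as a sum; \<open>span_rel_unique\<close> excludes this.\<close>

inductive span_rel :: "(real \<Rightarrow> 'e) \<Rightarrow> 'e \<Rightarrow> bool" where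
  zero: "span_rel (\<lambda>u. \<zero>) \<zero>"
| step: "span_rel f x \<Longrightarrow> tensor_rel y h w \<Longrightarrow> span_rel (\<lambda>u. f u \<oplus> h u \<odot> y) (x \<oplus> w)"

lemma span_rel_in: "span_rel f x \<Longrightarrow> x \<in> carrier E \<and> (\<forall>u. f u \<in> fiber)"
  by (induction rule: span_rel.induct) (auto simp: fiber_zero fiber_add fiber_smult tensor_rel_in)

text \<open>\<open>has_integral\<close> carries integrability along with the value, so that the
  induction can add integrals.\<close>

lemma span_rel_ip_tensor:
  assumes zk: "tensor_rel z k w" and "span_rel f x"
  shows "((\<lambda>u. ip E (k u \<odot> z) (f u)) has_integral ip E w x) {0..}"
  using assms(2)
proof (induction rule: span_rel.induct)
  case zero
  then show ?case using tensor_rel_in[OF zk] by (simp add: ip_zero_right)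
next
  case (step f x y h v)
  note in_E = span_rel_in[OF step(1)] tensor_rel_in[OF step(2)] tensor_rel_in[OF zk]
  have "((\<lambda>u. ip E (k u \<odot> z) (f u) + scaleC (cnj (k u) * h u) (ip E z y)) has_integral
      ip E w x + scaleC (l2ip k h) (ip E z y)) {0..}"
    using in_E by (intro has_integral_add step has_integral_l2ip)
  then show ?case
    using in_E tensor_rel_ip[OF zk step(2)]
    by (simp add: ip_add_right ip_smult_right ip_smult_left scaleC_scaleC mult.commute)
qed

lemma span_rel_ip:
  assumes "span_rel f x" "span_rel g w"
  shows "((\<lambda>u. ip E (f u) (g u)) has_integral ip E x w) {0..}"
  using assms(1)
proof (induction rule: span_rel.induct)
  case zero
  then show ?case using span_rel_in[OF assms(2)] by (simp add: ip_zero_left)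
next
  case (step f x y h v)
  note in_E = span_rel_in[OF step(1)] tensor_rel_in[OF step(2)] span_rel_in[OF assms(2)]
  have "((\<lambda>u. ip E (f u) (g u) + ip E (h u \<odot> y) (g u)) has_integral ip E x w + ip E v w) {0..}"
    using step by (intro has_integral_add span_rel_ip_tensor assms(2))
  then show ?case using in_E by (simp add: ip_add_left)
qed

lemma span_rel_add:
  assumes f: "span_rel f x" and "span_rel g w"
  shows "span_rel (\<lambda>u. f u \<oplus> g u) (x \<oplus> w)"
  using assms(2)
proof (induction rule: span_rel.induct)
  case zero
  then show ?case using f span_rel_in[OF f] by simp
next
  case (step g w y h v)
  note in_E = span_rel_in[OF f] span_rel_in[OF step(1)] tensor_rel_in[OF step(2)]
  have "span_rel (\<lambda>u. (f u \<oplus> g u) \<oplus> h u \<odot> y) ((x \<oplus> w) \<oplus> v)"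
    using step by (intro span_rel.step)
  then show ?case using in_E by (simp add: a_assoc)
qed

lemma span_rel_smult:
  assumes "span_rel f x" shows "span_rel (\<lambda>u. c \<odot> f u) (c \<odot> x)"
  using assms
proof (induction rule: span_rel.induct)
  case zero
  then show ?case using span_rel.zero by simp
next
  case (step f x y h v)
  note in_E = span_rel_in[OF step(1)] tensor_rel_in[OF step(2)]
  have "span_rel (\<lambda>u. c \<odot> f u \<oplus> h u \<odot> (c \<odot> y)) (c \<odot> x \<oplus> c \<odot> v)"
    using step tensor_rel_smult by (intro span_rel.step) auto
  then show ?case using in_E by (simp add: smult_add_right smult_smult mult.commute)
qed

lemma span_rel_shift:
  assumes "span_rel f x" "0 \<le> t" shows "span_rel (shift_fun Fib t f) (s t x)"
  using assms(1)
proof (induction rule: span_rel.induct)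
  case zero
  then show ?case using span_rel.zero assms(2) by (simp add: shift_fun_def s_zero cong: if_cong)
next
  case (step f x y h v)
  note in_E = span_rel_in[OF step(1)] tensor_rel_in[OF step(2)]
  have "span_rel (\<lambda>u. shift_fun Fib t f u \<oplus> h (u - t) \<odot> y) (s t x \<oplus> s t v)"
    using step tensor_rel_shift assms(2) by (intro span_rel.step) auto
  \<comment> \<open>For \<open>u < t\<close> the scalar \<open>h (u - t)\<close> vanishes, which
    matches the default zero in \<open>shift_fun\<close>.\<close>
  moreover have "shift_fun Fib t (\<lambda>u. f u \<oplus> h u \<odot> y) = (\<lambda>u. shift_fun Fib t f u \<oplus> h (u - t) \<odot> y)"
    using in_E L2_neg[of h] by (auto simp: shift_fun_def fun_eq_iff)
  ultimately show ?case using in_E assms(2) by (simp add: s_add)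
qed

text \<open>All inner products among \<open>x\<close> and \<open>w\<close> are integrals of the same
  function, so their difference has length zero.\<close>

lemma span_rel_unique:
  assumes "span_rel f x" "span_rel f w" shows "x = w"
proof -
  have in_E: "x \<in> carrier E" "w \<in> carrier E" using assms span_rel_in by blast+
  have "ip E x x = ip E x w" "ip E w x = ip E w w"
    using assms span_rel_ip has_integral_unique by blast+
  then have "ip E (x \<ominus> w) (x \<ominus> w) = 0" using in_E by (simp add: ip_diff_left ip_diff_right)
  then have "x \<ominus> w = \<zero>" using in_E by (intro ip_definite) auto
  then show ?thesis by (rule eq_if_minus_zero[OF in_E])
qed

text \<open>A real multiple of a translate \<open>s r y\<close> is absorbed into the fiber vector
  \<open>y\<close>, so it is again the image of a single elementary tensor.\<close>

lemma generated_span_rel: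
  assumes "m \<in> typed.generated" shows "\<exists>f x. span_rel f x \<and> m = emb x"
  using assms
proof (induction rule: span_induct_alt)
  case base
  then show ?case using span_rel.zero emb_zero by metis
next
  case (step c m1 m2)
  then obtain f x where f: "span_rel f x" "m2 = emb x" by blast
  from step obtain r v where r: "0 \<le> r" "v \<in> typed.eigenspace" "m1 = emb (s r (unemb v))" by auto
  then obtain y where y: "y \<in> carrier E" "v = emb y" by (auto simp: typed.eigenspace_def)
  have "y \<in> fiber"
  proof (rule fiberI[OF y(1)])
    fix t :: real and z assume t: "0 \<le> t" and z: "z \<in> carrier E"
    have "ip E (unemb (emb (s t (unemb (emb z))))) (unemb v) = exp (- t) *\<^sub>R ip E (unemb (emb z)) (unemb v)"
      using r(2) t z unfolding typed.eigenspace_def by blast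
    then show "ip E (s t z) y = scaleC (complex_of_real (exp (- t))) (ip E z y)"
      using t z y by (simp add: s_in scaleC_of_real)
  qed
  then have "tensor_rel (complex_of_real c \<odot> y) (shifted_exp r) (s r (complex_of_real c \<odot> y))"
    using r(1) by (intro tensor_rel_s fiber_smult)
  then have "span_rel (\<lambda>u. f u \<oplus> shifted_exp r u \<odot> (complex_of_real c \<odot> y)) (x \<oplus> s r (complex_of_real c \<odot> y))"
    using f by (intro span_rel.step)
  moreover have "c *\<^sub>R m1 + m2 = emb (x \<oplus> s r (complex_of_real c \<odot> y))"
    using r y f span_rel_in[OF f(1)] by (simp add: s_smult s_in emb_add emb_scaleR add.commute)
  ultimately show ?case by blast
qed

text \<open>This is \<open>generated_dense\<close> transported back through \<open>emb\<close>: the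
  isometry on finite sums has dense range.\<close>

lemma span_rel_dense:
  assumes x: "x \<in> carrier E"
  obtains X f where "\<And>n. span_rel (f n) (X n)" "hlim X x"
proof -
  have "\<exists>f w. span_rel f w \<and> hnorm E (w \<ominus> x) < inverse (real (Suc n))" for n
  proof -
    obtain m where m: "m \<in> typed.generated" "norm (emb x - m) < inverse (real (Suc n))"
      using typed.generated_dense[of "emb x" "inverse (real (Suc n))"] x by auto
    then obtain f w where f: "span_rel f w" "m = emb w" using generated_span_rel by blast
    then have "hnorm E (w \<ominus> x) < inverse (real (Suc n))"
      using m x span_rel_in[OF f(1)] by (simp flip: norm_emb add: emb_diff norm_minus_commute)
    then show ?thesis using f(1) by blast
  qed
  then obtain f X where f: "\<And>n. span_rel (f n) (X n)" "\<And>n. hnorm E (X n \<ominus> x) < inverse (real (Suc n))"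
    by metis
  have "(\<lambda>n. hnorm E (X n \<ominus> x)) \<longlonglongrightarrow> 0"
    by (rule tendsto_sandwich[OF _ _ tendsto_const LIMSEQ_inverse_real_of_nat])
      (use less_imp_le[OF f(2)] in \<open>auto simp: hnorm_nonneg intro!: always_eventually\<close>)
  then have "hlim X x" using x span_rel_in[OF f(1)] by (auto simp: hlim_iff)
  then show ?thesis using f(1) that by blast
qed

section \<open>The algebraic tensor product as domain of the isometry\<close>

abbreviation H :: "('b, real \<Rightarrow> 'e) hmodule" where
  "H \<equiv> L2_alg Fib"

lemma finsum_Fib_Suc:
  fixes n :: nat
  assumes "\<And>i. i < Suc n \<Longrightarrow> a i \<in> fiber"
  shows "(\<Oplus>\<^bsub>Fib\<^esub>i\<in>{..<Suc n}. a i) = (\<Oplus>\<^bsub>Fib\<^esub>i\<in>{..<n}. a i) \<oplus> a n"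
proof -
  interpret Fm: Module.module complex_ring Fib by (rule Fib_module)
  have "(\<Oplus>\<^bsub>Fib\<^esub>i\<in>{..<n}. a i) \<in> fiber"
    using Fm.finsum_closed[of a "{..<n}"] assms by (auto simp: Pi_iff)
  then show ?thesis
    using Fm.finsum_insert[of "{..<n}" n a] assms by (simp add: lessThan_Suc Pi_iff a_comm)
qed

text \<open>The relation reaches the whole span because every elementary tensor has an image by
  \<open>tensor_rel_ex\<close>.\<close>

lemma L2_span_iff: "f \<in> L2_span Fib \<longleftrightarrow> (\<exists>x. span_rel f x)"
proof
  interpret Fm: Module.module complex_ring Fib by (rule Fib_module)
  assume "f \<in> L2_span Fib"
  then obtain n :: nat and h y where hy: "\<And>i. i < n \<Longrightarrow> h i \<in> L2_halfline \<and> y i \<in> fiber"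
    and f: "f = (\<lambda>u. \<Oplus>\<^bsub>Fib\<^esub>i\<in>{..<n}. h i u \<odot> y i)"
    unfolding L2_span_def by auto
  have "\<exists>x. span_rel (\<lambda>u. \<Oplus>\<^bsub>Fib\<^esub>i\<in>{..<n}. h i u \<odot> y i) x"
    using hy
  proof (induction n)
    case 0
    then show ?case using span_rel.zero by auto
  next
    case (Suc n)
    then obtain x where "span_rel (\<lambda>u. \<Oplus>\<^bsub>Fib\<^esub>i\<in>{..<n}. h i u \<odot> y i) x" by auto
    moreover obtain w where "tensor_rel (y n) (h n) w" using Suc.prems[of n] tensor_rel_ex by auto
    ultimately have "span_rel (\<lambda>u. (\<Oplus>\<^bsub>Fib\<^esub>i\<in>{..<n}. h i u \<odot> y i) \<oplus> h n u \<odot> y n) (x \<oplus> w)"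
      by (rule span_rel.step)
    moreover have "(\<Oplus>\<^bsub>Fib\<^esub>i\<in>{..<Suc n}. h i u \<odot> y i) = (\<Oplus>\<^bsub>Fib\<^esub>i\<in>{..<n}. h i u \<odot> y i) \<oplus> h n u \<odot> y n" for u
      using Suc.prems by (intro finsum_Fib_Suc fiber_smult) auto
    ultimately show ?case by auto
  qed
  then show "\<exists>x. span_rel f x" unfolding f .
next
  interpret Fm: Module.module complex_ring Fib by (rule Fib_module)
  assume "\<exists>x. span_rel f x"
  then obtain x where "span_rel f x" ..
  then show "f \<in> L2_span Fib"
  proof (induction rule: span_rel.induct)
    case zero
    show ?case unfolding L2_span_def by (intro CollectI exI[of _ 0]) auto
  next
    case (step f x y h w)
    then obtain n :: nat and k z where kz: "\<And>i. i < n \<Longrightarrow> k i \<in> L2_halfline \<and> z i \<in> fiber"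
      and f: "f = (\<lambda>u. \<Oplus>\<^bsub>Fib\<^esub>i\<in>{..<n}. k i u \<odot> z i)"
      unfolding L2_span_def by auto
    note yh = tensor_rel_in[OF step(2)]
    let ?k = "k(n := h)" and ?z = "z(n := y)"
    have "f u \<oplus> h u \<odot> y = (\<Oplus>\<^bsub>Fib\<^esub>i\<in>{..<Suc n}. ?k i u \<odot> ?z i)" for u
    proof -
      let ?a = "\<lambda>i. ?k i u \<odot> ?z i"
      have a: "?a i \<in> fiber" if "i < Suc n" for i using that kz yh by (auto intro: fiber_smult)
      have "(\<Oplus>\<^bsub>Fib\<^esub>i\<in>{..<n}. ?a i) = f u"
        unfolding f by (rule Fm.finsum_cong') (use kz in \<open>auto intro: fiber_smult\<close>)
      then show ?thesis using finsum_Fib_Suc[of n ?a, OF a] by simp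
    qed
    then show ?case
      unfolding L2_span_def using kz yh
      by (intro CollectI exI[of _ "Suc n"] exI[of _ ?k] exI[of _ ?z]) (auto simp: less_Suc_eq)
  qed
qed

definition V0 :: "(real \<Rightarrow> 'e) \<Rightarrow> 'e" where
  "V0 f = (THE x. span_rel f x)"

lemma V0_eq: "span_rel f x \<Longrightarrow> V0 f = x"
  unfolding V0_def using span_rel_unique by blast

lemma H_simps:
  "carrier H = L2_span Fib" "f \<oplus>\<^bsub>H\<^esub> g = (\<lambda>u. f u \<oplus> g u)" "c \<odot>\<^bsub>H\<^esub> f = (\<lambda>u. c \<odot> f u)"
  "\<zero>\<^bsub>H\<^esub> = (\<lambda>u. \<zero>)" "ip H f g = integral {0..} (\<lambda>u. ip E (f u) (g u))"
  by (simp_all add: L2_alg_def)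

lemma H_rel: "f \<in> carrier H \<longleftrightarrow> span_rel f (V0 f)"
  using V0_eq by (auto simp: H_simps L2_span_iff)

lemma H_carrierI: "span_rel f x \<Longrightarrow> f \<in> carrier H"
  by (auto simp: H_simps L2_span_iff)

lemma V0_in: "f \<in> carrier H \<Longrightarrow> V0 f \<in> carrier E"
  using H_rel span_rel_in by blast

lemma H_add: "f \<in> carrier H \<Longrightarrow> g \<in> carrier H \<Longrightarrow> span_rel (f \<oplus>\<^bsub>H\<^esub> g) (V0 f \<oplus> V0 g)"
  using H_rel span_rel_add by (simp add: H_simps(2))

lemma H_smult: "f \<in> carrier H \<Longrightarrow> span_rel (c \<odot>\<^bsub>H\<^esub> f) (c \<odot> V0 f)"
  using H_rel span_rel_smult by (simp add: H_simps(3))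

lemma H_ip: "f \<in> carrier H \<Longrightarrow> g \<in> carrier H \<Longrightarrow> ip H f g = ip E (V0 f) (V0 g)"
  using H_rel span_rel_ip integral_unique by (metis H_simps(5))

lemma H_minus:
  assumes f: "f \<in> carrier H" and g: "g \<in> carrier H"
  shows "span_rel (f \<ominus>\<^bsub>H\<^esub> g) (V0 f \<ominus> V0 g)"
proof -
  have val: "g' u \<in> carrier E" if "g' \<in> carrier H" for g' u using that H_rel span_rel_in by auto
  have neg: "(-1) \<odot>\<^bsub>H\<^esub> g \<in> carrier H" using H_smult[OF g] by (rule H_carrierI)
  have "\<ominus>\<^bsub>H\<^esub> g = (-1) \<odot>\<^bsub>H\<^esub> g"
  proof (rule a_inv_eqI[OF g neg])
    show "g \<oplus>\<^bsub>H\<^esub> (-1) \<odot>\<^bsub>H\<^esub> g = \<zero>\<^bsub>H\<^esub>" "(-1) \<odot>\<^bsub>H\<^esub> g \<oplus>\<^bsub>H\<^esub> g = \<zero>\<^bsub>H\<^esub>"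
      using val[OF g] by (simp_all add: H_simps add_neg)
    fix g' assume "g' \<in> carrier H" "g \<oplus>\<^bsub>H\<^esub> g' = \<zero>\<^bsub>H\<^esub>"
    then show "g' = (-1) \<odot>\<^bsub>H\<^esub> g"
      using val g by (auto simp: H_simps(2-4) fun_eq_iff intro: add_eq_zero)
  qed
  then have "f \<ominus>\<^bsub>H\<^esub> g = f \<oplus>\<^bsub>H\<^esub> (-1) \<odot>\<^bsub>H\<^esub> g" by (simp add: a_minus_def)
  moreover have "V0 f \<ominus> V0 g = V0 f \<oplus> V0 ((-1) \<odot>\<^bsub>H\<^esub> g)"
    using f g V0_in V0_eq[OF H_smult[OF g]] by (simp add: minus_conv)
  ultimately show ?thesis using H_add[OF f neg] by simp
qed

lemma H_hnorm_minus:
  assumes "f \<in> carrier H" "g \<in> carrier H"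
  shows "hnorm H (f \<ominus>\<^bsub>H\<^esub> g) = hnorm E (V0 f \<ominus> V0 g)"
  using H_minus[OF assms] H_carrierI[OF H_minus[OF assms]] V0_eq[OF H_minus[OF assms]]
  by (simp add: hnorm_def H_ip)


section \<open>The completion\<close>

text \<open>A Cauchy sequence of functions is handled through the limit of its images in
  \<open>E\<close>, which takes the place of its class in the completion.\<close>

definition represents :: "(nat \<Rightarrow> real \<Rightarrow> 'e) \<Rightarrow> 'e \<Rightarrow> bool" where
  "represents X x \<longleftrightarrow> range X \<subseteq> carrier H \<and> hlim (\<lambda>n. V0 (X n)) x"

lemma hcauchy_H_iff: "hcauchy H X \<longleftrightarrow> range X \<subseteq> carrier H \<and> hcauchy E (\<lambda>n. V0 (X n))"
proof (cases "range X \<subseteq> carrier H")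
  case True
  then have "X n \<in> carrier H" for n by auto
  then show ?thesis using True by (auto simp: hcauchy_def H_hnorm_minus V0_in)
qed (simp add: hcauchy_def)

lemma represents_hcauchy: "represents X x \<Longrightarrow> hcauchy H X"
  unfolding represents_def hcauchy_H_iff using hlim_hcauchy by blast

lemma hcauchy_represents: "hcauchy H X \<Longrightarrow> \<exists>x. represents X x"
  using hcauchy_hlim by (auto simp: represents_def hcauchy_H_iff)

lemma represents_in: "represents X x \<Longrightarrow> x \<in> carrier E" "represents X x \<Longrightarrow> X n \<in> carrier H"
  by (auto simp: represents_def hlim_in)

lemma represents_unique: "represents X x \<Longrightarrow> represents X y \<Longrightarrow> x = y"
  using hlim_unique by (auto simp: represents_def)

lemma represents_ex: "x \<in> carrier E \<Longrightarrow> \<exists>X. represents X x"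
proof -
  assume "x \<in> carrier E"
  then obtain f X where f: "\<And>n. span_rel (f n) (X n)" "hlim X x" using span_rel_dense by metis
  then have "represents f x" using H_carrierI[OF f(1)] V0_eq[OF f(1)] by (auto simp: represents_def)
  then show "\<exists>X. represents X x" by blast
qed

text \<open>The distances of the functions are those of their images and tend to the distance of
  \<open>x\<close> and \<open>y\<close>, so two sequences are equivalent exactly when their images
  have the same limit.\<close>

lemma completion_rel_iff:
  assumes X: "represents X x" and Y: "represents Y y"
  shows "(X, Y) \<in> completion_rel H \<longleftrightarrow> x = y"
proof -
  have in_H: "X n \<in> carrier H" "Y n \<in> carrier H" for n using X Y represents_in by blast+
  have lim: "(\<lambda>n. hnorm E (V0 (X n) \<ominus> V0 (Y n))) \<longlonglongrightarrow> norm (emb x - emb y)"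
  proof -
    have "(\<lambda>n. norm (emb (V0 (X n)) - emb (V0 (Y n)))) \<longlonglongrightarrow> norm (emb x - emb y)"
      using X Y by (intro tendsto_norm tendsto_diff) (auto simp: represents_def hlim_def)
    then show ?thesis using in_H V0_in by (simp flip: norm_emb add: emb_diff)
  qed
  have "(X, Y) \<in> completion_rel H \<longleftrightarrow> (\<lambda>n. hnorm E (V0 (X n) \<ominus> V0 (Y n))) \<longlonglongrightarrow> 0"
    using represents_hcauchy[OF X] represents_hcauchy[OF Y] in_H
    by (simp add: completion_rel_def H_hnorm_minus)
  also have "\<dots> \<longleftrightarrow> norm (emb x - emb y) = 0"
    using lim LIMSEQ_unique[OF lim, of 0] by auto
  also have "\<dots> \<longleftrightarrow> x = y"
    using represents_in(1)[OF X] represents_in(1)[OF Y] emb_inj by (auto dest: inj_onD)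
  finally show ?thesis .
qed

text \<open>The inverse of the unitary \<open>V\<close>.\<close>

definition cls :: "'e \<Rightarrow> (nat \<Rightarrow> real \<Rightarrow> 'e) set" where
  "cls x = {X. represents X x}"

lemma completion_class_eq:
  assumes X: "represents X x" shows "completion_class H X = cls x"
proof -
  have "(X, Y) \<in> completion_rel H \<longleftrightarrow> represents Y x" for Y
  proof
    assume XY: "(X, Y) \<in> completion_rel H"
    then obtain y where "represents Y y" using hcauchy_represents by (auto simp: completion_rel_def)
    then show "represents Y x" using completion_rel_iff[OF X] XY by blast
  next
    assume "represents Y x"
    then show "(X, Y) \<in> completion_rel H" using completion_rel_iff[OF X] by blast
  qed
  then show ?thesis by (auto simp: completion_class_def cls_def)
qed

text \<open>The operations of \<open>completion\<close> act on representatives chosen by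
  \<open>SOME\<close>, and this is the fact about the choice that the computations below
  use.\<close>

lemma represents_rep:
  assumes "x \<in> carrier E" shows "represents (completion_rep (cls x)) x"
proof -
  obtain X where "represents X x" using represents_ex[OF assms] ..
  then have "X \<in> cls x" by (simp add: cls_def)
  then have "completion_rep (cls x) \<in> cls x" using someI[of "\<lambda>Z. Z \<in> cls x" X] unfolding completion_rep_def by blast
  then show ?thesis by (simp add: cls_def)
qed

lemma cls_inj: "inj_on cls (carrier E)"
  using represents_rep represents_unique by (metis inj_onI)

text \<open>The density of the range enters here: by \<open>represents_ex\<close> every vector of
  \<open>E\<close> is the limit of the images of some sequence of functions.\<close>

lemma L2_carrier: "carrier (L2 Fib) = cls ` carrier E"
proof -
  have "carrier (L2 Fib) = completion_class H ` {X. hcauchy H X}"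
    by (auto simp: L2_def completion_def quotient_def completion_class_def)
  also have "\<dots> = cls ` carrier E"
  proof (intro equalityI subsetI)
    fix A assume "A \<in> completion_class H ` {X. hcauchy H X}"
    then obtain X where "hcauchy H X" "A = completion_class H X" by auto
    then show "A \<in> cls ` carrier E"
      using hcauchy_represents completion_class_eq represents_in(1) by blast
  next
    fix A assume "A \<in> cls ` carrier E"
    then obtain x where x: "x \<in> carrier E" "A = cls x" by auto
    then show "A \<in> completion_class H ` {X. hcauchy H X}"
      using represents_rep[OF x(1)] completion_class_eq represents_hcauchy by blast
  qed
  finally show ?thesis .
qed

section \<open>Operations on the completion, read in \<open>E\<close>\<close>

lemma L2_add: "x \<in> carrier E \<Longrightarrow> y \<in> carrier E \<Longrightarrow> cls x \<oplus>\<^bsub>L2 Fib\<^esub> cls y = cls (x \<oplus> y)"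
proof -
  assume x: "x \<in> carrier E" and y: "y \<in> carrier E"
  let ?X = "completion_rep (cls x)" and ?Y = "completion_rep (cls y)"
  note rep = represents_rep[OF x] represents_rep[OF y]
  have sum: "span_rel (?X n \<oplus>\<^bsub>H\<^esub> ?Y n) (V0 (?X n) \<oplus> V0 (?Y n))" for n
    using rep by (intro H_add represents_in(2))
  have "represents (\<lambda>n. ?X n \<oplus>\<^bsub>H\<^esub> ?Y n) (x \<oplus> y)"
    using rep hlim_add H_carrierI[OF sum] V0_eq[OF sum] by (auto simp: represents_def)
  then show ?thesis using completion_class_eq by (simp add: L2_def completion_def)
qed

lemma L2_smult: "x \<in> carrier E \<Longrightarrow> c \<odot>\<^bsub>L2 Fib\<^esub> cls x = cls (c \<odot> x)"
proof -
  assume x: "x \<in> carrier E"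
  let ?X = "completion_rep (cls x)"
  note rep = represents_rep[OF x]
  have sm: "span_rel (c \<odot>\<^bsub>H\<^esub> ?X n) (c \<odot> V0 (?X n))" for n
    using rep by (intro H_smult represents_in(2))
  have "represents (\<lambda>n. c \<odot>\<^bsub>H\<^esub> ?X n) (c \<odot> x)"
    using rep hlim_smult H_carrierI[OF sm] V0_eq[OF sm] by (auto simp: represents_def)
  then show ?thesis using completion_class_eq by (simp add: L2_def completion_def)
qed

lemma L2_ip:
  assumes x: "x \<in> carrier E" and y: "y \<in> carrier E"
  shows "ip (L2 Fib) (cls x) (cls y) = ip E x y"
proof -
  let ?X = "completion_rep (cls x)" and ?Y = "completion_rep (cls y)"
  note rep = represents_rep[OF x] represents_rep[OF y]
  have "(\<lambda>n. ip E (V0 (?X n)) (V0 (?Y n))) \<longlonglongrightarrow> ip E x y"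
    using rep by (intro hlim_ip) (auto simp: represents_def)
  then have "(\<lambda>n. ip H (?X n) (?Y n)) \<longlonglongrightarrow> ip E x y"
    using represents_in(2)[OF rep(1)] represents_in(2)[OF rep(2)] by (simp add: H_ip)
  then show ?thesis by (simp add: L2_def completion_def limI)
qed

lemma right_shift_cls:
  assumes x: "x \<in> carrier E" and t: "0 \<le> t"
  shows "right_shift Fib t (cls x) = cls (s t x)"
proof -
  let ?X = "completion_rep (cls x)"
  note rep = represents_rep[OF x]
  have sh: "span_rel (shift_fun Fib t (?X n)) (s t (V0 (?X n)))" for n
    using represents_in(2)[OF rep, of n] t by (intro span_rel_shift) (simp_all add: H_rel)
  have "hlim (\<lambda>n. s t (V0 (?X n))) (s t x)"
    using rep by (intro hlim_isometry[OF s_isometry[OF t]]) (simp add: represents_def)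
  then have "represents (\<lambda>n. shift_fun Fib t (?X n)) (s t x)"
    using H_carrierI[OF sh] V0_eq[OF sh] by (auto simp: represents_def)
  then show ?thesis unfolding right_shift_def by (rule completion_class_eq)
qed

section \<open>The unitary and its adjoint\<close>

definition V :: "(nat \<Rightarrow> real \<Rightarrow> 'e) set \<Rightarrow> 'e" where
  "V = inv_into (carrier E) cls"

lemma V_cls: "x \<in> carrier E \<Longrightarrow> V (cls x) = x"
  by (simp add: V_def cls_inj)

lemma V_unitary: "hunitary (L2 Fib) E V"
proof -
  have "V ` carrier (L2 Fib) = carrier E" by (force simp: L2_carrier V_cls image_image)
  then show ?thesis
    unfolding hunitary_def hisometry_def hlinear_def
    by (auto simp: L2_carrier L2_add L2_smult L2_ip V_cls)
qed

text \<open>The adjoint of a unitary is its inverse. As \<open>hadjoint\<close> is a description,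
  uniqueness is shown as well, from nondegeneracy of \<open>ip E\<close>.\<close>

lemma hadjoint_V:
  assumes x: "x \<in> carrier E" shows "hadjoint (L2 Fib) E V x = cls x"
  unfolding hadjoint_def
proof (rule the_equality)
  show "cls x \<in> carrier (L2 Fib) \<and> (\<forall>z\<in>carrier (L2 Fib). ip E (V z) x = ip (L2 Fib) z (cls x))"
    using x by (auto simp: L2_carrier L2_ip V_cls)
  fix A assume A: "A \<in> carrier (L2 Fib) \<and> (\<forall>z\<in>carrier (L2 Fib). ip E (V z) x = ip (L2 Fib) z A)"
  then obtain y where y: "y \<in> carrier E" "A = cls y" by (auto simp: L2_carrier)
  have "y = x"
  proof (rule ip_eqI[OF y(1) x])
    fix z assume "z \<in> carrier E"
    then show "ip E z y = ip E z x" using A y by (auto simp: L2_carrier L2_ip V_cls)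
  qed
  then show "A = cls x" using y by simp
qed

theorem unitarily_equivalent_shift:
  "t \<ge> 0 \<Longrightarrow> x \<in> carrier E \<Longrightarrow> s t x = V (right_shift Fib t (hadjoint (L2 Fib) E V x))"
  by (simp add: hadjoint_V right_shift_cls V_cls s_in)

end

theorem theorem1p2:
  fixes E :: "('b::cstar_algebra, 'e) hmodule"
    and s :: "real \<Rightarrow> 'e \<Rightarrow> 'e"
  assumes "hilbert_module E"
    and "hsemigroup E s"
    and "strongly_continuous E s"
    and "adjointable_isometries E s"
    and "pure_semigroup E s"
  shows "\<exists>(F :: ('b, 'e) hmodule) (V :: (nat \<Rightarrow> real \<Rightarrow> 'e) set \<Rightarrow> 'e).
           hilbert_module F \<and> hunitary (L2 F) E V \<and>
           (\<forall>t\<ge>0. \<forall>x \<in> carrier E.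
              s t x = V (right_shift F t (hadjoint (L2 F) E V x)))"
proof -
  interpret pure_shift_semigroup E s
    using assms by (simp add: pure_shift_semigroup_def pure_shift_semigroup_axioms_def)
  show ?thesis
    using Fib_hilbert_module V_unitary unitarily_equivalent_shift by blast
qed

end
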